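(* Let $(M,g,f)$ be an isotropic locally homogeneous Lorentzian steady gradient Ricci soliton, i.e. $(M,g)$ is a locally homogeneous Lorentzian manifold and $f\in C^\infty(M)$ satisfies $\operatorname{Hess}_f+\rho=0$ and $\|\nabla f\|^2=0$. Then one of the following two possibilities pertains: (1) $\mathcal{H}_f=-\operatorname{Ric}$ has rank $2$ and is $3$-step nilpotent. (2) $\mathcal{H}_f=-\operatorname{Ric}$ has rank $1$ and is $2$-step nilpotent. In this case $(M,g)$ is locally a strict Walker manifold; more specifically: (a) $\ker\{\mathcal{H}_f\}=\nabla f^\perp$ and $\operatorname{Image}\{\mathcal{H}_f\}=\nabla f$ (that is, the image is the line spanned by $\nabla f$). (b) $\nabla f$ is a recurrent vector field, and $\nabla f^\perp$ is an integrable totally geodesic distribution with leaves the level sets of $f$. (c) Let $P\in M$. At least one of the following possibilities holds near $P$: (i) there exists a Killing vector field $F$ so that $\operatorname{grad}\{F(f)\}$ is a null parallel vector field; (ii) there exists a smooth function $\psi$ defined near $P$ so that $\psi\,\nabla f$ is a null parallel vector field.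
   Context: $M$ has dimension $n+2$ with $n\ge1$. $\rho$ is the Ricci tensor and $\operatorname{Ric}$ the Ricci operator, $\rho(X,Y)=g(\operatorname{Ric}X,Y)$; $\nabla f=\operatorname{grad}\{f\}$ is the gradient of $f$ (the vector field dual to $df$), $\|\nabla f\|^2=g(\nabla f,\nabla f)$, $\operatorname{Hess}_f(X,Y)=XY(f)-(\nabla_XY)(f)$ is the Hessian, and $\mathcal{H}_f(X)=\nabla_X(\nabla f)$ is the Hessian operator. $\nabla f^\perp$ is the distribution of vectors orthogonal to $\nabla f$. An endomorphism field $T$ is $k$-step nilpotent if $T^k=0$ and $T^{k-1}\ne0$. A tensor $T$ is recurrent if there is a smooth $1$-form $\omega$ with $\nabla_XT=\omega(X)T$ for all $X$. A vector field $F$ is Killing if $\mathcal{L}_Fg=0$, where $\mathcal{L}$ is the Lie derivative. A null parallel vector field is a non-trivial vector field $V$ with $\nabla V=0$ and $g(V,V)=0$. A Lorentzian manifold is strict Walker if it admits a parallel null line field spanned by a parallel null vector field.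
   Formalization: The formal theorem additionally assumes that ∇f vanishes nowhere and that Ric is not identically zero; without these the claim fails (Cahen–Wallach space with f = a u²/2 at u = 0; Minkowski space with f = x + t). *)

theory Defs
  imports "HOL-Analysis.Analysis"
begin

section \<open>Smooth functions on open sets\<close>

text \<open>Both notions are only meant for open \<open>S\<close>; the derivative is the full one, not the one within \<open>S\<close>.\<close>

fun Ck_on :: "nat \<Rightarrow> 'a::real_normed_vector set \<Rightarrow> ('a \<Rightarrow> 'b::real_normed_vector) \<Rightarrow> bool" where
  "Ck_on 0 S f \<longleftrightarrow> continuous_on S f"
| "Ck_on (Suc k) S f \<longleftrightarrow> (\<forall>x\<in>S. f differentiable (at x)) \<and>
     (\<forall>v. Ck_on k S (\<lambda>x. frechet_derivative f (at x) v))"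

definition smooth_on :: "'a::real_normed_vector set \<Rightarrow> ('a \<Rightarrow> 'b::real_normed_vector) \<Rightarrow> bool" where
  "smooth_on S f \<longleftrightarrow> (\<forall>k. Ck_on k S f)"


section \<open>Pseudo-Riemannian geometry in one coordinate system\<close>

text \<open>Here \<open>G\<close> is the coordinate expression of a metric: \<open>G x\<close> is the bilinear form at the coordinate
  point \<open>x\<close>.  Vector fields are maps \<open>real^'d \<Rightarrow> real^'d\<close>, so that \<open>\<lambda>_. u\<close> is the vector field with
  constant components extending the vector \<open>u\<close>; tensorial expressions are evaluated on vectors by means
  of this extension.  All expressions depend only on germs at the point of evaluation.\<close>

type_synonym 'd form_field = "real^'d \<Rightarrow> real^'d \<Rightarrow> real^'d \<Rightarrow> real"
type_synonym 'd local_field = "real^'d \<Rightarrow> real^'d"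

definition dir_deriv :: "'d::finite local_field \<Rightarrow> (real^'d \<Rightarrow> 'b::real_normed_vector) \<Rightarrow> real^'d \<Rightarrow> 'b" where
  "dir_deriv X h x = frechet_derivative h (at x) (X x)"

definition lie_bracket :: "'d::finite local_field \<Rightarrow> 'd local_field \<Rightarrow> 'd local_field" where
  "lie_bracket X Y x = dir_deriv X Y x - dir_deriv Y X x"

definition sharp :: "'d::finite form_field \<Rightarrow> real^'d \<Rightarrow> (real^'d \<Rightarrow> real) \<Rightarrow> real^'d" where
  "sharp G x \<alpha> = (THE v. \<forall>w. G x v w = \<alpha> w)"

text \<open>The Koszul formula for fields with constant components, which commute.\<close>

definition christoffel :: "'d::finite form_field \<Rightarrow> real^'d \<Rightarrow> real^'d \<Rightarrow> real^'d \<Rightarrow> real^'d" where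
  "christoffel G x u v = sharp G x (\<lambda>w.
     (frechet_derivative (\<lambda>y. G y v w) (at x) u + frechet_derivative (\<lambda>y. G y u w) (at x) v
       - frechet_derivative (\<lambda>y. G y u v) (at x) w) / 2)"

definition nabla :: "'d::finite form_field \<Rightarrow> 'd local_field \<Rightarrow> 'd local_field \<Rightarrow> 'd local_field" where
  "nabla G X Y x = dir_deriv X Y x + christoffel G x (X x) (Y x)"

definition curvature ::
    "'d::finite form_field \<Rightarrow> 'd local_field \<Rightarrow> 'd local_field \<Rightarrow> 'd local_field \<Rightarrow> 'd local_field" where
  "curvature G X Y Z x =
     nabla G X (nabla G Y Z) x - nabla G Y (nabla G X Z) x - nabla G (lie_bracket X Y) Z x"

definition ricci :: "'d::finite form_field \<Rightarrow> 'd form_field" where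
  "ricci G x u v = trace (matrix (\<lambda>w. curvature G (\<lambda>_. w) (\<lambda>_. u) (\<lambda>_. v) x))"

definition ricci_op :: "'d::finite form_field \<Rightarrow> real^'d \<Rightarrow> real^'d \<Rightarrow> real^'d" where
  "ricci_op G x u = sharp G x (ricci G x u)"

definition grad :: "'d::finite form_field \<Rightarrow> (real^'d \<Rightarrow> real) \<Rightarrow> 'd local_field" where
  "grad G h x = sharp G x (frechet_derivative h (at x))"

definition hess ::
    "'d::finite form_field \<Rightarrow> (real^'d \<Rightarrow> real) \<Rightarrow> 'd local_field \<Rightarrow> 'd local_field \<Rightarrow> real^'d \<Rightarrow> real" where
  "hess G h X Y x = dir_deriv X (dir_deriv Y h) x - dir_deriv (nabla G X Y) h x"

definition hess_op :: "'d::finite form_field \<Rightarrow> (real^'d \<Rightarrow> real) \<Rightarrow> real^'d \<Rightarrow> real^'d \<Rightarrow> real^'d" where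
  "hess_op G h x u = nabla G (\<lambda>_. u) (grad G h) x"

definition lie_deriv_metric ::
    "'d::finite form_field \<Rightarrow> 'd local_field \<Rightarrow> 'd local_field \<Rightarrow> 'd local_field \<Rightarrow> real^'d \<Rightarrow> real" where
  "lie_deriv_metric G F X Y x =
     dir_deriv F (\<lambda>y. G y (X y) (Y y)) x - G x (lie_bracket F X x) (Y x) - G x (X x) (lie_bracket F Y x)"

definition nilpotent_step :: "nat \<Rightarrow> ('a::real_vector \<Rightarrow> 'a) \<Rightarrow> bool" where
  "nilpotent_step k T \<longleftrightarrow> (T ^^ k) = (\<lambda>_. 0) \<and> (T ^^ (k - 1)) \<noteq> (\<lambda>_. 0)"

definition endo_rank :: "(real^'d::finite \<Rightarrow> real^'d) \<Rightarrow> nat" where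
  "endo_rank T = dim (range T)"

definition lorentzian_form :: "(real^'d::finite \<Rightarrow> real^'d \<Rightarrow> real) \<Rightarrow> bool" where
  "lorentzian_form B \<longleftrightarrow> bilinear B \<and> (\<forall>u v. B u v = B v u) \<and>
     (\<exists>(e :: 'd \<Rightarrow> real^'d) i0. \<forall>i j. B (e i) (e j) = (if i = j then if i = i0 then - 1 else 1 else 0))"


section \<open>Manifolds\<close>

text \<open>A chart is a pair of its domain and its coordinate map.  The manifold described by an atlas is the
  union of the chart domains, an open subset of a Hausdorff second countable space.\<close>

type_synonym ('m, 'd) chart = "'m set \<times> ('m \<Rightarrow> real^'d)"

definition chart_inv :: "('m, 'd::finite) chart \<Rightarrow> real^'d \<Rightarrow> 'm" where
  "chart_inv c = inv_into (fst c) (snd c)"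

definition coords :: "('m, 'd::finite) chart \<Rightarrow> 'm set \<Rightarrow> (real^'d) set" where
  "coords c W = snd c ` (fst c \<inter> W)"

definition transition :: "('m, 'd::finite) chart \<Rightarrow> ('m, 'd) chart \<Rightarrow> real^'d \<Rightarrow> real^'d" where
  "transition c c' = snd c' \<circ> chart_inv c"

definition smooth_atlas ::
    "('m::{t2_space, second_countable_topology}, 'd::finite) chart set \<Rightarrow> bool" where
  "smooth_atlas A \<longleftrightarrow>
     (\<forall>c\<in>A. open (fst c) \<and> open (coords c UNIV) \<and>
        homeomorphism (fst c) (coords c UNIV) (snd c) (chart_inv c)) \<and>
     (\<forall>c\<in>A. \<forall>c'\<in>A. smooth_on (coords c (fst c')) (transition c c'))"

definition carrier :: "('m, 'd::finite) chart set \<Rightarrow> 'm set" where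
  "carrier A = \<Union> (fst ` A)"

definition local_rep :: "('m \<Rightarrow> 'b) \<Rightarrow> ('m, 'd::finite) chart \<Rightarrow> real^'d \<Rightarrow> 'b" where
  "local_rep h c = h \<circ> chart_inv c"

definition smooth_fun :: "('m, 'd::finite) chart set \<Rightarrow> 'm set \<Rightarrow> ('m \<Rightarrow> real) \<Rightarrow> bool" where
  "smooth_fun A W h \<longleftrightarrow> (\<forall>c\<in>A. smooth_on (coords c W) (local_rep h c))"

definition smooth_map :: "('m, 'd::finite) chart set \<Rightarrow> 'm set \<Rightarrow> ('m \<Rightarrow> 'm) \<Rightarrow> bool" where
  "smooth_map A W \<phi> \<longleftrightarrow>
     (\<forall>c\<in>A. \<forall>c'\<in>A. smooth_on (coords c (W \<inter> \<phi> -` fst c')) (snd c' \<circ> \<phi> \<circ> chart_inv c))"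

text \<open>Tensor fields on an open subset \<open>W\<close> of the manifold are families of coordinate expressions, one for
  each chart of the atlas and depending on the coordinate point, which satisfy the transformation law.\<close>

type_synonym ('m, 'd) vfield = "('m, 'd) chart \<Rightarrow> 'd local_field"
type_synonym ('m, 'd) metric = "('m, 'd) chart \<Rightarrow> 'd form_field"
type_synonym ('m, 'd) oneform = "('m, 'd) chart \<Rightarrow> real^'d \<Rightarrow> real^'d \<Rightarrow> real"
type_synonym ('m, 'd) subspace_field = "('m, 'd) chart \<Rightarrow> real^'d \<Rightarrow> (real^'d) set"

definition vector_field :: "('m, 'd::finite) chart set \<Rightarrow> 'm set \<Rightarrow> ('m, 'd) vfield \<Rightarrow> bool" where
  "vector_field A W X \<longleftrightarrow>
     (\<forall>c\<in>A. smooth_on (coords c W) (X c)) \<and>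
     (\<forall>c\<in>A. \<forall>c'\<in>A. \<forall>x\<in>coords c (fst c' \<inter> W).
        X c' (transition c c' x) = frechet_derivative (transition c c') (at x) (X c x))"

definition one_form :: "('m, 'd::finite) chart set \<Rightarrow> 'm set \<Rightarrow> ('m, 'd) oneform \<Rightarrow> bool" where
  "one_form A W \<omega> \<longleftrightarrow>
     (\<forall>c\<in>A. (\<forall>x\<in>coords c W. linear (\<omega> c x)) \<and> (\<forall>v. smooth_on (coords c W) (\<lambda>x. \<omega> c x v))) \<and>
     (\<forall>c\<in>A. \<forall>c'\<in>A. \<forall>x\<in>coords c (fst c' \<inter> W). \<forall>v.
        \<omega> c' (transition c c' x) (frechet_derivative (transition c c') (at x) v) = \<omega> c x v)"

definition lorentzian_metric :: "('m, 'd::finite) chart set \<Rightarrow> ('m, 'd) metric \<Rightarrow> bool" where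
  "lorentzian_metric A g \<longleftrightarrow>
     (\<forall>c\<in>A. (\<forall>x\<in>coords c UNIV. lorentzian_form (g c x)) \<and>
        (\<forall>u v. smooth_on (coords c UNIV) (\<lambda>x. g c x u v))) \<and>
     (\<forall>c\<in>A. \<forall>c'\<in>A. \<forall>x\<in>coords c (fst c'). \<forall>u v.
        g c' (transition c c' x) (frechet_derivative (transition c c') (at x) u)
          (frechet_derivative (transition c c') (at x) v) = g c x u v)"

definition lorentzian_manifold ::
    "('m::{t2_space, second_countable_topology}, 'd::finite) chart set \<Rightarrow> ('m, 'd) metric \<Rightarrow> bool" where
  "lorentzian_manifold A g \<longleftrightarrow> smooth_atlas A \<and> lorentzian_metric A g"


section \<open>Local isometries, Killing fields and parallel fields\<close>

definition local_isometry ::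
    "('m::topological_space, 'd::finite) chart set \<Rightarrow> ('m, 'd) metric \<Rightarrow> 'm set \<Rightarrow> 'm set \<Rightarrow> ('m \<Rightarrow> 'm) \<Rightarrow> bool" where
  "local_isometry A g W W' \<phi> \<longleftrightarrow>
     open W \<and> W \<subseteq> carrier A \<and> open W' \<and> W' \<subseteq> carrier A \<and>
     homeomorphism W W' \<phi> (inv_into W \<phi>) \<and>
     smooth_map A W \<phi> \<and> smooth_map A W' (inv_into W \<phi>) \<and>
     (\<forall>c\<in>A. \<forall>c'\<in>A. \<forall>x\<in>coords c (W \<inter> \<phi> -` fst c'). \<forall>u v.
        let \<psi> = snd c' \<circ> \<phi> \<circ> chart_inv c in
        g c' (\<psi> x) (frechet_derivative \<psi> (at x) u) (frechet_derivative \<psi> (at x) v) = g c x u v)"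

definition locally_homogeneous ::
    "('m::topological_space, 'd::finite) chart set \<Rightarrow> ('m, 'd) metric \<Rightarrow> bool" where
  "locally_homogeneous A g \<longleftrightarrow>
     (\<forall>p\<in>carrier A. \<forall>q\<in>carrier A. \<exists>W W' \<phi>. local_isometry A g W W' \<phi> \<and> p \<in> W \<and> \<phi> p = q)"

definition gradient :: "('m, 'd::finite) metric \<Rightarrow> ('m \<Rightarrow> real) \<Rightarrow> ('m, 'd) vfield" where
  "gradient g h c = grad (g c) (local_rep h c)"

text \<open>\<open>gradient_along g F f\<close> is the vector field \<open>grad {F(f)}\<close>; the function \<open>F(f)\<close> is represented by its coordinate expressions.\<close>

definition gradient_along ::
    "('m, 'd::finite) metric \<Rightarrow> ('m, 'd) vfield \<Rightarrow> ('m \<Rightarrow> real) \<Rightarrow> ('m, 'd) vfield" where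
  "gradient_along g F f c = grad (g c) (dir_deriv (F c) (local_rep f c))"

definition steady_gradient_ricci_soliton ::
    "('m, 'd::finite) chart set \<Rightarrow> ('m, 'd) metric \<Rightarrow> ('m \<Rightarrow> real) \<Rightarrow> bool" where
  "steady_gradient_ricci_soliton A g f \<longleftrightarrow> smooth_fun A (carrier A) f \<and>
     (\<forall>c\<in>A. \<forall>x\<in>coords c UNIV. \<forall>u v.
        hess (g c) (local_rep f c) (\<lambda>_. u) (\<lambda>_. v) x + ricci (g c) x u v = 0)"

definition killing_field ::
    "('m, 'd::finite) chart set \<Rightarrow> ('m, 'd) metric \<Rightarrow> 'm set \<Rightarrow> ('m, 'd) vfield \<Rightarrow> bool" where
  "killing_field A g W F \<longleftrightarrow> vector_field A W F \<and>
     (\<forall>c\<in>A. \<forall>x\<in>coords c W. \<forall>u v. lie_deriv_metric (g c) (F c) (\<lambda>_. u) (\<lambda>_. v) x = 0)"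

text \<open>Non-trivial means not identically zero; a parallel field on a connected \<open>W\<close> then vanishes nowhere.\<close>

definition null_parallel_field ::
    "('m, 'd::finite) chart set \<Rightarrow> ('m, 'd) metric \<Rightarrow> 'm set \<Rightarrow> ('m, 'd) vfield \<Rightarrow> bool" where
  "null_parallel_field A g W V \<longleftrightarrow> vector_field A W V \<and>
     (\<exists>c\<in>A. \<exists>x\<in>coords c W. V c x \<noteq> 0) \<and>
     (\<forall>c\<in>A. \<forall>x\<in>coords c W. g c x (V c x) (V c x) = 0 \<and> (\<forall>u. nabla (g c) (\<lambda>_. u) (V c) x = 0))"

definition recurrent_field ::
    "('m, 'd::finite) chart set \<Rightarrow> ('m, 'd) metric \<Rightarrow> 'm set \<Rightarrow> ('m, 'd) vfield \<Rightarrow> bool" where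
  "recurrent_field A g W V \<longleftrightarrow> vector_field A W V \<and>
     (\<exists>\<omega>. one_form A W \<omega> \<and>
        (\<forall>c\<in>A. \<forall>x\<in>coords c W. \<forall>u. nabla (g c) (\<lambda>_. u) (V c) x = \<omega> c x u *\<^sub>R V c x))"


section \<open>Distributions\<close>

definition distribution ::
    "('m, 'd::finite) chart set \<Rightarrow> 'm set \<Rightarrow> nat \<Rightarrow> ('m, 'd) subspace_field \<Rightarrow> bool" where
  "distribution A W k D \<longleftrightarrow>
     (\<forall>c\<in>A. \<forall>x\<in>coords c W. subspace (D c x) \<and> dim (D c x) = k \<and>
        (\<exists>S B. open S \<and> x \<in> S \<and> S \<subseteq> coords c W \<and> (\<forall>i<k. smooth_on S (B i)) \<and>
           (\<forall>y\<in>S. D c y = span ((\<lambda>i. B i y) ` {..<k})))) \<and>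
     (\<forall>c\<in>A. \<forall>c'\<in>A. \<forall>x\<in>coords c (fst c' \<inter> W).
        frechet_derivative (transition c c') (at x) ` D c x = D c' (transition c c' x))"

definition section_of ::
    "('m, 'd::finite) chart set \<Rightarrow> 'm set \<Rightarrow> ('m, 'd) subspace_field \<Rightarrow> ('m, 'd) vfield \<Rightarrow> bool" where
  "section_of A W D Y \<longleftrightarrow> vector_field A W Y \<and> (\<forall>c\<in>A. \<forall>x\<in>coords c W. Y c x \<in> D c x)"

definition parallel_distribution ::
    "('m::topological_space, 'd::finite) chart set \<Rightarrow> ('m, 'd) metric \<Rightarrow> 'm set \<Rightarrow> ('m, 'd) subspace_field \<Rightarrow> bool" where
  "parallel_distribution A g W D \<longleftrightarrow>
     (\<forall>U X Y. open U \<and> U \<subseteq> W \<and> vector_field A U X \<and> section_of A U D Y \<longrightarrow>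
        (\<forall>c\<in>A. \<forall>x\<in>coords c U. nabla (g c) (X c) (Y c) x \<in> D c x))"

definition totally_geodesic_distribution ::
    "('m::topological_space, 'd::finite) chart set \<Rightarrow> ('m, 'd) metric \<Rightarrow> 'm set \<Rightarrow> ('m, 'd) subspace_field \<Rightarrow> bool" where
  "totally_geodesic_distribution A g W D \<longleftrightarrow>
     (\<forall>U X Y. open U \<and> U \<subseteq> W \<and> section_of A U D X \<and> section_of A U D Y \<longrightarrow>
        (\<forall>c\<in>A. \<forall>x\<in>coords c U. nabla (g c) (X c) (Y c) x \<in> D c x))"

text \<open>\<open>N\<close> is an embedded submanifold with tangent spaces \<open>D\<close>: near each of its points there is a
  diffeomorphism \<open>\<Psi>\<close> straightening \<open>N\<close> to a linear subspace \<open>E\<close>, and the tangent space at \<open>y\<close> is the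
  preimage of \<open>E\<close> under the derivative of \<open>\<Psi>\<close>.\<close>

definition integral_manifold ::
    "('m, 'd::finite) chart set \<Rightarrow> ('m, 'd) subspace_field \<Rightarrow> 'm set \<Rightarrow> bool" where
  "integral_manifold A D N \<longleftrightarrow> N \<subseteq> carrier A \<and>
     (\<forall>c\<in>A. \<forall>x\<in>coords c N. \<exists>S (\<Psi> :: real^'d \<Rightarrow> real^'d) E.
        open S \<and> x \<in> S \<and> S \<subseteq> coords c UNIV \<and>
        inj_on \<Psi> S \<and> open (\<Psi> ` S) \<and> smooth_on S \<Psi> \<and> smooth_on (\<Psi> ` S) (inv_into S \<Psi>) \<and>
        subspace E \<and> \<Psi> ` (S \<inter> coords c N) = \<Psi> ` S \<inter> E \<and>
        (\<forall>y\<in>S \<inter> coords c N. D c y = {v. frechet_derivative \<Psi> (at y) v \<in> E}))"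

definition integrable_distribution ::
    "('m, 'd::finite) chart set \<Rightarrow> ('m, 'd) subspace_field \<Rightarrow> bool" where
  "integrable_distribution A D \<longleftrightarrow> (\<forall>p\<in>carrier A. \<exists>N. integral_manifold A D N \<and> p \<in> N)"

text \<open>Integral manifolds being embedded here, this is the notion of leaf for distributions whose maximal
  connected integral manifolds are embedded, such as those tangent to the level sets of a function
  without critical points.\<close>

definition leaf ::
    "('m::topological_space, 'd::finite) chart set \<Rightarrow> ('m, 'd) subspace_field \<Rightarrow> 'm set \<Rightarrow> bool" where
  "leaf A D N \<longleftrightarrow> integral_manifold A D N \<and> connected N \<and> N \<noteq> {} \<and>
     (\<forall>N'. integral_manifold A D N' \<and> connected N' \<and> N \<subseteq> N' \<longrightarrow> N' = N)"

definition orthogonal_distribution :: "('m, 'd::finite) metric \<Rightarrow> ('m, 'd) vfield \<Rightarrow> ('m, 'd) subspace_field" where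
  "orthogonal_distribution g V c x = {v. g c x v (V c x) = 0}"

definition strict_walker ::
    "('m::topological_space, 'd::finite) chart set \<Rightarrow> ('m, 'd) metric \<Rightarrow> 'm set \<Rightarrow> bool" where
  "strict_walker A g W \<longleftrightarrow> (\<exists>L V.
     distribution A W 1 L \<and> parallel_distribution A g W L \<and>
     (\<forall>c\<in>A. \<forall>x\<in>coords c W. \<forall>v\<in>L c x. g c x v v = 0) \<and>
     null_parallel_field A g W V \<and> (\<forall>c\<in>A. \<forall>x\<in>coords c W. L c x = span {V c x}))"

definition locally_strict_walker ::
    "('m::topological_space, 'd::finite) chart set \<Rightarrow> ('m, 'd) metric \<Rightarrow> bool" where
  "locally_strict_walker A g \<longleftrightarrow>
     (\<forall>p\<in>carrier A. \<exists>W. open W \<and> p \<in> W \<and> W \<subseteq> carrier A \<and> strict_walker A g W)"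

end

theory Submission
  imports Defs
begin

text \<open>Differentiating \<open>\<parallel>grad f\<parallel>\<^sup>2 = 0\<close> gives \<open>H (grad f) = 0\<close> for \<open>H = hess_op = - Ric\<close>.  By local homogeneity the
  trace of \<open>H\<close> is constant, so the Bochner formula reduces to \<open>tr (H\<^sup>2) = 0\<close>.  As \<open>H\<close> is self-adjoint and kills the
  null vector \<open>N = grad f\<close>, it acts on the positive definite space \<open>N\<^sup>\<bottom> / N\<close> with \<open>tr (H\<^sup>2) = 0\<close>, hence trivially.
  Thus \<open>H\<^sup>3 = 0\<close>, and the two cases are \<open>H\<^sup>2 \<noteq> 0\<close> and \<open>H\<^sup>2 = 0\<close>.

  In the second case \<open>\<nabla>\<^sub>u N = h df(u) N\<close>, and alternative (ii) of (c) always holds.  Suppose some local isometry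
  \<open>\<phi>\<close> defined at \<open>P\<close> does not preserve \<open>N\<close> there.  Then \<open>f \<circ> \<phi> - f\<close> has vanishing Hessian, because
  \<open>Hess f = - \<rho>\<close> is invariant, and its gradient is a multiple of \<open>N\<close>, because the line spanned by \<open>N\<close> is the
  image of \<open>Ric\<close>.  Otherwise all local isometries at \<open>P\<close> preserve \<open>N\<close>, so \<open>h\<close> is constant by local homogeneity and
  \<open>exp (- h f) N\<close> is parallel.  No Killing fields are needed.\<close>


section \<open>Smooth functions\<close>

text \<open>Local homogeneity supplies single local isometries, not flows. The function F(f) of a
  Killing field F is therefore replaced by a finite counterpart, the displacement f \<circ> \<phi> -
  f. Its gradient is carried by \<phi> to the defect N - d\<phi>(N), so it is nonzero at P exactly
  when \<phi> moves N there. Everything rests on H being - Ric: the metric determines Ric, so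
  isometries commute with H although they need not preserve f.

  The trace of H^2 vanishes for the following reason. In the Ricci identity for R(w, N) N,
  differentiating H N = 0 produces the term - H (H w). The other terms have trace zero in w: one is
  the derivative of the constant tr H, the rest form a commutator with a Christoffel operator. The
  trace of the left side is \<rho>(N, N) = - g(H N, N) = 0.\<close>

lemma frechet_derivative_cong_open:
  assumes "open S" "x \<in> S" "\<And>y. y \<in> S \<Longrightarrow> f y = g y"
  shows "frechet_derivative f (at x) = frechet_derivative g (at x)"
proof -
  have "(f has_derivative D) (at x) \<longleftrightarrow> (g has_derivative D) (at x)" for D
    using assms by (metis has_derivative_transform_within_open)
  then show ?thesis by (simp add: frechet_derivative_def)
qed

lemma Ck_on_cong:
  assumes "open S" "\<And>x. x \<in> S \<Longrightarrow> f x = g x"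
  shows "Ck_on k S f \<longleftrightarrow> Ck_on k S g"
  using assms(2)
proof (induction k arbitrary: f g)
  case 0
  then show ?case by (simp cong: continuous_on_cong)
next
  case (Suc k)
  have "f differentiable at x \<longleftrightarrow> g differentiable at x" if "x \<in> S" for x
    using that assms(1) Suc.prems unfolding differentiable_def
    by (metis has_derivative_transform_within_open)
  moreover have "Ck_on k S (\<lambda>x. frechet_derivative f (at x) v) \<longleftrightarrow> Ck_on k S (\<lambda>x. frechet_derivative g (at x) v)" for v
    by (rule Suc.IH) (simp add: frechet_derivative_cong_open[OF assms(1) _ Suc.prems])
  ultimately show ?case by simp
qed

lemma Ck_on_subset: "Ck_on k S f \<Longrightarrow> T \<subseteq> S \<Longrightarrow> Ck_on k T f"
  by (induction k arbitrary: f) (auto intro: continuous_on_subset)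

lemma Ck_on_local:
  assumes "\<And>x. x \<in> S \<Longrightarrow> \<exists>T. open T \<and> x \<in> T \<and> Ck_on k T f"
  shows "Ck_on k S f"
  using assms
proof (induction k arbitrary: f)
  case 0
  have "continuous (at x within S) f" if "x \<in> S" for x
    using 0[OF that] by (metis Ck_on.simps(1) continuous_on_interior interior_open continuous_at_imp_continuous_at_within)
  then show ?case by (simp add: continuous_on_eq_continuous_within)
next
  case (Suc k)
  have "Ck_on k S (\<lambda>x. frechet_derivative f (at x) v)" for v
  proof (rule Suc.IH)
    fix x assume "x \<in> S"
    from Suc.prems[OF this] show "\<exists>T. open T \<and> x \<in> T \<and> Ck_on k T (\<lambda>x. frechet_derivative f (at x) v)" by auto
  qed
  moreover have "\<forall>x\<in>S. f differentiable at x"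
    using Suc.prems by force
  ultimately show ?case by simp
qed

lemma Ck_on_SucD: "Ck_on (Suc k) S f \<Longrightarrow> Ck_on k S f"
proof (induction k arbitrary: f)
  case 0
  then show ?case
    by (auto intro!: differentiable_imp_continuous_on simp: differentiable_on_def differentiable_at_withinI)
next
  case (Suc k)
  then show ?case by (auto simp del: Ck_on.simps(1))
qed

lemma Ck_on_const: "Ck_on k S (\<lambda>_. c)"
  by (induction k arbitrary: c) (auto simp: frechet_derivative_const)

text \<open>The induction step of most closure properties below: an explicit derivative formula
  replaces the choice made by \<open>frechet_derivative\<close>, so that only the regularity of that
  formula is left to prove.\<close>

lemma Ck_on_SucI:
  assumes "open S" "\<And>x. x \<in> S \<Longrightarrow> (f has_derivative f' x) (at x)"
    and "\<And>v. Ck_on k S (\<lambda>x. f' x v)"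
  shows "Ck_on (Suc k) S f"
proof -
  have "frechet_derivative f (at x) = f' x" if "x \<in> S" for x
    using assms(2)[OF that] frechet_derivative_at by metis
  then have "Ck_on k S (\<lambda>x. frechet_derivative f (at x) v) \<longleftrightarrow> Ck_on k S (\<lambda>x. f' x v)" for v
    by (intro Ck_on_cong[OF assms(1)]) simp
  then show ?thesis using assms(2,3) by (auto simp: differentiable_def)
qed

lemma Ck_on_SucD':
  assumes "Ck_on (Suc k) S f" "x \<in> S"
  shows "(f has_derivative frechet_derivative f (at x)) (at x)"
  using assms frechet_derivative_works by auto

lemma Ck_on_bounded_linear_compose:
  assumes "bounded_linear L" "open S"
  shows "Ck_on k S f \<Longrightarrow> Ck_on k S (\<lambda>x. L (f x))"
proof (induction k arbitrary: f)
  case 0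
  then show ?case using assms(1) by (simp add: bounded_linear.continuous_on)
next
  case (Suc k)
  show ?case
    by (rule Ck_on_SucI[OF assms(2)], erule bounded_linear.has_derivative[OF assms(1) Ck_on_SucD'[OF Suc.prems]])
       (use Suc in auto)
qed

lemma Ck_on_bounded_linear: "bounded_linear L \<Longrightarrow> Ck_on k S L"
proof (cases k)
  case 0
  moreover assume "bounded_linear L"
  ultimately show ?thesis by (simp add: linear_continuous_on)
next
  case (Suc j)
  assume L: "bounded_linear L"
  then have *: "frechet_derivative L (at x) = L" for x
    using bounded_linear_imp_has_derivative frechet_derivative_at by metis
  show ?thesis
    using Ck_on_const L unfolding Suc Ck_on.simps *
    by (auto simp: bounded_linear_imp_differentiable)
qed

lemma Ck_on_add:
  assumes "open S"
  shows "Ck_on k S f \<Longrightarrow> Ck_on k S g \<Longrightarrow> Ck_on k S (\<lambda>x. f x + g x)"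
proof (induction k arbitrary: f g)
  case 0
  then show ?case by (simp add: continuous_on_add)
next
  case (Suc k)
  show ?case
    by (rule Ck_on_SucI[OF assms], rule has_derivative_add; (erule Ck_on_SucD'[OF Suc.prems(1)] Ck_on_SucD'[OF Suc.prems(2)])?)
       (use Suc in auto)
qed

lemma Ck_on_bounded_bilinear:
  assumes "bounded_bilinear B" "open S"
  shows "Ck_on k S f \<Longrightarrow> Ck_on k S g \<Longrightarrow> Ck_on k S (\<lambda>x. B (f x) (g x))"
proof (induction k arbitrary: f g)
  case 0
  then show ?case using assms(1) by (simp add: bounded_bilinear.continuous_on)
next
  case (Suc k)
  show ?case
  proof (rule Ck_on_SucI[OF assms(2)])
    fix x assume x: "x \<in> S"
    show "((\<lambda>x. B (f x) (g x)) has_derivative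
       (\<lambda>v. B (f x) (frechet_derivative g (at x) v) + B (frechet_derivative f (at x) v) (g x))) (at x)"
      by (rule bounded_bilinear.FDERIV[OF assms(1)]) (use Suc.prems Ck_on_SucD' x in auto)
  next
    fix v
    show "Ck_on k S (\<lambda>x. B (f x) (frechet_derivative g (at x) v) + B (frechet_derivative f (at x) v) (g x))"
      by (intro Ck_on_add[OF assms(2)] Suc.IH) (use Suc.prems Ck_on_SucD in auto)
  qed
qed

lemma Ck_on_sum:
  assumes "open S" "\<And>i. i \<in> I \<Longrightarrow> Ck_on k S (f i)"
  shows "Ck_on k S (\<lambda>x. \<Sum>i\<in>I. f i x)"
  using assms(2)
  by (induction I rule: infinite_finite_induct) (auto intro: Ck_on_const Ck_on_add[OF assms(1)])

text \<open>\<open>Ck_on\<close> controls the derivative of \<open>f\<close> only in fixed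
  directions, but the chain rule evaluates it in a direction that moves with x. Expanding that
  direction over the finite \<open>Basis\<close> separates the two dependences, and the induction
  hypothesis applies to each directional derivative of \<open>f\<close>. This is why the middle
  space is Euclidean.\<close>

lemma Ck_on_compose:
  fixes f :: "'b::euclidean_space \<Rightarrow> 'c::real_normed_vector" and g :: "'a::real_normed_vector \<Rightarrow> 'b"
  assumes "open S" "open T" "g ` S \<subseteq> T"
  shows "Ck_on k T f \<Longrightarrow> Ck_on k S g \<Longrightarrow> Ck_on k S (\<lambda>x. f (g x))"
proof (induction k arbitrary: f)
  case 0
  then show ?case using assms(3) continuous_on_compose2 by fastforce
next
  case (Suc k)
  have lin: "linear (frechet_derivative f (at y))" if "y \<in> T" for y
    using Ck_on_SucD'[OF Suc.prems(1) that] has_derivative_linear by blast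
  show ?case
  proof (rule Ck_on_SucI[OF assms(1)])
    fix x assume x: "x \<in> S"
    then have gx: "g x \<in> T" using assms(3) by auto
    have expand: "frechet_derivative f (at (g x)) w = (\<Sum>b\<in>Basis. (w \<bullet> b) *\<^sub>R frechet_derivative f (at (g x)) b)" for w
    proof -
      have "frechet_derivative f (at (g x)) (\<Sum>b\<in>Basis. (w \<bullet> b) *\<^sub>R b)
          = (\<Sum>b\<in>Basis. (w \<bullet> b) *\<^sub>R frechet_derivative f (at (g x)) b)"
        unfolding linear_sum[OF lin[OF gx]] linear_cmul[OF lin[OF gx]] ..
      then show ?thesis by (simp add: euclidean_representation)
    qed
    show "((\<lambda>x. f (g x)) has_derivative
      (\<lambda>v. \<Sum>b\<in>Basis. (frechet_derivative g (at x) v \<bullet> b) *\<^sub>R frechet_derivative f (at (g x)) b)) (at x)"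
      unfolding expand[symmetric]
      by (rule has_derivative_compose[OF Ck_on_SucD'[OF Suc.prems(2) x] Ck_on_SucD'[OF Suc.prems(1) gx]])
  next
    fix v
    show "Ck_on k S (\<lambda>x. \<Sum>b\<in>Basis. (frechet_derivative g (at x) v \<bullet> b) *\<^sub>R frechet_derivative f (at (g x)) b)"
      by (intro Ck_on_sum[OF assms(1)] Ck_on_bounded_bilinear[OF bounded_bilinear_scaleR assms(1)]
           Ck_on_bounded_linear_compose[OF bounded_linear_inner_left assms(1)] Suc.IH)
         (use Suc.prems Ck_on_SucD in auto)
  qed
qed

text \<open>The derivative of the inverse contains the inverse again, so \<open>f\<close> stays
  fixed in the induction and the induction hypothesis itself supplies the regularity of these
  factors.\<close>

lemma Ck_on_inverse:
  fixes f :: "'a::real_normed_vector \<Rightarrow> real"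
  assumes "open S" "\<And>x. x \<in> S \<Longrightarrow> f x \<noteq> 0"
  shows "Ck_on k S f \<Longrightarrow> Ck_on k S (\<lambda>x. inverse (f x))"
proof (induction k)
  case 0
  then show ?case using assms(2) by (auto intro: continuous_on_inverse)
next
  case (Suc k)
  show ?case
  proof (rule Ck_on_SucI[OF assms(1)])
    fix x assume "x \<in> S"
    then show "((\<lambda>x. inverse (f x)) has_derivative
       (\<lambda>v. - (inverse (f x) * frechet_derivative f (at x) v * inverse (f x)))) (at x)"
      by (intro Deriv.has_derivative_inverse assms(2) Ck_on_SucD'[OF Suc.prems])
  next
    fix v
    show "Ck_on k S (\<lambda>x. - (inverse (f x) * frechet_derivative f (at x) v * inverse (f x)))"
      by (intro Ck_on_bounded_linear_compose[OF bounded_linear_minus[OF bounded_linear_ident] assms(1)]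
          Ck_on_bounded_bilinear[OF bounded_bilinear_mult assms(1)])
         (use Suc Ck_on_SucD in auto)
  qed
qed

lemma Ck_on_exp:
  fixes f :: "'a::real_normed_vector \<Rightarrow> real"
  assumes "open S"
  shows "Ck_on k S f \<Longrightarrow> Ck_on k S (\<lambda>x. exp (f x))"
proof (induction k)
  case 0
  then show ?case by (auto intro: continuous_on_exp)
next
  case (Suc k)
  show ?case
  proof (rule Ck_on_SucI[OF assms])
    fix x assume "x \<in> S"
    from Ck_on_SucD'[OF Suc.prems this]
    show "((\<lambda>x. exp (f x)) has_derivative (\<lambda>v. exp (f x) * frechet_derivative f (at x) v)) (at x)"
      by (auto intro!: derivative_eq_intros)
  next
    fix v
    show "Ck_on k S (\<lambda>x. exp (f x) * frechet_derivative f (at x) v)"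
      by (intro Ck_on_bounded_bilinear[OF bounded_bilinear_mult assms])
         (use Suc Ck_on_SucD in auto)
  qed
qed

section \<open>Closure properties of smooth functions\<close>

lemma smooth_on_cong: "open S \<Longrightarrow> (\<And>x. x \<in> S \<Longrightarrow> f x = g x) \<Longrightarrow> smooth_on S f \<longleftrightarrow> smooth_on S g"
  unfolding smooth_on_def using Ck_on_cong by blast

lemma smooth_on_subset: "smooth_on S f \<Longrightarrow> T \<subseteq> S \<Longrightarrow> smooth_on T f"
  unfolding smooth_on_def using Ck_on_subset by blast

text \<open>Needed where the representing formula changes with the point, as for a map whose image
  passes through several charts.\<close>

lemma smooth_on_local:
  assumes "\<And>x. x \<in> S \<Longrightarrow> \<exists>T. open T \<and> x \<in> T \<and> smooth_on T f"
  shows "smooth_on S f"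
  unfolding smooth_on_def
proof
  fix k show "Ck_on k S f"
    by (rule Ck_on_local) (use assms in \<open>auto simp: smooth_on_def\<close>)
qed

lemma smooth_on_const: "smooth_on S (\<lambda>_. c)"
  by (simp add: smooth_on_def Ck_on_const)

lemma smooth_on_bounded_linear: "bounded_linear L \<Longrightarrow> smooth_on S L"
  by (simp add: smooth_on_def Ck_on_bounded_linear)

lemma smooth_on_ident: "smooth_on S (\<lambda>x. x)"
  by (rule smooth_on_bounded_linear[OF bounded_linear_ident])

lemma smooth_on_bounded_linear_compose:
  "bounded_linear L \<Longrightarrow> open S \<Longrightarrow> smooth_on S f \<Longrightarrow> smooth_on S (\<lambda>x. L (f x))"
  by (simp add: smooth_on_def Ck_on_bounded_linear_compose)

lemma smooth_on_add: "open S \<Longrightarrow> smooth_on S f \<Longrightarrow> smooth_on S g \<Longrightarrow> smooth_on S (\<lambda>x. f x + g x)"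
  by (simp add: smooth_on_def Ck_on_add)

lemma smooth_on_minus: "open S \<Longrightarrow> smooth_on S f \<Longrightarrow> smooth_on S (\<lambda>x. - f x)"
  by (rule smooth_on_bounded_linear_compose[OF bounded_linear_minus[OF bounded_linear_ident]])

lemma smooth_on_diff: "open S \<Longrightarrow> smooth_on S f \<Longrightarrow> smooth_on S g \<Longrightarrow> smooth_on S (\<lambda>x. f x - g x)"
  using smooth_on_add[of S f "\<lambda>x. - g x"] smooth_on_minus[of S g] by simp

lemma smooth_on_bounded_bilinear:
  "bounded_bilinear B \<Longrightarrow> open S \<Longrightarrow> smooth_on S f \<Longrightarrow> smooth_on S g \<Longrightarrow> smooth_on S (\<lambda>x. B (f x) (g x))"
  by (simp add: smooth_on_def Ck_on_bounded_bilinear)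

lemmas smooth_on_scaleR = smooth_on_bounded_bilinear[OF bounded_bilinear_scaleR]
lemmas smooth_on_mult = smooth_on_bounded_bilinear[OF bounded_bilinear_mult]
lemmas smooth_on_inner = smooth_on_bounded_bilinear[OF bounded_bilinear_inner]

lemma smooth_on_sum:
  "open S \<Longrightarrow> (\<And>i. i \<in> I \<Longrightarrow> smooth_on S (f i)) \<Longrightarrow> smooth_on S (\<lambda>x. \<Sum>i\<in>I. f i x)"
  by (simp add: smooth_on_def Ck_on_sum)

lemma smooth_on_prod:
  fixes f :: "'i \<Rightarrow> 'a::real_normed_vector \<Rightarrow> real"
  assumes "open S" "\<And>i. i \<in> I \<Longrightarrow> smooth_on S (f i)"
  shows "smooth_on S (\<lambda>x. \<Prod>i\<in>I. f i x)"
  using assms(2)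
  by (induction I rule: infinite_finite_induct) (auto intro: smooth_on_const smooth_on_mult[OF assms(1)])

lemma smooth_on_compose:
  fixes f :: "'b::euclidean_space \<Rightarrow> 'c::real_normed_vector" and g :: "'a::real_normed_vector \<Rightarrow> 'b"
  assumes "open S" "open T" "g ` S \<subseteq> T" "smooth_on T f" "smooth_on S g"
  shows "smooth_on S (\<lambda>x. f (g x))"
  using assms by (auto simp: smooth_on_def intro: Ck_on_compose)

lemma smooth_on_inverse:
  fixes f :: "'a::real_normed_vector \<Rightarrow> real"
  shows "open S \<Longrightarrow> (\<And>x. x \<in> S \<Longrightarrow> f x \<noteq> 0) \<Longrightarrow> smooth_on S f \<Longrightarrow> smooth_on S (\<lambda>x. inverse (f x))"
  by (simp add: smooth_on_def Ck_on_inverse)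

lemma smooth_on_divide:
  fixes f :: "'a::real_normed_vector \<Rightarrow> real"
  shows "open S \<Longrightarrow> (\<And>x. x \<in> S \<Longrightarrow> g x \<noteq> 0) \<Longrightarrow> smooth_on S f \<Longrightarrow> smooth_on S g \<Longrightarrow> smooth_on S (\<lambda>x. f x / g x)"
  unfolding divide_inverse by (intro smooth_on_mult smooth_on_inverse)

lemma smooth_on_exp:
  fixes f :: "'a::real_normed_vector \<Rightarrow> real"
  shows "open S \<Longrightarrow> smooth_on S f \<Longrightarrow> smooth_on S (\<lambda>x. exp (f x))"
  by (simp add: smooth_on_def Ck_on_exp)

lemma smooth_on_frechet_derivative:
  "smooth_on S f \<Longrightarrow> smooth_on S (\<lambda>x. frechet_derivative f (at x) v)"
  unfolding smooth_on_def by (metis Ck_on.simps(2))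

lemma smooth_on_has_derivative:
  "smooth_on S f \<Longrightarrow> x \<in> S \<Longrightarrow> (f has_derivative frechet_derivative f (at x)) (at x)"
  unfolding smooth_on_def using Ck_on_SucD' by blast

lemma smooth_on_linear_frechet_derivative:
  "smooth_on S f \<Longrightarrow> x \<in> S \<Longrightarrow> linear (frechet_derivative f (at x))"
  using smooth_on_has_derivative has_derivative_linear by blast

lemma smooth_on_imp_continuous_on: "smooth_on S f \<Longrightarrow> continuous_on S f"
  unfolding smooth_on_def by (metis Ck_on.simps(1))

lemma smooth_on_vec_nth:
  fixes f :: "'a::real_normed_vector \<Rightarrow> real^'d"
  shows "open S \<Longrightarrow> smooth_on S f \<Longrightarrow> smooth_on S (\<lambda>x. f x $ i)"
  by (rule smooth_on_bounded_linear_compose[OF bounded_linear_vec_nth])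

lemma smooth_on_componentwise:
  fixes f :: "'a::real_normed_vector \<Rightarrow> real^'d"
  assumes "open S" "\<And>i. smooth_on S (\<lambda>x. f x $ i)"
  shows "smooth_on S f"
proof -
  have "smooth_on S (\<lambda>x. \<Sum>i\<in>UNIV. (f x $ i) *\<^sub>R axis i (1::real))"
    by (intro smooth_on_sum smooth_on_scaleR assms smooth_on_const)
  moreover have "(\<Sum>i\<in>UNIV. (f x $ i) *\<^sub>R axis i (1::real)) = f x" for x
    using basis_expansion[of "f x"] by (simp add: scalar_mult_eq_scaleR)
  ultimately show ?thesis by simp
qed

section \<open>Smooth families of linear maps\<close>

lemma linear_basis_expansion:
  fixes L :: "real^'d \<Rightarrow> 'b::real_vector"
  assumes "linear L"
  shows "L v = (\<Sum>i\<in>UNIV. (v $ i) *\<^sub>R L (axis i 1))"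
proof -
  have "L v = L (\<Sum>i\<in>UNIV. (v $ i) *\<^sub>R axis i 1)"
    using basis_expansion[of v] by (simp add: scalar_mult_eq_scaleR)
  then show ?thesis using assms by (simp add: linear_sum linear_cmul)
qed

text \<open>Tensors are curried functions here, known to be smooth only for each fixed vector.
  Expanding a moving vector in the standard basis turns the value into a finite sum of products of
  smooth functions.\<close>

lemma smooth_on_linear_family:
  fixes L :: "'a::real_normed_vector \<Rightarrow> real^'d \<Rightarrow> 'b::real_normed_vector"
  assumes "open S" "\<And>y. y \<in> S \<Longrightarrow> linear (L y)" "\<And>v. smooth_on S (\<lambda>y. L y v)" "smooth_on S X"
  shows "smooth_on S (\<lambda>y. L y (X y))"
proof -
  have "smooth_on S (\<lambda>y. \<Sum>i\<in>UNIV. (X y $ i) *\<^sub>R L y (axis i 1))"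
    by (intro smooth_on_sum smooth_on_scaleR smooth_on_vec_nth assms)
  moreover have "L y (X y) = (\<Sum>i\<in>UNIV. (X y $ i) *\<^sub>R L y (axis i 1))" if "y \<in> S" for y
    by (rule linear_basis_expansion[OF assms(2)[OF that]])
  ultimately show ?thesis
    by (subst smooth_on_cong[OF assms(1)]) auto
qed

lemma has_derivative_linear_family:
  fixes L :: "'a::real_normed_vector \<Rightarrow> real^'d \<Rightarrow> 'b::real_normed_vector"
  assumes S: "open S" "x \<in> S" and L: "\<And>y. y \<in> S \<Longrightarrow> linear (L y)"
    and L': "\<And>v. ((\<lambda>y. L y v) has_derivative (\<lambda>w. L' w v)) (at x)"
    and X: "(X has_derivative X') (at x)"
  shows "((\<lambda>y. L y (X y)) has_derivative (\<lambda>w. L' w (X x) + L x (X' w))) (at x)"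
proof -
  \<comment> \<open>Linearity passes from \<open>L\<close> to its derivative by uniqueness of
    derivatives. It is needed to contract the basis sum back to \<open>L' w (X x)\<close>.\<close>
  have lin: "linear (L' w)" for w
  proof
    fix u v :: "real^'d" and r :: real
    have "((\<lambda>y. L y u + L y v) has_derivative (\<lambda>w. L' w u + L' w v)) (at x)"
      by (intro has_derivative_add L')
    then have "((\<lambda>y. L y (u + v)) has_derivative (\<lambda>w. L' w u + L' w v)) (at x)"
      by (rule has_derivative_transform_within_open[OF _ S]) (simp add: L linear_add)
    then show "L' w (u + v) = L' w u + L' w v"
      using has_derivative_unique[OF L'] by metis
    have "((\<lambda>y. r *\<^sub>R L y u) has_derivative (\<lambda>w. r *\<^sub>R L' w u)) (at x)"
      by (intro has_derivative_scaleR_right L')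
    then have "((\<lambda>y. L y (r *\<^sub>R u)) has_derivative (\<lambda>w. r *\<^sub>R L' w u)) (at x)"
      by (rule has_derivative_transform_within_open[OF _ S]) (simp add: L linear_cmul)
    then show "L' w (r *\<^sub>R u) = r *\<^sub>R L' w u"
      using has_derivative_unique[OF L'] by metis
  qed
  have "((\<lambda>y. \<Sum>i\<in>UNIV. (X y $ i) *\<^sub>R L y (axis i 1)) has_derivative
     (\<lambda>w. \<Sum>i\<in>UNIV. (X x $ i) *\<^sub>R L' w (axis i 1) + (X' w $ i) *\<^sub>R L x (axis i 1))) (at x)"
    by (intro has_derivative_sum has_derivative_scaleR L' bounded_linear.has_derivative[OF bounded_linear_vec_nth X])
  then have "((\<lambda>y. L y (X y)) has_derivative
     (\<lambda>w. \<Sum>i\<in>UNIV. (X x $ i) *\<^sub>R L' w (axis i 1) + (X' w $ i) *\<^sub>R L x (axis i 1))) (at x)"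
    by (rule has_derivative_transform_within_open[OF _ S]) (rule linear_basis_expansion[OF L, symmetric])
  then show ?thesis
    by (simp add: sum.distrib flip: linear_basis_expansion[OF lin] linear_basis_expansion[OF L[OF S(2)]])
qed

subsection \<open>Symmetry of second derivatives\<close>

text \<open>The mean value theorem is applied twice: to a \<mapsto> f(x + a v + t w) - f(x + a v),
  and then to the derivative of f along v as the point moves in direction w.\<close>

lemma second_difference_mean_value:
  fixes f :: "'a::real_normed_vector \<Rightarrow> real"
  assumes f: "smooth_on S f" and t: "0 < t"
    and S: "\<And>a b. 0 \<le> a \<Longrightarrow> a \<le> t \<Longrightarrow> 0 \<le> b \<Longrightarrow> b \<le> t \<Longrightarrow> x + a *\<^sub>R v + b *\<^sub>R w \<in> S"
  shows "\<exists>a b. 0 \<le> a \<and> a \<le> t \<and> 0 \<le> b \<and> b \<le> t \<and>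
    f (x + t *\<^sub>R v + t *\<^sub>R w) - f (x + t *\<^sub>R v) - f (x + t *\<^sub>R w) + f x
      = t * t * frechet_derivative (\<lambda>y. frechet_derivative f (at y) v) (at (x + a *\<^sub>R v + b *\<^sub>R w)) w"
proof -
  let ?D = "\<lambda>y. frechet_derivative f (at y) v"
  let ?g = "\<lambda>a. f (x + a *\<^sub>R v + t *\<^sub>R w) - f (x + a *\<^sub>R v + 0 *\<^sub>R w)"
  have D: "((\<lambda>s. f (x + s *\<^sub>R v + b *\<^sub>R w)) has_real_derivative ?D (x + a *\<^sub>R v + b *\<^sub>R w)) (at a)"
    if "0 \<le> a" "a \<le> t" "0 \<le> b" "b \<le> t" for a b
  proof -
    have in_S: "x + a *\<^sub>R v + b *\<^sub>R w \<in> S" using S that by auto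
    have "((\<lambda>s. x + s *\<^sub>R v + b *\<^sub>R w) has_derivative (\<lambda>s. s *\<^sub>R v)) (at a)"
      by (auto intro!: derivative_eq_intros)
    from has_derivative_compose[OF this smooth_on_has_derivative[OF f in_S]]
    show ?thesis
      using linear_cmul[OF smooth_on_linear_frechet_derivative[OF f in_S]]
      by (simp add: has_field_derivative_def mult_commute_abs)
  qed
  have "\<exists>a. 0 < a \<and> a < t \<and> ?g t - ?g 0 = (t - 0) * (?D (x + a *\<^sub>R v + t *\<^sub>R w) - ?D (x + a *\<^sub>R v + 0 *\<^sub>R w))"
    by (rule MVT2[OF t]) (intro DERIV_diff D, use t in auto)
  then obtain a where a: "0 < a" "a < t"
    and ga: "?g t - ?g 0 = t * (?D (x + a *\<^sub>R v + t *\<^sub>R w) - ?D (x + a *\<^sub>R v + 0 *\<^sub>R w))" by auto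
  have D2: "((\<lambda>s. ?D (x + a *\<^sub>R v + s *\<^sub>R w)) has_real_derivative
      frechet_derivative ?D (at (x + a *\<^sub>R v + b *\<^sub>R w)) w) (at b)"
    if "0 \<le> b" "b \<le> t" for b
  proof -
    have in_S: "x + a *\<^sub>R v + b *\<^sub>R w \<in> S" using S that a by auto
    note sm = smooth_on_frechet_derivative[OF f, of v]
    have "((\<lambda>s. x + a *\<^sub>R v + s *\<^sub>R w) has_derivative (\<lambda>s. s *\<^sub>R w)) (at b)"
      by (auto intro!: derivative_eq_intros)
    from has_derivative_compose[OF this smooth_on_has_derivative[OF sm in_S]]
    show ?thesis
      using linear_cmul[OF smooth_on_linear_frechet_derivative[OF sm in_S]]
      by (simp add: has_field_derivative_def mult_commute_abs)
  qed
  have "\<exists>b. 0 < b \<and> b < t \<and> ?D (x + a *\<^sub>R v + t *\<^sub>R w) - ?D (x + a *\<^sub>R v + 0 *\<^sub>R w)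
      = (t - 0) * frechet_derivative ?D (at (x + a *\<^sub>R v + b *\<^sub>R w)) w"
    by (rule MVT2[OF t]) (intro D2, auto)
  then obtain b where b: "0 < b" "b < t" "?D (x + a *\<^sub>R v + t *\<^sub>R w) - ?D (x + a *\<^sub>R v + 0 *\<^sub>R w)
      = t * frechet_derivative ?D (at (x + a *\<^sub>R v + b *\<^sub>R w)) w" by auto
  show ?thesis
    using a b ga by (intro exI[of _ a] exI[of _ b]) (auto simp: algebra_simps)
qed

text \<open>The second difference over a small parallelogram is symmetric in v and w. By the
  preceding lemma it is t^2 times either mixed derivative at some point of the parallelogram, so
  continuity of both at x forces them to agree.\<close>

lemma second_derivative_symmetric_real:
  fixes f :: "'a::real_normed_vector \<Rightarrow> real"
  assumes f: "smooth_on S f" and S: "open S" "x \<in> S"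
  shows "frechet_derivative (\<lambda>y. frechet_derivative f (at y) v) (at x) w
       = frechet_derivative (\<lambda>y. frechet_derivative f (at y) w) (at x) v" (is "?F x = ?G x")
proof (rule ccontr)
  assume ne: "?F x \<noteq> ?G x"
  define e where "e = \<bar>?F x - ?G x\<bar> / 2"
  have e: "e > 0" using ne by (simp add: e_def)
  have cont: "continuous_on S ?F" "continuous_on S ?G"
    by (intro smooth_on_imp_continuous_on smooth_on_frechet_derivative f)+
  have "eventually (\<lambda>y. dist (?F y) (?F x) < e) (at x)" "eventually (\<lambda>y. dist (?G y) (?G x) < e) (at x)"
    using cont S e by (auto intro!: tendstoD simp: continuous_on_eq_continuous_at isCont_def)
  then obtain d1 d2 where d: "d1 > 0" "d2 > 0"
    "\<And>y. y \<noteq> x \<Longrightarrow> dist y x < d1 \<Longrightarrow> dist (?F y) (?F x) < e"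
    "\<And>y. y \<noteq> x \<Longrightarrow> dist y x < d2 \<Longrightarrow> dist (?G y) (?G x) < e"
    unfolding eventually_at by (metis UNIV_I)
  obtain d3 where d3: "d3 > 0" "ball x d3 \<subseteq> S" using S openE by blast
  define d where "d = min d1 (min d2 d3)"
  have dpos: "d > 0" using d d3 by (simp add: d_def)
  have F_near: "dist (?F y) (?F x) < e" if "dist y x < d" for y
    using d(3)[of y] that e by (cases "y = x") (auto simp: d_def)
  have G_near: "dist (?G y) (?G x) < e" if "dist y x < d" for y
    using d(4)[of y] that e by (cases "y = x") (auto simp: d_def)
  \<comment> \<open>This step size keeps the whole parallelogram within distance d / 2 of x; the
    summand 1 covers the case v = w = 0.\<close>
  define t where "t = d / (2 * (norm v + norm w + 1))"
  have nn: "norm v + norm w + 1 > 0"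
    using norm_ge_zero[of v] norm_ge_zero[of w] by linarith
  then have t: "t > 0" unfolding t_def using dpos by simp
  have near: "dist (x + a *\<^sub>R v + b *\<^sub>R w) x < d" if "0 \<le> a" "a \<le> t" "0 \<le> b" "b \<le> t" for a b
  proof -
    have "dist (x + a *\<^sub>R v + b *\<^sub>R w) x = norm (a *\<^sub>R v + b *\<^sub>R w)" by (simp add: dist_norm add.assoc)
    also have "\<dots> \<le> a * norm v + b * norm w" using that by (metis norm_triangle_ineq norm_scaleR abs_of_nonneg)
    also have "\<dots> \<le> t * norm v + t * norm w" using that by (intro add_mono mult_right_mono) auto
    also have "\<dots> \<le> t * (norm v + norm w + 1)" using t by (simp add: algebra_simps)
    also have "\<dots> = d / 2" unfolding t_def using nn by (simp del: distrib_left_numeral)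
    also have "\<dots> < d" using dpos by simp
    finally show ?thesis .
  qed
  have inS: "x + a *\<^sub>R v + b *\<^sub>R w \<in> S" if "0 \<le> a" "a \<le> t" "0 \<le> b" "b \<le> t" for a b
    using near[OF that] d3(2) by (auto simp: d_def dist_commute)
  have inS': "x + b *\<^sub>R w + a *\<^sub>R v \<in> S" if "0 \<le> b" "b \<le> t" "0 \<le> a" "a \<le> t" for a b
    using inS[of a b] that by (simp add: add_ac)
  obtain a b where ab: "0 \<le> a" "a \<le> t" "0 \<le> b" "b \<le> t"
    and 1: "f (x + t *\<^sub>R v + t *\<^sub>R w) - f (x + t *\<^sub>R v) - f (x + t *\<^sub>R w) + f x = t * t * ?F (x + a *\<^sub>R v + b *\<^sub>R w)"
    using second_difference_mean_value[OF f t inS] by blast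
  obtain a' b' where ab': "0 \<le> a'" "a' \<le> t" "0 \<le> b'" "b' \<le> t"
    and 2: "f (x + t *\<^sub>R w + t *\<^sub>R v) - f (x + t *\<^sub>R w) - f (x + t *\<^sub>R v) + f x = t * t * ?G (x + b' *\<^sub>R w + a' *\<^sub>R v)"
    using second_difference_mean_value[OF f t inS'] by blast
  have "t * t * ?F (x + a *\<^sub>R v + b *\<^sub>R w) = t * t * ?G (x + a' *\<^sub>R v + b' *\<^sub>R w)"
    using 1 2 by (simp only: add.assoc add.commute[of "t *\<^sub>R w"] add.commute[of "b' *\<^sub>R w"])
  then have eq: "?F (x + a *\<^sub>R v + b *\<^sub>R w) = ?G (x + a' *\<^sub>R v + b' *\<^sub>R w)"
    using t by simp
  have "\<bar>?F (x + a *\<^sub>R v + b *\<^sub>R w) - ?F x\<bar> < e"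
    using F_near[OF near[OF ab]] by (simp add: dist_real_def)
  moreover have "\<bar>?G (x + a' *\<^sub>R v + b' *\<^sub>R w) - ?G x\<bar> < e"
    using G_near[OF near[OF ab']] by (simp add: dist_real_def)
  ultimately have "\<bar>?F x - ?G x\<bar> < 2 * e" using eq by linarith
  then show False by (simp add: e_def)
qed

lemma frechet_derivative_vec_nth:
  fixes f :: "'a::real_normed_vector \<Rightarrow> real^'d"
  assumes "(f has_derivative f') (at x)"
  shows "frechet_derivative (\<lambda>y. f y $ i) (at x) v = f' v $ i"
  using bounded_linear.has_derivative[OF bounded_linear_vec_nth assms] frechet_derivative_at by metis

lemma second_derivative_symmetric:
  fixes f :: "'a::real_normed_vector \<Rightarrow> real^'d"
  assumes f: "smooth_on S f" and S: "open S" "x \<in> S"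
  shows "frechet_derivative (\<lambda>y. frechet_derivative f (at y) v) (at x) w
       = frechet_derivative (\<lambda>y. frechet_derivative f (at y) w) (at x) v"
proof (rule vec_eq_iff[THEN iffD2], rule)
  fix i
  have 1: "frechet_derivative f (at y) u $ i = frechet_derivative (\<lambda>y. f y $ i) (at y) u" if "y \<in> S" for y u
    using frechet_derivative_vec_nth[OF smooth_on_has_derivative[OF f that]] by simp
  have 2: "frechet_derivative (\<lambda>y. frechet_derivative f (at y) u) (at x) u' $ i
     = frechet_derivative (\<lambda>y. frechet_derivative (\<lambda>y. f y $ i) (at y) u) (at x) u'" for u u'
  proof -
    have "frechet_derivative (\<lambda>y. frechet_derivative f (at y) u) (at x) u' $ i
      = frechet_derivative (\<lambda>y. frechet_derivative f (at y) u $ i) (at x) u'"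
      using frechet_derivative_vec_nth[OF smooth_on_has_derivative[OF smooth_on_frechet_derivative[OF f] S(2)]]
      by simp
    also have "\<dots> = frechet_derivative (\<lambda>y. frechet_derivative (\<lambda>y. f y $ i) (at y) u) (at x) u'"
      by (rule fun_cong[OF frechet_derivative_cong_open[OF S 1]])
    finally show ?thesis .
  qed
  show "frechet_derivative (\<lambda>y. frechet_derivative f (at y) v) (at x) w $ i
      = frechet_derivative (\<lambda>y. frechet_derivative f (at y) w) (at x) v $ i"
    unfolding 2 using second_derivative_symmetric_real[OF smooth_on_vec_nth[OF S(1) f] S] .
qed


section \<open>Lorentzian forms\<close>

lemma lorentzian_form_bilinear: "lorentzian_form B \<Longrightarrow> bilinear B"
  and lorentzian_form_sym: "lorentzian_form B \<Longrightarrow> B u v = B v u"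
  by (auto simp: lorentzian_form_def)

lemma lorentzian_form_linear:
  assumes "lorentzian_form B"
  shows "linear (B u)" "linear (\<lambda>u. B u v)"
  using lorentzian_form_bilinear[OF assms] by (auto simp: bilinear_def)

text \<open>\<open>lorentzian_form\<close> provides orthonormal vectors without saying that they
  span. Pairing with \<open>e j\<close> shows that the map \<open>T\<close> from coefficients to
  combinations is injective, hence surjective by equality of dimensions.\<close>

lemma lorentzian_frame:
  fixes B :: "real^'d::finite \<Rightarrow> real^'d \<Rightarrow> real"
  assumes "lorentzian_form B"
  obtains e :: "'d \<Rightarrow> real^'d" and i0 s where
    "s = (\<lambda>i. if i = i0 then - 1 else 1)"
    "\<And>i j. B (e i) (e j) = (if i = j then s i else 0)"
    "\<And>v. v = (\<Sum>i\<in>UNIV. (s i * B v (e i)) *\<^sub>R e i)"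
proof -
  obtain e :: "'d \<Rightarrow> real^'d" and i0
    where e: "\<And>i j. B (e i) (e j) = (if i = j then if i = i0 then - 1 else 1 else 0)"
    using assms unfolding lorentzian_form_def by metis
  define s :: "'d \<Rightarrow> real" where "s = (\<lambda>i. if i = i0 then - 1 else 1)"
  define T :: "real^'d \<Rightarrow> real^'d" where "T = (\<lambda>a. \<Sum>i\<in>UNIV. (a $ i) *\<^sub>R e i)"
  have T: "linear T"
    unfolding T_def by (intro linear_compose_sum ballI linearI) (auto simp: scaleR_add_left)
  have BT: "B (T a) (e j) = s j * a $ j" for a j
    unfolding T_def linear_sum[OF lorentzian_form_linear(2)[OF assms]] linear_cmul[OF lorentzian_form_linear(2)[OF assms]]
    by (simp add: e s_def if_distrib cong: if_cong)
  have "inj T"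
  proof (subst linear_injective_0[OF T], intro allI impI)
    fix a assume "T a = 0"
    then have "s j * a $ j = 0" for j
      using BT[of a j] linear_0[OF lorentzian_form_linear(2)[OF assms]] by simp
    moreover have "s j \<noteq> 0" for j by (simp add: s_def)
    ultimately show "a = 0" by (simp add: vec_eq_iff)
  qed
  then have "surj T" using linear_injective_imp_surjective[OF T] by simp
  have exp: "v = (\<Sum>i\<in>UNIV. (s i * B v (e i)) *\<^sub>R e i)" for v
  proof -
    obtain a where a: "v = T a" using \<open>surj T\<close> by (metis surjD)
    have "s i * (s i * a $ i) = a $ i" for i by (simp add: s_def)
    then show ?thesis unfolding a BT by (simp only: T_def)
  qed
  show ?thesis
    by (rule that[OF s_def _ exp]) (simp add: e s_def)
qed

lemma lorentzian_nondegenerate: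
  assumes "lorentzian_form B" "\<And>w. B v w = 0"
  shows "v = 0"
  using lorentzian_frame[OF assms(1)] assms(2)
  by (metis (no_types, lifting) mult_zero_right scaleR_zero_left sum.neutral)

lemma lorentzian_eqI:
  assumes B: "lorentzian_form B" and "\<And>w. B u w = B v w"
  shows "u = v"
  using lorentzian_nondegenerate[OF B, of "u - v"] assms(2) linear_diff[OF lorentzian_form_linear(2)[OF B]]
  by simp

lemma sharp_unique:
  assumes "lorentzian_form (G x)" "\<And>w. G x v w = \<alpha> w"
  shows "sharp G x \<alpha> = v"
  unfolding sharp_def
proof (rule the_equality)
  fix u assume "\<forall>w. G x u w = \<alpha> w"
  then show "u = v" using lorentzian_eqI[OF assms(1)] assms(2) by simp
qed (simp add: assms(2))

text \<open>The existence behind the \<open>THE\<close> in \<open>sharp\<close>: in an orthonormal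
  frame the dual vector is the sum of the s_i \<alpha>(e_i) e_i.\<close>

lemma sharp_works:
  fixes G :: "'d::finite form_field"
  assumes G: "lorentzian_form (G x)" and \<alpha>: "linear \<alpha>"
  shows "G x (sharp G x \<alpha>) w = \<alpha> w"
proof -
  obtain e :: "'d \<Rightarrow> real^'d" and i0 s where "s = (\<lambda>i. if i = i0 then - 1 else 1)"
    "\<And>i j. G x (e i) (e j) = (if i = j then s i else 0)"
    and e: "\<And>v. v = (\<Sum>i\<in>UNIV. (s i * G x v (e i)) *\<^sub>R e i)"
    by (rule lorentzian_frame[OF G]) (rule that)
  let ?v = "\<Sum>i\<in>UNIV. (s i * \<alpha> (e i)) *\<^sub>R e i"
  have "G x ?v w = \<alpha> w" for w
  proof -
    have "\<alpha> w = \<alpha> (\<Sum>i\<in>UNIV. (s i * G x w (e i)) *\<^sub>R e i)" by (rule arg_cong[OF e])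
    also have "\<dots> = (\<Sum>i\<in>UNIV. (s i * G x w (e i)) * \<alpha> (e i))"
      by (simp only: linear_sum[OF \<alpha>] linear_cmul[OF \<alpha>] real_scaleR_def)
    also have "\<dots> = G x ?v w"
      unfolding linear_sum[OF lorentzian_form_linear(2)[OF G]] linear_cmul[OF lorentzian_form_linear(2)[OF G]]
        lorentzian_form_sym[OF G, of w] by (simp add: mult_ac)
    finally show ?thesis ..
  qed
  then show ?thesis using sharp_unique[of G x ?v \<alpha>, OF G] by metis
qed

text \<open>Expand the images of the standard basis in the frame \<open>e\<close> and exchange the
  sums; the sum over the standard basis then reassembles \<open>T (e i)\<close>.\<close>

lemma trace_lorentzian:
  fixes B :: "real^'d::finite \<Rightarrow> real^'d \<Rightarrow> real"
  assumes B: "lorentzian_form B" and T: "linear T"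
    and e: "\<And>v. v = (\<Sum>i\<in>UNIV. (s i * B v (e i)) *\<^sub>R e i)"
  shows "trace (matrix T) = (\<Sum>i\<in>UNIV. s i * B (T (e i)) (e i))"
proof -
  have lin: "linear (\<lambda>v. B (T v) w)" for w
    using linear_compose[OF T lorentzian_form_linear(2)[OF B]] by (simp add: o_def)
  have "trace (matrix T) = (\<Sum>k\<in>UNIV. T (axis k 1) $ k)"
    by (simp add: trace_def matrix_def)
  also have "\<dots> = (\<Sum>k\<in>UNIV. \<Sum>i\<in>UNIV. s i * B (T (axis k 1)) (e i) * e i $ k)"
  proof (rule sum.cong[OF refl])
    fix k
    have "T (axis k 1) $ k = (\<Sum>i\<in>UNIV. (s i * B (T (axis k 1)) (e i)) *\<^sub>R e i) $ k"
      by (rule arg_cong[OF e])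
    then show "T (axis k 1) $ k = (\<Sum>i\<in>UNIV. s i * B (T (axis k 1)) (e i) * e i $ k)" by simp
  qed
  also have "\<dots> = (\<Sum>i\<in>UNIV. s i * (\<Sum>k\<in>UNIV. (e i $ k) *\<^sub>R B (T (axis k 1)) (e i)))"
    by (subst sum.swap) (simp add: sum_distrib_left mult_ac)
  also have "\<dots> = (\<Sum>i\<in>UNIV. s i * B (T (e i)) (e i))"
    by (simp only: linear_basis_expansion[OF lin, symmetric])
  finally show ?thesis .
qed

text \<open>Here \<open>c v\<close> are the coordinates of v in an orthonormal frame with timelike
  index \<open>i0\<close>. Scaled to time component 1, N has spatial part \<open>m\<close>, a unit
  vector because N is null. Orthogonality of X to N then says that the component of X along
  \<open>m\<close> equals its time component.\<close>

lemma lorentzian_null_frame: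
  fixes B :: "real^'d::finite \<Rightarrow> real^'d \<Rightarrow> real"
  assumes B: "lorentzian_form B" and N: "N \<noteq> 0" "B N N = 0"
  obtains e :: "'d \<Rightarrow> real^'d" and i0 s c m where
    "s = (\<lambda>i. if i = i0 then - 1 else 1)"
    "\<And>v. v = (\<Sum>i\<in>UNIV. (s i * B v (e i)) *\<^sub>R e i)"
    "\<And>v. v = (\<Sum>i\<in>UNIV - {i0}. c v i *\<^sub>R e i) + c v i0 *\<^sub>R e i0"
    "\<And>u v. B u v = (\<Sum>i\<in>UNIV - {i0}. c u i * c v i) - c u i0 * c v i0"
    "c N i0 \<noteq> 0" "\<And>i. i \<noteq> i0 \<Longrightarrow> c N i = c N i0 * m i" "(\<Sum>i\<in>UNIV - {i0}. m i * m i) = 1"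
    "\<And>X. B X N = 0 \<Longrightarrow> (\<Sum>i\<in>UNIV - {i0}. c X i * m i) = c X i0"
proof -
  obtain e :: "'d \<Rightarrow> real^'d" and i0 s where s: "s = (\<lambda>i. if i = i0 then - 1 else 1)"
    and "\<And>i j. B (e i) (e j) = (if i = j then s i else 0)"
    and e: "\<And>v. v = (\<Sum>i\<in>UNIV. (s i * B v (e i)) *\<^sub>R e i)"
    by (rule lorentzian_frame[OF B]) (rule that)
  define c where "c v i = s i * B v (e i)" for v i
  let ?I = "UNIV - {i0}"
  have Bc: "B u v = (\<Sum>i\<in>?I. c u i * c v i) - c u i0 * c v i0" for u v
  proof -
    have "B u v = B u (\<Sum>i\<in>UNIV. (s i * B v (e i)) *\<^sub>R e i)" by (rule arg_cong[OF e])
    also have "\<dots> = (\<Sum>i\<in>UNIV. s i * (c u i * c v i))"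
      unfolding linear_sum[OF lorentzian_form_linear(1)[OF B]] linear_cmul[OF lorentzian_form_linear(1)[OF B]]
      by (intro sum.cong refl) (auto simp: c_def s)
    also have "\<dots> = (\<Sum>i\<in>?I. s i * (c u i * c v i)) + s i0 * (c u i0 * c v i0)"
      by (simp add: sum.remove[of UNIV i0])
    also have "(\<Sum>i\<in>?I. s i * (c u i * c v i)) = (\<Sum>i\<in>?I. c u i * c v i)"
      by (intro sum.cong) (auto simp: s)
    finally show ?thesis by (simp add: s)
  qed
  \<comment> \<open>With zero time component, nullity would make a sum of squares vanish, and N
    would be 0.\<close>
  have N0: "c N i0 \<noteq> 0"
  proof
    assume 0: "c N i0 = 0"
    then have "(\<Sum>i\<in>?I. (c N i)\<^sup>2) = 0" using Bc[of N N] N(2) by (simp add: power2_eq_square)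
    then have "c N i = 0" for i using 0 by (cases "i = i0") (auto simp: sum_nonneg_eq_0_iff)
    then have "(\<Sum>i\<in>UNIV. c N i *\<^sub>R e i) = 0" by simp
    then have "(\<Sum>i\<in>UNIV. (s i * B N (e i)) *\<^sub>R e i) = 0" by (simp only: c_def)
    then show False using e N(1) by metis
  qed
  define m where "m i = c N i / c N i0" for i
  have m1: "(\<Sum>i\<in>?I. m i * m i) = 1"
  proof -
    have "(\<Sum>i\<in>?I. m i * m i) = (\<Sum>i\<in>?I. c N i * c N i) / (c N i0 * c N i0)"
      by (simp add: m_def sum_divide_distrib)
    also have "\<dots> = 1" using Bc[of N N] N(2) N0 by simp
    finally show ?thesis .
  qed
  have mX: "(\<Sum>i\<in>?I. c X i * m i) = c X i0" if X: "B X N = 0" for X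
  proof -
    have "(\<Sum>i\<in>?I. c X i * m i) = (\<Sum>i\<in>?I. c X i * c N i) / c N i0"
      by (simp add: m_def sum_divide_distrib)
    also have "\<dots> = c X i0" using Bc[of X N] X N0 by simp
    finally show ?thesis .
  qed
  have ev: "v = (\<Sum>i\<in>?I. c v i *\<^sub>R e i) + c v i0 *\<^sub>R e i0" for v
  proof -
    have "v = (\<Sum>i\<in>UNIV. c v i *\<^sub>R e i)" unfolding c_def by (rule e)
    then show ?thesis by (simp add: sum.remove[of UNIV i0] add.commute)
  qed
  have "c N i = c N i0 * m i" if "i \<noteq> i0" for i using N0 by (simp add: m_def)
  then show ?thesis by (rule that[OF s e ev Bc N0 _ m1 mX])
qed

text \<open>Subtracting from X the multiple of N with the same time component does not change its
  square, since N is null and orthogonal to X. The remainder is purely spatial, so the square is a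
  sum of squares, and it vanishes only if X is that multiple of N.\<close>

lemma lorentzian_null_orthogonal:
  fixes B :: "real^'d::finite \<Rightarrow> real^'d \<Rightarrow> real"
  assumes B: "lorentzian_form B" and N: "N \<noteq> 0" "B N N = 0" and X: "B X N = 0"
  shows "B X X \<ge> 0" "B X X = 0 \<Longrightarrow> X \<in> span {N}"
proof -
  obtain e :: "'d \<Rightarrow> real^'d" and i0 s c m where s: "s = (\<lambda>i. if i = i0 then - 1 else 1)"
    and e: "\<And>v. v = (\<Sum>i\<in>UNIV. (s i * B v (e i)) *\<^sub>R e i)"
    and ev: "\<And>v. v = (\<Sum>i\<in>UNIV - {i0}. c v i *\<^sub>R e i) + c v i0 *\<^sub>R e i0"
    and Bc: "\<And>u v. B u v = (\<Sum>i\<in>UNIV - {i0}. c u i * c v i) - c u i0 * c v i0"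
    and N0: "c N i0 \<noteq> 0" and cN: "\<And>i. i \<noteq> i0 \<Longrightarrow> c N i = c N i0 * m i" and m1: "(\<Sum>i\<in>UNIV - {i0}. m i * m i) = 1"
    and mX: "\<And>X. B X N = 0 \<Longrightarrow> (\<Sum>i\<in>UNIV - {i0}. c X i * m i) = c X i0"
    by (rule lorentzian_null_frame[OF B N]) (rule that)
  let ?I = "UNIV - {i0}"
  have eq: "B X X = (\<Sum>i\<in>?I. (c X i - c X i0 * m i)\<^sup>2)"
  proof -
    have "(\<Sum>i\<in>?I. (c X i - c X i0 * m i)\<^sup>2)
      = (\<Sum>i\<in>?I. c X i * c X i - 2 * c X i0 * (c X i * m i) + c X i0 * c X i0 * (m i * m i))"
      by (intro sum.cong refl) (simp add: power2_eq_square algebra_simps)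
    also have "\<dots> = (\<Sum>i\<in>?I. c X i * c X i) - 2 * c X i0 * (\<Sum>i\<in>?I. c X i * m i)
        + c X i0 * c X i0 * (\<Sum>i\<in>?I. m i * m i)"
      by (simp only: sum.distrib sum_subtractf sum_distrib_left)
    also have "\<dots> = B X X" unfolding m1 mX[OF X] Bc by simp
    finally show ?thesis ..
  qed
  show "B X X \<ge> 0" unfolding eq by (intro sum_nonneg) simp
  assume "B X X = 0"
  then have z: "c X i = c X i0 * m i" if "i \<noteq> i0" for i
    using that unfolding eq by (simp add: sum_nonneg_eq_0_iff)
  have "X = (\<Sum>i\<in>?I. c X i *\<^sub>R e i) + c X i0 *\<^sub>R e i0" by (rule ev)
  also have "(\<Sum>i\<in>?I. c X i *\<^sub>R e i) = (\<Sum>i\<in>?I. (c X i0 / c N i0) *\<^sub>R (c N i *\<^sub>R e i))"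
    by (intro sum.cong refl) (use N0 in \<open>auto simp: cN z\<close>)
  also have "\<dots> + c X i0 *\<^sub>R e i0 = (c X i0 / c N i0) *\<^sub>R ((\<Sum>i\<in>?I. c N i *\<^sub>R e i) + c N i0 *\<^sub>R e i0)"
    using N0 by (simp add: scaleR_add_right scaleR_sum_right)
  also have "\<dots> = (c X i0 / c N i0) *\<^sub>R N" unfolding ev[symmetric] ..
  finally show "X \<in> span {N}" by (metis span_base span_mul singletonI)
qed

text \<open>With the frame above, the vectors \<open>e i + m i e i0\<close> span the orthogonal complement of \<open>N\<close>, and the sum of the
  squared lengths of their images under \<open>H\<close> is the trace of \<open>H\<^sup>2\<close>.\<close>

lemma lorentzian_self_adjoint_maps_null_complement:
  fixes B :: "real^'d::finite \<Rightarrow> real^'d \<Rightarrow> real"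
  assumes B: "lorentzian_form B" and H: "linear H" "\<And>u v. B (H u) v = B u (H v)"
    and N: "N \<noteq> 0" "B N N = 0" "H N = 0" and tr: "trace (matrix (\<lambda>u. H (H u))) = 0"
    and X: "B X N = 0"
  shows "H X \<in> span {N}"
proof -
  obtain e :: "'d \<Rightarrow> real^'d" and i0 s c m where s: "s = (\<lambda>i. if i = i0 then - 1 else 1)"
    and e: "\<And>v. v = (\<Sum>i\<in>UNIV. (s i * B v (e i)) *\<^sub>R e i)"
    and ev: "\<And>v. v = (\<Sum>i\<in>UNIV - {i0}. c v i *\<^sub>R e i) + c v i0 *\<^sub>R e i0"
    and Bc: "\<And>u v. B u v = (\<Sum>i\<in>UNIV - {i0}. c u i * c v i) - c u i0 * c v i0"
    and N0: "c N i0 \<noteq> 0" and cN: "\<And>i. i \<noteq> i0 \<Longrightarrow> c N i = c N i0 * m i" and m1: "(\<Sum>i\<in>UNIV - {i0}. m i * m i) = 1"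
    and mX: "\<And>X. B X N = 0 \<Longrightarrow> (\<Sum>i\<in>UNIV - {i0}. c X i * m i) = c X i0"
    by (rule lorentzian_null_frame[OF B N(1,2)]) (rule that)
  let ?I = "UNIV - {i0}"
  note Bl = lorentzian_form_linear(1)[OF B] and Br = lorentzian_form_linear(2)[OF B]
  \<comment> \<open>This is H N = 0 written in the frame and divided by the time component of
    N.\<close>
  have mH: "(\<Sum>i\<in>?I. m i *\<^sub>R H (e i)) = - H (e i0)"
  proof -
    have "c N i0 *\<^sub>R ((\<Sum>i\<in>?I. m i *\<^sub>R H (e i)) + H (e i0)) = H ((\<Sum>i\<in>?I. c N i *\<^sub>R e i) + c N i0 *\<^sub>R e i0)"
    proof -
      have "(\<Sum>i\<in>?I. c N i *\<^sub>R e i) = (\<Sum>i\<in>?I. c N i0 *\<^sub>R (m i *\<^sub>R e i))"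
        by (intro sum.cong refl) (simp add: cN)
      then show ?thesis
        by (simp add: linear_add[OF H(1)] linear_sum[OF H(1)] linear_cmul[OF H(1)] scaleR_add_right scaleR_sum_right)
    qed
    also have "\<dots> = 0" using ev N(3) by metis
    finally show ?thesis using N0 by (simp add: add_eq_0_iff2)
  qed
  define Y where "Y i = e i + m i *\<^sub>R e i0" for i
  have HY: "H (Y i) = H (e i) + m i *\<^sub>R H (e i0)" for i
    by (simp add: Y_def linear_add[OF H(1)] linear_cmul[OF H(1)])
  have YN: "B (H (Y i)) N = 0" for i
    using H(2) N(3) linear_0[OF Bl] by simp
  have sq: "B (a + t *\<^sub>R b) (a + t *\<^sub>R b) = B a a + 2 * B (t *\<^sub>R a) b + (t * t) * B b b" for a b t
    using lorentzian_form_sym[OF B, of b a]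
    by (simp add: linear_add[OF Bl] linear_add[OF Br] linear_cmul[OF Bl] linear_cmul[OF Br] algebra_simps)
  have "(\<Sum>i\<in>?I. B (H (Y i)) (H (Y i))) = (\<Sum>i\<in>?I. B (H (e i)) (H (e i)) + 2 * B (m i *\<^sub>R H (e i)) (H (e i0))
      + (m i * m i) * B (H (e i0)) (H (e i0)))"
    by (simp only: HY sq)
  also have "\<dots> = (\<Sum>i\<in>?I. B (H (e i)) (H (e i))) + 2 * B (\<Sum>i\<in>?I. m i *\<^sub>R H (e i)) (H (e i0))
      + (\<Sum>i\<in>?I. m i * m i) * B (H (e i0)) (H (e i0))"
    unfolding linear_sum[OF Br] by (simp add: sum.distrib sum_distrib_left sum_distrib_right)
  \<comment> \<open>By \<open>mH\<close> the cross term is - 2 times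
    \<open>B (H (e i0)) (H (e i0))\<close>, and by \<open>m1\<close> the last term is + 1 times it.
    The total factor - 1 is the timelike sign \<open>s i0\<close>.\<close>
  also have "\<dots> = (\<Sum>i\<in>?I. s i * B (H (H (e i))) (e i)) + s i0 * B (H (H (e i0))) (e i0)"
  proof -
    have "(\<Sum>i\<in>?I. s i * B (H (H (e i))) (e i)) = (\<Sum>i\<in>?I. B (H (e i)) (H (e i)))"
      by (intro sum.cong refl) (simp add: s H(2))
    then show ?thesis unfolding m1 mH by (simp add: linear_neg[OF Br] H(2) s)
  qed
  also have "\<dots> = trace (matrix (\<lambda>u. H (H u)))"
    using trace_lorentzian[OF B _ e, of "\<lambda>u. H (H u)"] linear_compose[OF H(1) H(1)]
    by (simp add: o_def sum.remove[of UNIV i0])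
  finally have "(\<Sum>i\<in>?I. B (H (Y i)) (H (Y i))) = 0" using tr by simp
  then have "B (H (Y i)) (H (Y i)) = 0" if "i \<noteq> i0" for i
    using that lorentzian_null_orthogonal(1)[OF B N(1,2) YN] by (subst (asm) sum_nonneg_eq_0_iff) auto
  then have HYs: "H (Y i) \<in> span {N}" if "i \<noteq> i0" for i
    using lorentzian_null_orthogonal(2)[OF B N(1,2) YN] that by auto
  have "(\<Sum>i\<in>?I. c X i *\<^sub>R Y i) = (\<Sum>i\<in>?I. c X i *\<^sub>R e i) + (\<Sum>i\<in>?I. c X i * m i) *\<^sub>R e i0"
    by (simp add: Y_def scaleR_add_right sum.distrib scaleR_sum_left)
  then have "(\<Sum>i\<in>?I. c X i *\<^sub>R Y i) = X" unfolding mX[OF X] ev[symmetric] .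
  then have "H X = H (\<Sum>i\<in>?I. c X i *\<^sub>R Y i)" by simp
  also have "\<dots> = (\<Sum>i\<in>?I. c X i *\<^sub>R H (Y i))"
    by (simp only: linear_sum[OF H(1)] linear_cmul[OF H(1)])
  finally have "H X = (\<Sum>i\<in>?I. c X i *\<^sub>R H (Y i))" .
  then show ?thesis using HYs by (auto intro!: span_sum span_mul)
qed

section \<open>Pointwise algebra of a self-adjoint operator that kills a null vector\<close>

locale null_self_adjoint =
  fixes B :: "real^'d::finite \<Rightarrow> real^'d \<Rightarrow> real" and H :: "real^'d \<Rightarrow> real^'d" and N :: "real^'d"
  assumes B: "lorentzian_form B" and H: "linear H" and adj: "B (H u) v = B u (H v)"
    and N: "N \<noteq> 0" "B N N = 0" "H N = 0" and tr: "trace (matrix (\<lambda>u. H (H u))) = 0"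
begin

lemmas Bl = lorentzian_form_linear(1)[OF B] and Br = lorentzian_form_linear(2)[OF B]

lemma maps_complement: "B X N = 0 \<Longrightarrow> H X \<in> span {N}"
  using lorentzian_self_adjoint_maps_null_complement[OF B H adj N tr] .

lemma image_in_complement: "B (H u) N = 0"
  using adj N(3) linear_0[OF Bl] by simp

text \<open>Self-adjointness and H N = 0 put the range of H into the complement of N. A second
  application leads into the line of N, and a third one kills it.\<close>

lemma cube_eq_0: "H (H (H u)) = 0"
  using maps_complement[OF image_in_complement[of u]] N(3) linear_cmul[OF H]
  by (auto simp: span_singleton)

lemma exists_transversal: "\<exists>U. B U N = 1"
proof -
  obtain w where "B N w \<noteq> 0" using lorentzian_nondegenerate[OF B] N(1) by metis
  then have "B ((1 / B N w) *\<^sub>R w) N = 1"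
    using lorentzian_form_sym[OF B] linear_cmul[OF Br] by simp
  then show ?thesis by blast
qed

text \<open>From H^2 = 0 follows B (H u) (H u) = B (H (H u)) u = 0, so H u is null and orthogonal to
  N, hence a multiple of N. For the kernel, compare B (H X) U with B X (H U), where B U N = 1: the
  second vanishes if X is orthogonal to N, and the first is the coefficient of H X along N.\<close>

lemma square_eq_0_structure:
  assumes sq: "\<And>u. H (H u) = 0" and nz: "H \<noteq> (\<lambda>_. 0)"
  shows "{v. H v = 0} = {v. B v N = 0}" "range H = span {N}"
proof -
  have HN: "H u \<in> span {N}" for u
  proof (rule lorentzian_null_orthogonal(2)[OF B N(1,2) image_in_complement])
    show "B (H u) (H u) = 0" using adj[of "H u" u] sq linear_0[OF Br] lorentzian_form_sym[OF B] by metis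
  qed
  obtain U where U: "B U N = 1" using exists_transversal by blast
  have ker: "H X = 0" if X: "B X N = 0" for X
  proof -
    obtain a where a: "H X = a *\<^sub>R N" using HN[of X] by (auto simp: span_singleton)
    obtain b where b: "H U = b *\<^sub>R N" using HN[of U] by (auto simp: span_singleton)
    have "a * B N U = b * B X N"
      using adj[of X U] by (simp add: a b linear_cmul[OF Bl] linear_cmul[OF Br])
    then have "a = 0" using U X lorentzian_form_sym[OF B, of N U] by simp
    then show ?thesis by (simp add: a)
  qed
  have dec: "H v = B v N *\<^sub>R H U" for v
  proof -
    have "B (v - B v N *\<^sub>R U) N = 0" by (simp add: linear_diff[OF Br] linear_cmul[OF Br] U)
    from ker[OF this] show ?thesis by (simp add: linear_diff[OF H] linear_cmul[OF H])
  qed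
  have HU: "H U \<noteq> 0"
  proof
    assume "H U = 0"
    then have "H v = 0" for v by (subst dec) simp
    then show False using nz by auto
  qed
  then have "H v = 0 \<longleftrightarrow> B v N = 0" for v by (subst dec) simp
  then show "{v. H v = 0} = {v. B v N = 0}" by blast
  obtain b where b: "H U = b *\<^sub>R N" "b \<noteq> 0" using HN[of U] HU by (auto simp: span_singleton)
  show "range H = span {N}"
  proof
    show "span {N} \<subseteq> range H"
    proof
      fix y assume "y \<in> span {N}"
      then obtain k where "y = k *\<^sub>R N" by (auto simp: span_singleton)
      then have "y = H ((k / b) *\<^sub>R U)" using b by (simp add: linear_cmul[OF H])
      then show "y \<in> range H" by blast
    qed
  qed (use HN in auto)
qed

text \<open>U is transversal to the hyperplane orthogonal to N, so every H v differs from a multiple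
  of H U by the image of a vector of that hyperplane, which is a multiple of N. Since H kills N but
  not H U, the vectors N and H U are independent.\<close>

lemma square_ne_0_rank:
  assumes sq: "H (H U) \<noteq> 0"
  shows "endo_rank H = 2"
proof -
  have UN: "B U N \<noteq> 0"
  proof
    assume "B U N = 0"
    from maps_complement[OF this] have "H (H U) = 0"
      using N(3) linear_cmul[OF H] by (auto simp: span_singleton)
    then show False using sq by simp
  qed
  obtain a where a: "H (H U) = a *\<^sub>R N" "a \<noteq> 0"
    using maps_complement[OF image_in_complement[of U]] sq by (auto simp: span_singleton)
  have range: "range H = span {N, H U}"
  proof
    show "range H \<subseteq> span {N, H U}"
    proof
      fix y assume "y \<in> range H"
      then obtain v where v: "y = H v" by blast
      have "B (v - (B v N / B U N) *\<^sub>R U) N = 0" using UN by (simp add: linear_diff[OF Br] linear_cmul[OF Br])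
      from maps_complement[OF this] have "H v - (B v N / B U N) *\<^sub>R H U \<in> span {N}"
        by (simp add: linear_diff[OF H] linear_cmul[OF H])
      then have "H v - (B v N / B U N) *\<^sub>R H U \<in> span {N, H U}" 
        using span_mono[of "{N}" "{N, H U}"] by blast
      then have "(H v - (B v N / B U N) *\<^sub>R H U) + (B v N / B U N) *\<^sub>R H U \<in> span {N, H U}"
        by (intro span_add span_mul) (auto intro: span_base)
      then show "y \<in> span {N, H U}" by (simp add: v)
    qed
    have "N = H ((1 / a) *\<^sub>R H U)" using a by (simp add: linear_cmul[OF H])
    then have "{N, H U} \<subseteq> range H" by blast
    then show "span {N, H U} \<subseteq> range H" using H linear_subspace_image[OF H subspace_UNIV] by (simp add: span_minimal)
  qed
  have "H U \<notin> span {N}" using sq N(3) linear_cmul[OF H] by (auto simp: span_singleton)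
  then have "independent {N, H U}" "N \<noteq> H U"
    using N(1) by (auto simp: independent_insert insert_commute[of N] intro: span_base)
  then show ?thesis unfolding endo_rank_def range dim_span by (simp add: dim_eq_card_independent)
qed

end


section \<open>Derivatives of families of linear and bilinear maps\<close>

abbreviation der :: "('a::real_normed_vector \<Rightarrow> 'b::real_normed_vector) \<Rightarrow> 'a \<Rightarrow> 'a \<Rightarrow> 'b" where
  "der f x \<equiv> frechet_derivative f (at x)"

lemma der_eqI: "(f has_derivative f') (at x) \<Longrightarrow> der f x = f'"
  using frechet_derivative_at by metis

lemma has_derivative_constD: "((\<lambda>_. c) has_derivative f') (at x) \<Longrightarrow> f' w = 0"
  by (rule fun_cong[OF has_derivative_unique[OF _ has_derivative_const]])

lemma linear_der_family:
  fixes L :: "'a::real_normed_vector \<Rightarrow> 'c::real_vector \<Rightarrow> 'b::real_normed_vector"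
  assumes S: "open S" "x \<in> S" and L: "\<And>y. y \<in> S \<Longrightarrow> linear (L y)" and sm: "\<And>v. smooth_on S (\<lambda>y. L y v)"
  shows "linear (\<lambda>v. der (\<lambda>y. L y v) x w)"
proof
  note d = smooth_on_has_derivative[OF sm S(2)]
  fix u v r
  have "((\<lambda>y. L y (u + v)) has_derivative (\<lambda>w. der (\<lambda>y. L y u) x w + der (\<lambda>y. L y v) x w)) (at x)"
    by (rule has_derivative_transform_within_open[OF has_derivative_add[OF d d] S]) (simp add: L linear_add)
  then show "der (\<lambda>y. L y (u + v)) x w = der (\<lambda>y. L y u) x w + der (\<lambda>y. L y v) x w"
    by (simp add: der_eqI)
  have "((\<lambda>y. L y (r *\<^sub>R u)) has_derivative (\<lambda>w. r *\<^sub>R der (\<lambda>y. L y u) x w)) (at x)"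
    by (rule has_derivative_transform_within_open[OF has_derivative_scaleR_right[OF d] S]) (simp add: L linear_cmul)
  then show "der (\<lambda>y. L y (r *\<^sub>R u)) x w = r *\<^sub>R der (\<lambda>y. L y u) x w"
    by (simp add: der_eqI)
qed

lemma has_derivative_smooth_linear_family:
  fixes L :: "'a::real_normed_vector \<Rightarrow> real^'d \<Rightarrow> 'b::real_normed_vector"
  assumes S: "open S" "x \<in> S" and L: "\<And>y. y \<in> S \<Longrightarrow> linear (L y)" and sm: "\<And>v. smooth_on S (\<lambda>y. L y v)"
    and X: "(X has_derivative X') (at x)"
  shows "((\<lambda>y. L y (X y)) has_derivative (\<lambda>w. der (\<lambda>y. L y (X x)) x w + L x (X' w))) (at x)"
  by (rule has_derivative_linear_family[where L' = "\<lambda>w v. der (\<lambda>y. L y v) x w", OF S L _ X])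
     (use smooth_on_has_derivative[OF sm S(2)] in auto)

lemma has_derivative_smooth_bilinear_family:
  fixes B :: "'a::real_normed_vector \<Rightarrow> real^'d \<Rightarrow> real^'e \<Rightarrow> 'b::real_normed_vector"
  assumes S: "open S" "x \<in> S" and B: "\<And>y. y \<in> S \<Longrightarrow> bilinear (B y)" and sm: "\<And>u v. smooth_on S (\<lambda>y. B y u v)"
    and X: "(X has_derivative X') (at x)" and Y: "(Y has_derivative Y') (at x)"
  shows "((\<lambda>y. B y (X y) (Y y)) has_derivative
    (\<lambda>w. der (\<lambda>y. B y (X x) (Y x)) x w + B x (X' w) (Y x) + B x (X x) (Y' w))) (at x)"
proof (rule has_derivative_linear_family[where L = "\<lambda>y v. B y (X y) v" and X = Y
      and L' = "\<lambda>w v. der (\<lambda>y. B y (X x) v) x w + B x (X' w) v", OF S])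
  show "((\<lambda>y. B y (X y) v) has_derivative (\<lambda>w. der (\<lambda>y. B y (X x) v) x w + B x (X' w) v)) (at x)" for v
    by (rule has_derivative_smooth_linear_family[where L = "\<lambda>y u. B y u v", OF S _ sm X])
       (use B in \<open>simp add: bilinear_def\<close>)
qed (use B Y in \<open>auto simp: bilinear_def\<close>)

lemma smooth_on_bilinear_family:
  fixes B :: "'a::real_normed_vector \<Rightarrow> real^'d \<Rightarrow> real^'e \<Rightarrow> 'b::real_normed_vector"
  assumes "open S" "\<And>y. y \<in> S \<Longrightarrow> bilinear (B y)" "\<And>u v. smooth_on S (\<lambda>y. B y u v)"
    and "smooth_on S X" "smooth_on S Y"
  shows "smooth_on S (\<lambda>y. B y (X y) (Y y))"
proof (rule smooth_on_linear_family[where L = "\<lambda>y v. B y (X y) v", OF assms(1) _ _ assms(5)])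
  show "smooth_on S (\<lambda>y. B y (X y) v)" for v
    by (rule smooth_on_linear_family[where L = "\<lambda>y u. B y u v", OF assms(1) _ assms(3,4)])
       (use assms(2) in \<open>simp add: bilinear_def\<close>)
qed (use assms(2) in \<open>simp add: bilinear_def\<close>)

lemma smooth_on_det:
  fixes A :: "'a::real_normed_vector \<Rightarrow> real^'d^'d"
  assumes "open S" "\<And>i j. smooth_on S (\<lambda>x. A x $ i $ j)"
  shows "smooth_on S (\<lambda>x. det (A x))"
  unfolding det_def by (intro smooth_on_sum smooth_on_mult smooth_on_prod smooth_on_const assms)

lemma trace_matrix: "trace (matrix T) = (\<Sum>k\<in>UNIV. T (axis k 1) $ k)"
  by (simp add: trace_def matrix_def)

text \<open>An injective \<open>L\<close> is invertible, so \<open>T'\<close> is a conjugate of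
  \<open>T\<close>, and the trace is cyclic.\<close>

lemma trace_conjugate:
  fixes T T' L :: "real^'d \<Rightarrow> real^'d"
  assumes "linear T" "linear T'" "linear L" "inj L" "\<And>w. T' (L w) = L (T w)"
  shows "trace (matrix T') = trace (matrix T)"
proof -
  obtain K where K: "linear K" "L \<circ> K = id"
    using linear_surjective_right_inverse[OF assms(3) linear_injective_imp_surjective[OF assms(3,4)]] by auto
  have "T' = L \<circ> (T \<circ> K)"
  proof
    fix w
    have "L (K w) = w" using K(2) by (metis comp_apply id_apply)
    then show "T' w = (L \<circ> (T \<circ> K)) w" using assms(5)[of "K w"] by simp
  qed
  then have "trace (matrix T') = trace (matrix L ** matrix (T \<circ> K))"
    using assms K by (simp add: matrix_compose linear_compose)
  also have "\<dots> = trace (matrix (T \<circ> K) ** matrix L)" by (rule trace_mul_sym)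
  also have "\<dots> = trace (matrix ((T \<circ> K) \<circ> L))"
    using assms K by (simp add: matrix_compose linear_compose)
  also have "(T \<circ> K) \<circ> L = T"
  proof
    fix w
    have "L (K (L w)) = L w" using K(2) by (metis comp_apply id_apply)
    then show "((T \<circ> K) \<circ> L) w = T w" using assms(4) by (simp add: inj_eq)
  qed
  finally show ?thesis .
qed

section \<open>Geometry in one coordinate system\<close>

locale coordinate_metric =
  fixes G :: "'d::finite form_field" and S :: "(real^'d) set"
  assumes open_S: "open S"
    and lorentzian: "x \<in> S \<Longrightarrow> lorentzian_form (G x)"
    and smooth_G: "smooth_on S (\<lambda>x. G x u v)"
begin

lemmas G_sym = lorentzian_form_sym[OF lorentzian]
lemmas G_bilinear = lorentzian_form_bilinear[OF lorentzian]
lemmas G_linear = lorentzian_form_linear[OF lorentzian]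
lemmas G_eqI = lorentzian_eqI[OF lorentzian]
lemmas G_simps = bilinear_ladd[OF G_bilinear] bilinear_radd[OF G_bilinear] bilinear_lsub[OF G_bilinear]
  bilinear_rsub[OF G_bilinear] bilinear_lmul[OF G_bilinear] bilinear_rmul[OF G_bilinear]
  bilinear_lzero[OF G_bilinear] bilinear_rzero[OF G_bilinear] bilinear_lneg[OF G_bilinear] bilinear_rneg[OF G_bilinear]

text \<open>The description operator in \<open>sharp\<close> hides how the vector depends on the
  point. Cramer's rule for the Gram matrix of the standard basis exhibits its components as
  quotients of smooth determinants.\<close>

lemma smooth_sharp:
  assumes lin: "\<And>y. y \<in> S \<Longrightarrow> linear (\<alpha> y)" and sm: "\<And>w. smooth_on S (\<lambda>y. \<alpha> y w)"
  shows "smooth_on S (\<lambda>y. sharp G y (\<alpha> y))"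
proof -
  define A :: "real^'d \<Rightarrow> real^'d^'d" where "A y = (\<chi> i j. G y (axis i 1) (axis j 1))" for y
  define b :: "real^'d \<Rightarrow> real^'d" where "b y = (\<chi> i. \<alpha> y (axis i 1))" for y
  have A: "A y *v v = (\<chi> i. G y v (axis i 1))" if "y \<in> S" for y v
    unfolding vec_eq_iff matrix_vector_mult_def A_def
    by (simp add: G_sym[OF that, of v] linear_basis_expansion[OF G_linear(1)[OF that], of "axis _ 1" v] mult.commute)
  have det: "det (A y) \<noteq> 0" if "y \<in> S" for y
  proof -
    have "v = 0" if v: "A y *v v = 0" for v
    proof (rule lorentzian_nondegenerate[OF lorentzian[OF \<open>y \<in> S\<close>]])
      fix w
      have "G y v (axis i 1) = 0" for i using v A[OF \<open>y \<in> S\<close>] by (simp add: vec_eq_iff)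
      then show "G y v w = 0" using linear_basis_expansion[OF G_linear(1)[OF \<open>y \<in> S\<close>], of v w] by simp
    qed
    then have "inj ((*v) (A y))" by (simp add: linear_injective_0)
    then show ?thesis
      using det_nz_iff_inj[OF matrix_vector_mul_linear, of "A y"] by (simp add: matrix_of_matrix_vector_mul)
  qed
  have sharp: "sharp G y (\<alpha> y) $ k = det (\<chi> i j. if j = k then b y $ i else A y $ i $ j) / det (A y)" if "y \<in> S" for y k
  proof -
    have "A y *v sharp G y (\<alpha> y) = b y"
      using A[OF that] sharp_works[of G y, OF lorentzian[OF that] lin[OF that]] by (simp add: b_def)
    then show ?thesis using cramer[OF det[OF that]] by simp
  qed
  show ?thesis
  proof (rule smooth_on_componentwise[OF open_S])
    fix k
    have entry: "smooth_on S (\<lambda>y. A y $ i $ j)"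
      "smooth_on S (\<lambda>y. (\<chi> i j. if j = k then b y $ i else A y $ i $ j) $ i $ j)" for i j
      by (cases "j = k"; simp add: A_def b_def smooth_G sm)+
    have "smooth_on S (\<lambda>y. det (\<chi> i j. if j = k then b y $ i else A y $ i $ j) / det (A y))"
      by (intro smooth_on_divide smooth_on_det open_S det entry)
    then show "smooth_on S (\<lambda>y. sharp G y (\<alpha> y) $ k)"
      by (subst smooth_on_cong[OF open_S]) (use sharp in auto)
  qed
qed

lemma dG_linear:
  assumes "x \<in> S"
  shows "linear (\<lambda>w. der (\<lambda>y. G y u v) x w)"
    "linear (\<lambda>u. der (\<lambda>y. G y u v) x w)" "linear (\<lambda>v. der (\<lambda>y. G y u v) x w)"
  using smooth_on_linear_frechet_derivative[OF smooth_G assms]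
    linear_der_family[OF open_S assms, of "\<lambda>y u. G y u v"] linear_der_family[OF open_S assms, of "\<lambda>y v. G y u v"]
    G_linear smooth_G by auto

lemmas dG_simps = linear_add[OF dG_linear(1)] linear_add[OF dG_linear(2)] linear_add[OF dG_linear(3)]
  linear_cmul[OF dG_linear(1)] linear_cmul[OF dG_linear(2)] linear_cmul[OF dG_linear(3)]

lemma dG_sym: "x \<in> S \<Longrightarrow> der (\<lambda>y. G y u v) x = der (\<lambda>y. G y v u) x"
  by (rule frechet_derivative_cong_open[OF open_S]) (simp_all add: G_sym)

section \<open>The Levi-Civita connection in coordinates\<close>

lemma linear_koszul:
  assumes "x \<in> S"
  shows "linear (\<lambda>w. (der (\<lambda>y. G y v w) x u + der (\<lambda>y. G y u w) x v - der (\<lambda>y. G y u v) x w) / 2)"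
  by (rule linearI) (simp_all add: dG_simps[OF assms] field_simps)

lemma koszul:
  assumes "x \<in> S"
  shows "2 * G x (christoffel G x u v) w = der (\<lambda>y. G y v w) x u + der (\<lambda>y. G y u w) x v - der (\<lambda>y. G y u v) x w"
  unfolding christoffel_def
  by (subst sharp_works[of G x, OF lorentzian[OF assms]]) (use linear_koszul[OF assms] in auto)

lemma christoffel_sym: "x \<in> S \<Longrightarrow> christoffel G x u v = christoffel G x v u"
  by (simp add: christoffel_def dG_sym[of x u v] add.commute)

lemma christoffel_linear_left:
  assumes "x \<in> S"
  shows "linear (\<lambda>u. christoffel G x u v)"
proof
  fix u u' r
  note k = koszul[OF assms] and s = dG_simps[OF assms] G_simps[OF assms]
  have "2 * G x (christoffel G x (u + u') v) w = 2 * G x (christoffel G x u v + christoffel G x u' v) w" for w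
    unfolding k s distrib_left by simp
  then show "christoffel G x (u + u') v = christoffel G x u v + christoffel G x u' v"
    using G_eqI[OF assms] by simp
  have "2 * G x (christoffel G x (r *\<^sub>R u) v) w = r * (2 * G x (christoffel G x u v) w)" for w
    unfolding k s by (simp add: algebra_simps)
  then show "christoffel G x (r *\<^sub>R u) v = r *\<^sub>R christoffel G x u v"
    using G_eqI[OF assms] by (simp add: s)
qed

lemma christoffel_bilinear:
  assumes "x \<in> S"
  shows "bilinear (christoffel G x)"
  unfolding bilinear_def using christoffel_linear_left[OF assms] christoffel_sym[OF assms] by simp

lemmas christoffel_simps = bilinear_ladd[OF christoffel_bilinear] bilinear_radd[OF christoffel_bilinear]
  bilinear_lsub[OF christoffel_bilinear] bilinear_rsub[OF christoffel_bilinear]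
  bilinear_lmul[OF christoffel_bilinear] bilinear_rmul[OF christoffel_bilinear]
  bilinear_lzero[OF christoffel_bilinear] bilinear_rzero[OF christoffel_bilinear]

lemma smooth_christoffel: "smooth_on S (\<lambda>x. christoffel G x u v)"
  unfolding christoffel_def
proof (rule smooth_sharp)
  fix w
  show "smooth_on S (\<lambda>y. (der (\<lambda>y. G y v w) y u + der (\<lambda>y. G y u w) y v - der (\<lambda>y. G y u v) y w) / 2)"
    by (intro smooth_on_divide smooth_on_diff smooth_on_add smooth_on_frechet_derivative smooth_G open_S smooth_on_const) simp
qed (rule linear_koszul)

text \<open>Metric compatibility: in the sum of the Koszul identities for (w, u, v) and (w, v, u)
  everything cancels except twice the derivative of \<open>G y u v\<close> along w.\<close>

lemma dG_christoffel:
  assumes "x \<in> S"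
  shows "der (\<lambda>y. G y u v) x w = G x (christoffel G x w u) v + G x u (christoffel G x w v)"
  using koszul[OF assms, of w u v] koszul[OF assms, of w v u]
    dG_sym[OF assms, of u v] dG_sym[OF assms, of u w] dG_sym[OF assms, of v w] G_sym[OF assms, of u]
  by simp

section \<open>Curvature and the Ricci tensor in coordinates\<close>

lemma nabla_const: "nabla G (\<lambda>_. u) (\<lambda>_. v) = (\<lambda>x. christoffel G x u v)"
  by (auto simp: nabla_def dir_deriv_def)

text \<open>The curvature of fields with constant components, whose bracket vanishes. It takes
  vectors where \<open>curvature\<close> takes fields, so linearity and transformation behaviour can
  be read off from the Christoffel symbols.\<close>

definition riemann :: "real^'d \<Rightarrow> real^'d \<Rightarrow> real^'d \<Rightarrow> real^'d \<Rightarrow> real^'d" where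
  "riemann x w u v = der (\<lambda>y. christoffel G y u v) x w - der (\<lambda>y. christoffel G y w v) x u
     + christoffel G x w (christoffel G x u v) - christoffel G x u (christoffel G x w v)"

lemma curvature_const:
  assumes "x \<in> S"
  shows "curvature G (\<lambda>_. w) (\<lambda>_. u) (\<lambda>_. v) x = riemann x w u v"
  unfolding curvature_def nabla_const
  by (simp add: nabla_def dir_deriv_def riemann_def lie_bracket_def christoffel_simps[OF assms] algebra_simps)

lemma dchristoffel_linear:
  assumes "x \<in> S"
  shows "linear (\<lambda>w. der (\<lambda>y. christoffel G y u v) x w)"
    "linear (\<lambda>u. der (\<lambda>y. christoffel G y u v) x w)" "linear (\<lambda>v. der (\<lambda>y. christoffel G y u v) x w)"
  using smooth_on_linear_frechet_derivative[OF smooth_christoffel assms]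
    linear_der_family[OF open_S assms, of "\<lambda>y u. christoffel G y u v"]
    linear_der_family[OF open_S assms, of "\<lambda>y v. christoffel G y u v"]
    christoffel_bilinear smooth_christoffel by (auto simp: bilinear_def)

lemma riemann_linear:
  assumes "x \<in> S"
  shows "linear (\<lambda>w. riemann x w u v)" "linear (\<lambda>v. riemann x w u v)"
  unfolding riemann_def
  by (rule linearI; simp add: linear_add[OF dchristoffel_linear(1)[OF assms]] linear_cmul[OF dchristoffel_linear(1)[OF assms]]
      linear_add[OF dchristoffel_linear(2)[OF assms]] linear_cmul[OF dchristoffel_linear(2)[OF assms]]
      linear_add[OF dchristoffel_linear(3)[OF assms]] linear_cmul[OF dchristoffel_linear(3)[OF assms]]
      christoffel_simps[OF assms] algebra_simps)+

lemma ricci_riemann: "x \<in> S \<Longrightarrow> ricci G x u v = trace (matrix (\<lambda>w. riemann x w u v))"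
  by (simp add: ricci_def curvature_const)

lemma linear_ricci: "x \<in> S \<Longrightarrow> linear (ricci G x u)"
  by (rule linearI)
     (simp_all add: ricci_riemann trace_matrix linear_add[OF riemann_linear(2)] linear_cmul[OF riemann_linear(2)]
       sum.distrib sum_distrib_left)

lemma G_ricci_op: "x \<in> S \<Longrightarrow> G x (ricci_op G x u) v = ricci G x u v"
  unfolding ricci_op_def by (rule sharp_works[OF lorentzian linear_ricci])

section \<open>Gradient and Hessian in coordinates\<close>

lemma G_grad: "x \<in> S \<Longrightarrow> smooth_on T h \<Longrightarrow> x \<in> T \<Longrightarrow> G x (grad G h x) w = der h x w"
  unfolding grad_def by (rule sharp_works[OF lorentzian smooth_on_linear_frechet_derivative])

lemma smooth_grad: "smooth_on S h \<Longrightarrow> smooth_on S (grad G h)"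
  unfolding grad_def[abs_def] by (rule smooth_sharp) (auto intro: smooth_on_linear_frechet_derivative smooth_on_frechet_derivative)

lemma hess_const: "hess G h (\<lambda>_. u) (\<lambda>_. v) x = der (\<lambda>y. der h y v) x u - der h x (christoffel G x u v)"
  by (simp add: hess_def dir_deriv_def[abs_def] nabla_const)

lemma hess_sym:
  assumes "x \<in> S" "smooth_on S h"
  shows "hess G h (\<lambda>_. u) (\<lambda>_. v) x = hess G h (\<lambda>_. v) (\<lambda>_. u) x"
  using second_derivative_symmetric_real[OF assms(2) open_S assms(1)] christoffel_sym[OF assms(1)]
  by (simp add: hess_const)

lemma hess_op_eq: "hess_op G h x u = der (grad G h) x u + christoffel G x u (grad G h x)"
  by (simp add: hess_op_def nabla_def dir_deriv_def)

text \<open>Metric compatibility for moving fields, in the form used to differentiate identities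
  such as the vanishing of an inner product.\<close>

lemma G_nabla:
  assumes x: "x \<in> S" and X: "(X has_derivative X') (at x)" and Y: "(Y has_derivative Y') (at x)"
  shows "((\<lambda>y. G y (X y) (Y y)) has_derivative
     (\<lambda>w. G x (X' w + christoffel G x w (X x)) (Y x) + G x (X x) (Y' w + christoffel G x w (Y x)))) (at x)"
  using has_derivative_smooth_bilinear_family[OF open_S x G_bilinear smooth_G X Y]
  by (simp add: dG_christoffel[OF x] G_simps[OF x] add_ac)

text \<open>Differentiate G (grad h) v = dh(v) for constant v: the covariant derivative of the
  constant field v is a Christoffel symbol and yields the first-order term of the Hessian.\<close>

lemma G_hess_op:
  assumes x: "x \<in> S" and h: "smooth_on S h"
  shows "G x (hess_op G h x u) v = hess G h (\<lambda>_. u) (\<lambda>_. v) x"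
proof -
  have "((\<lambda>y. G y (grad G h y) v) has_derivative
    (\<lambda>w. G x (der (grad G h) x w + christoffel G x w (grad G h x)) v + G x (grad G h x) (0 + christoffel G x w v))) (at x)"
    by (rule G_nabla[OF x smooth_on_has_derivative[OF smooth_grad[OF h] x] has_derivative_const])
  then have "((\<lambda>y. der h y v) has_derivative
    (\<lambda>w. G x (der (grad G h) x w + christoffel G x w (grad G h x)) v + G x (grad G h x) (0 + christoffel G x w v))) (at x)"
    by (rule has_derivative_transform_within_open[OF _ open_S x]) (rule G_grad[OF _ h])
  then show ?thesis
    by (simp add: hess_const hess_op_eq der_eqI G_grad[OF x h x])
qed

lemma hess_op_linear:
  assumes x: "x \<in> S" and h: "smooth_on S h"
  shows "linear (hess_op G h x)"
  unfolding hess_op_eq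
  by (intro linear_compose_add smooth_on_linear_frechet_derivative[OF smooth_grad[OF h] x] christoffel_linear_left[OF x])

lemma hess_op_adjoint:
  assumes x: "x \<in> S" and h: "smooth_on S h"
  shows "G x (hess_op G h x u) v = G x u (hess_op G h x v)"
  using G_hess_op[OF assms] hess_sym[OF assms] G_sym[OF x] by metis

lemma smooth_hess_op:
  assumes h: "smooth_on S h"
  shows "smooth_on S (\<lambda>y. hess_op G h y u)"
  unfolding hess_op_eq
  by (intro smooth_on_add open_S smooth_on_frechet_derivative smooth_grad h
      smooth_on_bilinear_family[where B = "christoffel G" and X = "\<lambda>_. u"] christoffel_bilinear smooth_christoffel smooth_on_const)

lemma hess_op_grad_null:
  assumes x: "x \<in> S" and h: "smooth_on S h" and null: "\<And>y. y \<in> S \<Longrightarrow> G y (grad G h y) (grad G h y) = 0"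
  shows "hess_op G h x (grad G h x) = 0"
proof (rule lorentzian_nondegenerate[OF lorentzian[OF x]])
  fix w
  note d = smooth_on_has_derivative[OF smooth_grad[OF h] x]
  have "((\<lambda>y. 0) has_derivative (\<lambda>w. G x (hess_op G h x w) (grad G h x) + G x (grad G h x) (hess_op G h x w))) (at x)"
    unfolding hess_op_eq by (rule has_derivative_transform_within_open[OF G_nabla[OF x d d] open_S x]) (rule null)
  from has_derivative_constD[OF this]
  have "G x (hess_op G h x w) (grad G h x) + G x (grad G h x) (hess_op G h x w) = 0" .
  then show "G x (hess_op G h x (grad G h x)) w = 0"
    using hess_op_adjoint[OF x h] G_sym[OF x] by (metis add_cancel_right_right double_zero)
qed

text \<open>This is R(w, u) N = \<nabla>_w (H u) - \<nabla>_u (H w) for constant w and u and N =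
  grad h, where H u = \<nabla>_u N. The second derivatives of N cancel by symmetry.\<close>

lemma ricci_identity_grad:
  assumes x: "x \<in> S" and h: "smooth_on S h"
  shows "riemann x w u (grad G h x) = der (\<lambda>y. hess_op G h y u) x w - der (\<lambda>y. hess_op G h y w) x u
    + christoffel G x w (hess_op G h x u) - christoffel G x u (hess_op G h x w)"
proof -
  note sN = smooth_grad[OF h]
  have d: "der (\<lambda>y. hess_op G h y u) x w = der (\<lambda>y. der (grad G h) y u) x w
     + (der (\<lambda>y. christoffel G y u (grad G h x)) x w + christoffel G x u (der (grad G h) x w))" for u w
  proof -
    have "((\<lambda>y. der (grad G h) y u + christoffel G y u (grad G h y)) has_derivative
      (\<lambda>w. der (\<lambda>y. der (grad G h) y u) x w +
       (der (\<lambda>y. christoffel G y u (grad G h x)) x w + christoffel G x u (der (grad G h) x w)))) (at x)"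
      by (intro has_derivative_add smooth_on_has_derivative[OF smooth_on_frechet_derivative[OF sN] x]
          has_derivative_smooth_linear_family[where L = "\<lambda>y v. christoffel G y u v", OF open_S x]
          smooth_christoffel smooth_on_has_derivative[OF sN x])
         (use christoffel_bilinear in \<open>simp add: bilinear_def\<close>)
    then show ?thesis unfolding hess_op_eq by (simp add: der_eqI)
  qed
  show ?thesis
    unfolding d unfolding hess_op_eq riemann_def second_derivative_symmetric[OF sN open_S x, of u w]
    by (simp add: christoffel_simps[OF x])
qed

text \<open>The Bochner formula for \<open>\<parallel>grad h\<parallel>\<^sup>2 = 0\<close>, obtained by differentiating \<open>hess_op (grad h) = 0\<close>.\<close>

lemma trace_hess_op_square:
  assumes x: "x \<in> S" and h: "smooth_on S h" and null: "\<And>y. y \<in> S \<Longrightarrow> G y (grad G h y) (grad G h y) = 0"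
    and tr: "\<And>y. y \<in> S \<Longrightarrow> trace (matrix (hess_op G h y)) = c"
    and ric: "ricci G x (grad G h x) (grad G h x) = 0"
  shows "trace (matrix (\<lambda>w. hess_op G h x (hess_op G h x w))) = 0"
proof -
  let ?N = "grad G h" and ?H = "hess_op G h"
  \<comment> \<open>The value of N at x, extended with constant components. H u is known to vanish
    only at x itself; its derivative there, \<open>dHu\<close>, comes from differentiating H N = 0
    and compensates for the variation of N.\<close>
  define u where "u = ?N x"
  note sN = smooth_grad[OF h] and lH = hess_op_linear[OF _ h]
  have Hu: "?H x u = 0" unfolding u_def by (rule hess_op_grad_null[OF x h null])
  have dHu: "der (\<lambda>y. ?H y u) x w = - ?H x (der ?N x w)" for w
  proof -
    have "((\<lambda>y. ?H y (?N y)) has_derivative (\<lambda>w. der (\<lambda>y. ?H y u) x w + ?H x (der ?N x w))) (at x)"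
      unfolding u_def
      by (rule has_derivative_smooth_linear_family[OF open_S x lH smooth_hess_op[OF h] smooth_on_has_derivative[OF sN x]])
    then have "((\<lambda>y. 0) has_derivative (\<lambda>w. der (\<lambda>y. ?H y u) x w + ?H x (der ?N x w))) (at x)"
      by (rule has_derivative_transform_within_open[OF _ open_S x]) (rule hess_op_grad_null[OF _ h null])
    from has_derivative_constD[OF this]
    have "der (\<lambda>y. ?H y u) x w + ?H x (der ?N x w) = 0" .
    then show ?thesis by (simp add: eq_neg_iff_add_eq_0)
  qed
  have dN: "der ?N x w = ?H x w - christoffel G x u w" for w
    unfolding hess_op_eq u_def using christoffel_sym[OF x] by simp
  let ?C = "christoffel G x u"
  have lC: "linear ?C" using christoffel_bilinear[OF x] by (simp add: bilinear_def)
  \<comment> \<open>The expression \<open>(?H \<circ> id) x\<close> is simply \<open>?H x\<close>.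
    Under the trace in w the terms with \<open>?H\<close> after \<open>?C\<close> and
    \<open>?C\<close> after \<open>?H\<close> cancel, the term with the derivative of H along u
    gives the derivative of the constant trace, and only the square of H survives.\<close>
  have R: "riemann x w u u = - ?H x (?H x w) + (?H \<circ> id) x (?C w) - der (\<lambda>y. ?H y w) x u - ?C (?H x w)" for w
    using ricci_identity_grad[OF x h, of w u] unfolding u_def[symmetric] Hu dHu dN
    by (simp add: linear_diff[OF lH[OF x]] christoffel_simps[OF x])
  have "((\<lambda>y. \<Sum>k\<in>UNIV. ?H y (axis k 1) $ k) has_derivative (\<lambda>w. \<Sum>k\<in>UNIV. der (\<lambda>y. ?H y (axis k 1)) x w $ k)) (at x)"
    by (intro has_derivative_sum bounded_linear.has_derivative[OF bounded_linear_vec_nth]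
        smooth_on_has_derivative[OF smooth_hess_op[OF h] x])
  then have "((\<lambda>y. c) has_derivative (\<lambda>w. \<Sum>k\<in>UNIV. der (\<lambda>y. ?H y (axis k 1)) x w $ k)) (at x)"
    by (rule has_derivative_transform_within_open[OF _ open_S x]) (simp add: tr flip: trace_matrix)
  from has_derivative_constD[OF this]
  have dtr: "(\<Sum>k\<in>UNIV. der (\<lambda>y. ?H y (axis k 1)) x u $ k) = 0" .
  have "trace (matrix (\<lambda>w. ?H x (?C w))) = trace (matrix (\<lambda>w. ?C (?H x w)))"
    using trace_mul_sym[of "matrix (?H x)" "matrix ?C"] matrix_compose[OF lC lH[OF x]] matrix_compose[OF lH[OF x] lC]
    by (simp add: o_def)
  then have comm: "(\<Sum>k\<in>UNIV. ?H x (?C (axis k 1)) $ k) = (\<Sum>k\<in>UNIV. ?C (?H x (axis k 1)) $ k)"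
    by (simp add: trace_matrix)
  have "0 = (\<Sum>k\<in>UNIV. riemann x (axis k 1) u u $ k)"
    using ric by (simp add: ricci_riemann[OF x] trace_matrix u_def)
  also have "\<dots> = - trace (matrix (\<lambda>w. ?H x (?H x w)))"
    unfolding R trace_matrix using dtr comm by (simp add: sum.distrib sum_subtractf sum_negf)
  finally show ?thesis by simp
qed

end


section \<open>Isometries in coordinates\<close>

text \<open>Transition maps and chart expressions of local isometries are both instances, so one set
  of pullback formulas expresses independence of the chart as well as invariance under isometries.
  Nondegeneracy of the metric makes the derivative of \<phi> invertible.\<close>

locale coordinate_isometry = dom: coordinate_metric G S + cod: coordinate_metric G' S'
  for G :: "'d::finite form_field" and S and G' :: "'d form_field" and S' +
  fixes \<phi> :: "real^'d \<Rightarrow> real^'d" and T :: "(real^'d) set"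
  assumes open_T: "open T" and T_S: "T \<subseteq> S" and \<phi>_S': "\<phi> ` T \<subseteq> S'"
    and smooth_\<phi>: "smooth_on T \<phi>"
    and isometry: "x \<in> T \<Longrightarrow> G' (\<phi> x) (der \<phi> x u) (der \<phi> x v) = G x u v"
begin

lemma in_S: "x \<in> T \<Longrightarrow> x \<in> S" and \<phi>_in: "x \<in> T \<Longrightarrow> \<phi> x \<in> S'"
  using T_S \<phi>_S' by auto

lemmas d\<phi>_linear = smooth_on_linear_frechet_derivative[OF smooth_\<phi>]
lemmas d\<phi>_simps = linear_add[OF d\<phi>_linear] linear_diff[OF d\<phi>_linear] linear_cmul[OF d\<phi>_linear] linear_0[OF d\<phi>_linear]

lemma d\<phi>_inj: "x \<in> T \<Longrightarrow> inj (der \<phi> x)"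
proof (subst linear_injective_0[OF d\<phi>_linear], assumption, intro allI impI)
  fix u assume x: "x \<in> T" and u: "der \<phi> x u = 0"
  show "u = 0"
  proof (rule lorentzian_nondegenerate[OF dom.lorentzian[OF in_S[OF x]]])
    fix w show "G x u w = 0"
      using isometry[OF x, of u w] u cod.G_simps[OF \<phi>_in[OF x]] by simp
  qed
qed

lemma d\<phi>_surj: "x \<in> T \<Longrightarrow> surj (der \<phi> x)"
  using linear_injective_imp_surjective[OF d\<phi>_linear d\<phi>_inj] by blast

lemma G'_eqI:
  assumes x: "x \<in> T" and "\<And>v. G' (\<phi> x) a (der \<phi> x v) = G' (\<phi> x) b (der \<phi> x v)"
  shows "a = b"
proof (rule cod.G_eqI[OF \<phi>_in[OF x]])
  fix w obtain v where "w = der \<phi> x v" using surjD[OF d\<phi>_surj[OF x]] by metis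
  then show "G' (\<phi> x) a w = G' (\<phi> x) b w" using assms(2) by simp
qed

text \<open>The second derivative of \<phi> is the non-tensorial part of the transformation law of
  the Christoffel symbols, and has to cancel from every tensor below.\<close>

definition d2 :: "real^'d \<Rightarrow> real^'d \<Rightarrow> real^'d \<Rightarrow> real^'d" where
  "d2 x u v = der (\<lambda>y. der \<phi> y v) x u"

lemma d2_sym: "x \<in> T \<Longrightarrow> d2 x u v = d2 x v u"
  unfolding d2_def by (rule second_derivative_symmetric[OF smooth_\<phi> open_T])

lemma has_derivative_d\<phi>: "x \<in> T \<Longrightarrow> ((\<lambda>y. der \<phi> y v) has_derivative (\<lambda>w. d2 x w v)) (at x)"
  unfolding d2_def by (rule smooth_on_has_derivative[OF smooth_on_frechet_derivative[OF smooth_\<phi>]])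

lemma smooth_d2: "smooth_on T (\<lambda>y. d2 y u v)"
  unfolding d2_def by (intro smooth_on_frechet_derivative smooth_\<phi>)

lemma d3_sym:
  assumes x: "x \<in> T"
  shows "der (\<lambda>y. d2 y u v) x w = der (\<lambda>y. d2 y w v) x u"
  unfolding d2_def
  by (rule second_derivative_symmetric[OF smooth_on_frechet_derivative[OF smooth_\<phi>] open_T x])

lemma smooth_pullback:
  fixes f :: "real^'d \<Rightarrow> 'b::real_normed_vector"
  assumes "smooth_on S' f"
  shows "smooth_on T (\<lambda>y. f (\<phi> y))"
  by (rule smooth_on_compose[OF open_T cod.open_S \<phi>_S' assms smooth_\<phi>])

lemma der_pullback:
  fixes f :: "real^'d \<Rightarrow> 'b::real_normed_vector"
  assumes x: "x \<in> T" and f: "smooth_on S' f"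
  shows "der (\<lambda>y. f (\<phi> y)) x w = der f (\<phi> x) (der \<phi> x w)"
  using der_eqI[OF has_derivative_compose[OF smooth_on_has_derivative[OF smooth_\<phi> x]
      smooth_on_has_derivative[OF f \<phi>_in[OF x]]]] by simp

lemma dG_pullback:
  assumes x: "x \<in> T"
  shows "der (\<lambda>y. G y u v) x w = der (\<lambda>y. G' y (der \<phi> x u) (der \<phi> x v)) (\<phi> x) (der \<phi> x w)
    + G' (\<phi> x) (d2 x w u) (der \<phi> x v) + G' (\<phi> x) (der \<phi> x u) (d2 x w v)"
proof -
  have "((\<lambda>y. G' (\<phi> y) (der \<phi> y u) (der \<phi> y v)) has_derivative
    (\<lambda>w. der (\<lambda>y. G' (\<phi> y) (der \<phi> x u) (der \<phi> x v)) x w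
      + G' (\<phi> x) (d2 x w u) (der \<phi> x v) + G' (\<phi> x) (der \<phi> x u) (d2 x w v))) (at x)"
    by (rule has_derivative_smooth_bilinear_family[where B = "\<lambda>y. G' (\<phi> y)", OF open_T x _ _
          has_derivative_d\<phi>[OF x] has_derivative_d\<phi>[OF x]])
       (auto intro: cod.G_bilinear \<phi>_in smooth_pullback[OF cod.smooth_G])
  then have "((\<lambda>y. G y u v) has_derivative
    (\<lambda>w. der (\<lambda>y. G' (\<phi> y) (der \<phi> x u) (der \<phi> x v)) x w
      + G' (\<phi> x) (d2 x w u) (der \<phi> x v) + G' (\<phi> x) (der \<phi> x u) (d2 x w v))) (at x)"
    by (rule has_derivative_transform_within_open[OF _ open_T x]) (rule isometry)
  then show ?thesis by (simp add: der_eqI der_pullback[OF x cod.smooth_G])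
qed

text \<open>Apply the Koszul formula on both sides. Differentiating the isometry condition produces
  six terms with \<open>d2\<close>: four cancel, and the other two combine to the inhomogeneous
  term.\<close>

lemma christoffel_pullback:
  assumes x: "x \<in> T"
  shows "der \<phi> x (christoffel G x u v) = christoffel G' (\<phi> x) (der \<phi> x u) (der \<phi> x v) + d2 x u v"
proof (rule G'_eqI[OF x])
  fix w
  let ?J = "der \<phi> x"
  note s = cod.G_sym[OF \<phi>_in[OF x]]
  have "2 * G' (\<phi> x) (?J (christoffel G x u v)) (?J w) = 2 * G x (christoffel G x u v) w"
    using isometry[OF x] by simp
  also have "\<dots> = 2 * G' (\<phi> x) (christoffel G' (\<phi> x) (?J u) (?J v)) (?J w) + 2 * G' (\<phi> x) (d2 x u v) (?J w)"
    unfolding dom.koszul[OF in_S[OF x]] cod.koszul[OF \<phi>_in[OF x]] dG_pullback[OF x]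
    using d2_sym[OF x, of u v] d2_sym[OF x, of u w] d2_sym[OF x, of v w]
      s[of "?J v" "d2 x u w"] s[of "?J u" "d2 x v w"] s[of "?J w" "d2 x u v"]
      s[of "?J v" "d2 x w u"] s[of "?J u" "d2 x w v"] s[of "?J w" "d2 x v u"]
    by simp
  finally show "G' (\<phi> x) (?J (christoffel G x u v)) (?J w)
      = G' (\<phi> x) (christoffel G' (\<phi> x) (?J u) (?J v) + d2 x u v) (?J w)"
    by (simp add: cod.G_simps[OF \<phi>_in[OF x]])
qed

lemma dchristoffel_pullback:
  assumes x: "x \<in> T"
  shows "d2 x w (christoffel G x u v) + der \<phi> x (der (\<lambda>y. christoffel G y u v) x w)
    = der (\<lambda>y. christoffel G' y (der \<phi> x u) (der \<phi> x v)) (\<phi> x) (der \<phi> x w)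
     + christoffel G' (\<phi> x) (d2 x w u) (der \<phi> x v) + christoffel G' (\<phi> x) (der \<phi> x u) (d2 x w v)
     + der (\<lambda>y. d2 y u v) x w"
proof -
  have "((\<lambda>y. der \<phi> y (christoffel G y u v)) has_derivative
    (\<lambda>w. der (\<lambda>y. der \<phi> y (christoffel G x u v)) x w + der \<phi> x (der (\<lambda>y. christoffel G y u v) x w))) (at x)"
    by (rule has_derivative_smooth_linear_family[OF open_T x d\<phi>_linear smooth_on_frechet_derivative[OF smooth_\<phi>]
          smooth_on_has_derivative[OF dom.smooth_christoffel in_S[OF x]]])
  then have 1: "((\<lambda>y. christoffel G' (\<phi> y) (der \<phi> y u) (der \<phi> y v) + d2 y u v) has_derivative
    (\<lambda>w. der (\<lambda>y. der \<phi> y (christoffel G x u v)) x w + der \<phi> x (der (\<lambda>y. christoffel G y u v) x w))) (at x)"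
    by (rule has_derivative_transform_within_open[OF _ open_T x]) (rule christoffel_pullback)
  have "((\<lambda>y. christoffel G' (\<phi> y) (der \<phi> y u) (der \<phi> y v)) has_derivative
    (\<lambda>w. der (\<lambda>y. christoffel G' (\<phi> y) (der \<phi> x u) (der \<phi> x v)) x w
      + christoffel G' (\<phi> x) (d2 x w u) (der \<phi> x v) + christoffel G' (\<phi> x) (der \<phi> x u) (d2 x w v))) (at x)"
    by (rule has_derivative_smooth_bilinear_family[where B = "\<lambda>y. christoffel G' (\<phi> y)", OF open_T x _ _
          has_derivative_d\<phi>[OF x] has_derivative_d\<phi>[OF x]])
       (auto intro: cod.christoffel_bilinear \<phi>_in smooth_pullback[OF cod.smooth_christoffel])
  from has_derivative_unique[OF 1 has_derivative_add[OF this smooth_on_has_derivative[OF smooth_d2 x]], THEN fun_cong, of w]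
  show ?thesis by (simp add: der_pullback[OF x cod.smooth_christoffel] d2_def)
qed

text \<open>The differentiated Christoffel law contains third derivatives of \<phi>, which cancel by
  their symmetry in w and u. The remaining terms with \<open>d2\<close> cancel against those that
  the law produces in the quadratic Christoffel terms.\<close>

lemma riemann_pullback:
  assumes x: "x \<in> T"
  shows "der \<phi> x (dom.riemann x w u v) = cod.riemann (\<phi> x) (der \<phi> x w) (der \<phi> x u) (der \<phi> x v)"
proof -
  have 1: "der \<phi> x (der (\<lambda>y. christoffel G y u v) x w)
    = der (\<lambda>y. christoffel G' y (der \<phi> x u) (der \<phi> x v)) (\<phi> x) (der \<phi> x w)
     + christoffel G' (\<phi> x) (d2 x w u) (der \<phi> x v) + christoffel G' (\<phi> x) (der \<phi> x u) (d2 x w v)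
     + der (\<lambda>y. d2 y u v) x w - d2 x w (christoffel G x u v)" for u w
    using dchristoffel_pullback[OF x, of w u v] by (simp add: algebra_simps)
  show ?thesis
    unfolding dom.riemann_def cod.riemann_def d\<phi>_simps[OF x] 1 christoffel_pullback[OF x]
      cod.christoffel_simps[OF \<phi>_in[OF x]] d2_sym[OF x, of u w] d3_sym[OF x, of u v w]
    by (simp add: algebra_simps)
qed

lemma ricci_pullback:
  assumes x: "x \<in> T"
  shows "ricci G' (\<phi> x) (der \<phi> x u) (der \<phi> x v) = ricci G x u v"
  unfolding dom.ricci_riemann[OF in_S[OF x]] cod.ricci_riemann[OF \<phi>_in[OF x]]
proof (rule trace_conjugate[where L = "der \<phi> x"])
  show "linear (\<lambda>w. dom.riemann x w u v)" by (rule dom.riemann_linear(1)[OF in_S[OF x]])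
  show "linear (\<lambda>w. cod.riemann (\<phi> x) w (der \<phi> x u) (der \<phi> x v))" by (rule cod.riemann_linear(1)[OF \<phi>_in[OF x]])
qed (simp_all add: d\<phi>_linear d\<phi>_inj riemann_pullback x)

lemma ricci_op_pullback:
  assumes x: "x \<in> T"
  shows "ricci_op G' (\<phi> x) (der \<phi> x u) = der \<phi> x (ricci_op G x u)"
  by (rule G'_eqI[OF x])
     (simp add: cod.G_ricci_op[OF \<phi>_in[OF x]] isometry[OF x] dom.G_ricci_op[OF in_S[OF x]] ricci_pullback[OF x])

lemma grad_pullback:
  assumes x: "x \<in> T" and h: "smooth_on S' h"
  shows "der \<phi> x (grad G (\<lambda>y. h (\<phi> y)) x) = grad G' h (\<phi> x)"
  by (rule G'_eqI[OF x])
     (simp add: isometry[OF x] dom.G_grad[OF in_S[OF x] smooth_pullback[OF h] x] der_pullback[OF x h]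
       cod.G_grad[OF \<phi>_in[OF x] h \<phi>_in[OF x]])

text \<open>The chain rule adds dh applied to \<open>d2\<close> to the second derivative of h
  \<circ> \<phi>, and this is exactly what the inhomogeneous term of the Christoffel law
  removes.\<close>

lemma hess_pullback:
  assumes x: "x \<in> T" and h: "smooth_on S' h"
  shows "hess G (\<lambda>y. h (\<phi> y)) (\<lambda>_. u) (\<lambda>_. v) x = hess G' h (\<lambda>_. der \<phi> x u) (\<lambda>_. der \<phi> x v) (\<phi> x)"
proof -
  note lin = smooth_on_linear_frechet_derivative[OF h \<phi>_in[OF x]]
  have "((\<lambda>y. der h (\<phi> y) (der \<phi> y v)) has_derivative
    (\<lambda>w. der (\<lambda>y. der h (\<phi> y) (der \<phi> x v)) x w + der h (\<phi> x) (d2 x w v))) (at x)"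
    by (rule has_derivative_smooth_linear_family[where L = "\<lambda>y. der h (\<phi> y)", OF open_T x _ _ has_derivative_d\<phi>[OF x]])
       (auto intro: smooth_on_linear_frechet_derivative[OF h] \<phi>_in smooth_pullback[OF smooth_on_frechet_derivative[OF h]])
  then have "((\<lambda>y. der (\<lambda>y. h (\<phi> y)) y v) has_derivative
    (\<lambda>w. der (\<lambda>y. der h (\<phi> y) (der \<phi> x v)) x w + der h (\<phi> x) (d2 x w v))) (at x)"
    by (rule has_derivative_transform_within_open[OF _ open_T x]) (simp add: der_pullback[OF _ h])
  then show ?thesis
    unfolding dom.hess_const cod.hess_const
    by (simp add: der_eqI der_pullback[OF x smooth_on_frechet_derivative[OF h]] der_pullback[OF x h]
        christoffel_pullback[OF x] linear_add[OF lin])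
qed

end


section \<open>Straightening level sets\<close>

text \<open>Bootstrapping: the derivative of \<open>g\<close> is \<open>F\<close> evaluated along
  \<open>g\<close>, so it is as regular as \<open>g\<close> itself, and \<open>g\<close> gains one
  order at each step.\<close>

lemma smooth_on_inverse_function:
  fixes g :: "'a::real_normed_vector \<Rightarrow> 'b::euclidean_space" and F :: "'b \<Rightarrow> 'a \<Rightarrow> 'b"
  assumes "open U" "open V" "g ` V \<subseteq> U" "\<And>z. z \<in> V \<Longrightarrow> (g has_derivative F (g z)) (at z)"
    and "\<And>w. smooth_on U (\<lambda>x. F x w)"
  shows "smooth_on V g"
  unfolding smooth_on_def
proof
  fix k show "Ck_on k V g"
  proof (induction k)
    case 0
    have "continuous_on V g"
      using assms(4) has_derivative_continuous continuous_at_imp_continuous_on by blast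
    then show ?case by simp
  next
    case (Suc k)
    show ?case
      by (rule Ck_on_SucI[OF assms(2,4)])
         (use assms(5) in \<open>auto simp: smooth_on_def intro: Ck_on_compose[OF assms(2,1,3) _ Suc]\<close>)
  qed
qed

lemma linear_ne_0_axis:
  fixes L :: "real^'d \<Rightarrow> real"
  assumes "linear L" "L \<noteq> (\<lambda>_. 0)"
  shows "\<exists>i. L (axis i 1) \<noteq> 0"
proof (rule ccontr)
  assume "\<nexists>i. L (axis i 1) \<noteq> 0"
  then have "L v = 0" for v by (subst linear_basis_expansion[OF assms(1)]) simp
  then show False using assms(2) by blast
qed

text \<open>A submanifold chart from the inverse function theorem. Connectedness of the piece of the
  level set is part of the claim because leaves will be compared with connected components.\<close>

lemma level_set_straightening:
  fixes h :: "real^'d::finite \<Rightarrow> real"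
  assumes S: "open S" "x \<in> S" and h: "smooth_on S h" and dh: "der h x \<noteq> (\<lambda>_. 0)"
  obtains S' \<Psi> E where "open S'" "x \<in> S'" "S' \<subseteq> S" "inj_on \<Psi> S'" "open (\<Psi> ` S')"
    "smooth_on S' \<Psi>" "smooth_on (\<Psi> ` S') (inv_into S' \<Psi>)" "subspace (E :: (real^'d) set)"
    "\<Psi> ` (S' \<inter> {y. h y = h x}) = \<Psi> ` S' \<inter> E" "connected (S' \<inter> {y. h y = h x})"
    "\<And>y. y \<in> S' \<Longrightarrow> {v. der h y v = 0} = {v. der \<Psi> y v \<in> E}"
proof -
  obtain i where i: "der h x (axis i 1) \<noteq> 0"
    using linear_ne_0_axis[OF smooth_on_linear_frechet_derivative[OF h S(2)] dh] by blast
  let ?e = "axis i 1 :: real^'d"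
  \<comment> \<open>This map replaces coordinate i of y by h y - h x, so the level set becomes the
    hyperplane where that coordinate is 0. \<open>D y\<close> is its derivative, and
    \<open>F y\<close> inverts \<open>D y\<close> wherever the i-th partial derivative of h is
    nonzero.\<close>
  define \<Psi> where "\<Psi> y = y + (h y - h x - y $ i) *\<^sub>R ?e" for y
  define D where "D y v = v + (der h y v - v $ i) *\<^sub>R ?e" for y v
  define F where "F y w = w + ((w $ i - der h y w) / der h y ?e) *\<^sub>R ?e" for y w
  define U where "U = {y \<in> S. der h y ?e \<noteq> 0}"
  have sdh: "smooth_on S (\<lambda>y. der h y v)" for v by (rule smooth_on_frechet_derivative[OF h])
  have U: "open U" "x \<in> U" "U \<subseteq> S"
  proof -
    have "open ((\<lambda>y. der h y ?e) -` (- {0}) \<inter> S)"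
      by (rule continuous_on_open_vimage[THEN iffD1, rule_format, OF S(1) smooth_on_imp_continuous_on[OF sdh]])
         (rule open_Compl[OF closed_singleton])
    moreover have "(\<lambda>y. der h y ?e) -` (- {0}) \<inter> S = U" by (auto simp: U_def)
    ultimately show "open U" by simp
  qed (use S i in \<open>auto simp: U_def\<close>)
  have s\<Psi>: "smooth_on S \<Psi>"
    unfolding \<Psi>_def[abs_def]
    by (intro smooth_on_add smooth_on_scaleR smooth_on_diff smooth_on_ident smooth_on_const h S(1)
        smooth_on_bounded_linear bounded_linear_vec_nth)
  have d\<Psi>: "(\<Psi> has_derivative D y) (at y)" if "y \<in> S" for y
    unfolding \<Psi>_def[abs_def] D_def[abs_def]
    by (rule derivative_eq_intros smooth_on_has_derivative[OF h that]
        bounded_linear_imp_has_derivative[OF bounded_linear_vec_nth] refl | simp)+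
  have lin: "linear (der h y)" if "y \<in> S" for y
    by (rule smooth_on_linear_frechet_derivative[OF h that])
  have blD: "bounded_linear (D y)" if "y \<in> S" for y using d\<Psi>[OF that] has_derivative_bounded_linear by blast
  have FD: "F y (D y v) = v" and DF: "D y (F y v) = v" if "y \<in> U" for y v
    using that by (auto simp: F_def D_def U_def linear_add[OF lin] linear_diff[OF lin] linear_cmul[OF lin] field_simps simp flip: scaleR_add_left)
  have blF: "bounded_linear (F y)" if "y \<in> U" for y
  proof -
    have "linear (F y)"
      unfolding F_def using that U(3)
      by (intro linearI)
         (auto simp: linear_add[OF lin] linear_cmul[OF lin] algebra_simps diff_divide_distrib add_divide_distrib subset_iff)
    then show ?thesis by (simp add: linear_conv_bounded_linear)
  qed
  have contD: "continuous_on U (\<lambda>y. Blinfun (D y))"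
  proof (rule continuous_on_blinfun_componentwise)
    fix b
    have "continuous_on U (\<lambda>y. D y b)"
      unfolding D_def using continuous_on_subset[OF smooth_on_imp_continuous_on[OF sdh] U(3)]
      by (intro continuous_intros)
    then show "continuous_on U (\<lambda>y. blinfun_apply (Blinfun (D y)) b)"
      by (subst continuous_on_cong[OF refl, of _ _ "\<lambda>y. D y b"])
         (use U(3) blD in \<open>auto simp: bounded_linear_Blinfun_apply\<close>)
  qed
  have inv: "Blinfun (F x) o\<^sub>L Blinfun (D x) = id_blinfun"
    by (rule blinfun_eqI)
       (use U blD blF FD in \<open>auto simp: bounded_linear_Blinfun_apply\<close>)
  obtain U' V g g' where U': "open U'" "U' \<subseteq> U" "x \<in> U'" and V: "open V" "\<Psi> x \<in> V"
    and hom: "homeomorphism U' V \<Psi> g" and g: "\<And>z. z \<in> V \<Longrightarrow> (g has_derivative g' z) (at z)"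
    "\<And>z. z \<in> V \<Longrightarrow> g' z = inv (blinfun_apply (Blinfun (D (g z))))"
  proof (rule inverse_function_theorem[OF U(1) _ contD U(2) inv])
    show "(\<Psi> has_derivative blinfun_apply (Blinfun (D y))) (at y)" if "y \<in> U" for y
      using d\<Psi>[of y] blD[of y] U(3) that by (auto simp: bounded_linear_Blinfun_apply)
  qed (rule that)
  have gV: "g z \<in> U'" "g z \<in> U" "g z \<in> S" "\<Psi> (g z) = z" if "z \<in> V" for z
    using hom that U'(2) U(3) by (auto simp: homeomorphism_def)
  have g\<Psi>: "g (\<Psi> y) = y" "\<Psi> y \<in> V" if "y \<in> U'" for y
    using hom that by (auto simp: homeomorphism_def)
  have dg: "(g has_derivative F (g z)) (at z)" if "z \<in> V" for z
  proof -
    have "inv (D (g z)) = F (g z)"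
      by (rule inv_equality) (use FD DF gV[OF that] in auto)
    then show ?thesis using g[OF that] blD[OF gV(3)[OF that]] by (simp add: bounded_linear_Blinfun_apply)
  qed
  have sg: "smooth_on V g"
  proof (rule smooth_on_inverse_function[OF U(1) V(1) _ dg])
    show "smooth_on U (\<lambda>y. F y w)" for w
      unfolding F_def
      by (intro smooth_on_add smooth_on_scaleR smooth_on_divide smooth_on_diff smooth_on_const U(1)
          smooth_on_subset[OF sdh U(3)]) (auto simp: U_def)
  qed (use gV in auto)
  obtain r where r: "r > 0" "ball (\<Psi> x) r \<subseteq> V" using V openE by blast
  \<comment> \<open>Only the part over a ball is kept: the ball meets \<open>E\<close> in a convex
    set, whose image under the continuous \<open>g\<close> is connected.\<close>
  define S' where "S' = g ` ball (\<Psi> x) r"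
  have \<Psi>S': "\<Psi> ` S' = ball (\<Psi> x) r"
    unfolding S'_def image_image using gV(4) r(2) by (force simp: image_iff)
  have S'U': "S' \<subseteq> U'" unfolding S'_def using gV r by auto
  have S'_eq: "S' = \<Psi> -` ball (\<Psi> x) r \<inter> U'"
    unfolding S'_def using gV g\<Psi> r(2) by (force simp: image_iff)
  have "open S'"
    unfolding S'_eq using U' U(3) s\<Psi>
    by (intro continuous_on_open_vimage[THEN iffD1, rule_format] continuous_on_subset[OF smooth_on_imp_continuous_on[OF s\<Psi>]]) auto
  have inj: "inj_on \<Psi> S'" using g\<Psi>(1) S'U' by (metis inj_on_inverseI subsetD)
  have inv_eq: "inv_into S' \<Psi> z = g z" if "z \<in> ball (\<Psi> x) r" for z
    using that gV(4) r(2) by (intro inv_into_f_eq[OF inj]) (auto simp: S'_def)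
  define E where "E = {z :: real^'d. z $ i = 0}"
  have \<Psi>i: "\<Psi> y $ i = h y - h x" for y by (simp add: \<Psi>_def)
  have img: "\<Psi> ` (S' \<inter> {y. h y = h x}) = \<Psi> ` S' \<inter> E"
    by (auto simp: E_def \<Psi>i)
  have "convex E" unfolding E_def by (auto simp: convex_def)
  then have conv: "convex (ball (\<Psi> x) r \<inter> E)" by (intro convex_Int convex_ball)
  have "S' \<inter> {y. h y = h x} = g ` (ball (\<Psi> x) r \<inter> E)"
  proof
    show "S' \<inter> {y. h y = h x} \<subseteq> g ` (ball (\<Psi> x) r \<inter> E)"
    proof
      fix y assume y: "y \<in> S' \<inter> {y. h y = h x}"
      then have "\<Psi> y \<in> ball (\<Psi> x) r \<inter> E" using \<Psi>S' by (auto simp: E_def \<Psi>i)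
      moreover have "g (\<Psi> y) = y" using y S'U' g\<Psi> by blast
      ultimately show "y \<in> g ` (ball (\<Psi> x) r \<inter> E)" by (metis imageI)
    qed
    show "g ` (ball (\<Psi> x) r \<inter> E) \<subseteq> S' \<inter> {y. h y = h x}"
    proof
      fix y assume "y \<in> g ` (ball (\<Psi> x) r \<inter> E)"
      then obtain z where z: "z \<in> ball (\<Psi> x) r" "z $ i = 0" "y = g z" by (auto simp: E_def)
      then have "\<Psi> y = z" using gV(4) r(2) by blast
      then have "h y = h x" using \<Psi>i[of y] z(2) by simp
      then show "y \<in> S' \<inter> {y. h y = h x}" using z by (auto simp: S'_def)
    qed
  qed
  then have conn: "connected (S' \<inter> {y. h y = h x})"
    using connected_continuous_image[OF continuous_on_subset[OF smooth_on_imp_continuous_on[OF sg]] convex_connected[OF conv]] r(2)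
    by auto
  show ?thesis
  proof (rule that[of S' \<Psi> E])
    show "x \<in> S'" unfolding S'_eq using U' r by simp
    show "smooth_on (\<Psi> ` S') (inv_into S' \<Psi>)"
      unfolding \<Psi>S' by (subst smooth_on_cong[OF open_ball inv_eq]) (auto intro: smooth_on_subset[OF sg r(2)])
    show "{v. der h y v = 0} = {v. der \<Psi> y v \<in> E}" if "y \<in> S'" for y
      using d\<Psi>[of y] that S'U' U'(2) U(3) der_eqI[of \<Psi> "D y" y] by (auto simp: E_def D_def subset_iff)
    show "subspace E" by (auto simp: E_def subspace_def)
    show "S' \<subseteq> S" using S'U' U'(2) U(3) by blast
    then show "smooth_on S' \<Psi>" by (rule smooth_on_subset[OF s\<Psi>])
  qed (use \<open>open S'\<close> inj img conn \<Psi>S' in auto)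
qed

text \<open>In the straightened chart, x and a nearby point of K are joined by a segment in E. Its
  preimage is a curve in K whose velocity is mapped into E by the derivative of \<Psi>, so h has
  zero derivative along it.\<close>

lemma locally_constant_on_integral_manifold:
  fixes h :: "real^'d::finite \<Rightarrow> real" and \<Psi> :: "real^'d \<Rightarrow> real^'d"
  assumes S: "open S" and inj: "inj_on \<Psi> S" and o: "open (\<Psi> ` S)" and s\<Psi>: "smooth_on S \<Psi>"
    and si: "smooth_on (\<Psi> ` S) (inv_into S \<Psi>)" and E: "subspace E" and K: "K \<subseteq> S" "\<Psi> ` K = \<Psi> ` S \<inter> E"
    and dh: "\<And>y v. y \<in> K \<Longrightarrow> der \<Psi> y v \<in> E \<Longrightarrow> der h y v = 0" and h: "smooth_on S h" and x: "x \<in> K"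
  shows "\<exists>S'. open S' \<and> x \<in> S' \<and> S' \<subseteq> S \<and> (\<forall>y\<in>S' \<inter> K. h y = h x)"
proof -
  have xS: "x \<in> S" using x K by blast
  obtain r where r: "r > 0" "ball (\<Psi> x) r \<subseteq> \<Psi> ` S" using o xS openE by blast
  let ?g = "inv_into S \<Psi>"
  have g: "?g z \<in> S" "\<Psi> (?g z) = z" if "z \<in> \<Psi> ` S" for z
    using that by (auto simp: inv_into_into f_inv_into_f)
  have gK: "?g z \<in> K" if "z \<in> \<Psi> ` S \<inter> E" for z
  proof -
    have "z \<in> \<Psi> ` K" using that K(2) by simp
    then obtain y where y: "y \<in> K" "z = \<Psi> y" by blast
    then have "?g z = y" using inv_into_f_f[OF inj, of y] K(1) by auto
    then show ?thesis using y by simp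
  qed
  have const: "h y = h x" if y: "y \<in> K" "\<Psi> y \<in> ball (\<Psi> x) r" for y
  proof -
    define z where "z s = \<Psi> x + s *\<^sub>R (\<Psi> y - \<Psi> x)" for s :: real
    have "\<Psi> x \<in> E" "\<Psi> y \<in> E" using K(2) x y by auto
    then have dE: "\<Psi> y - \<Psi> x \<in> E" and zE: "z s \<in> E" for s
      using E by (auto simp: z_def intro: subspace_diff subspace_add subspace_mul)
    have zb: "z s \<in> ball (\<Psi> x) r" if "0 \<le> s" "s \<le> 1" for s
    proof -
      have "dist (\<Psi> x) (z s) = \<bar>s\<bar> * norm (\<Psi> y - \<Psi> x)" by (simp add: z_def dist_norm)
      also have "\<dots> \<le> 1 * norm (\<Psi> y - \<Psi> x)" using that by (intro mult_right_mono) auto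
      also have "\<dots> < r" using y by (simp add: dist_norm norm_minus_commute)
      finally show ?thesis by simp
    qed
    have D: "((\<lambda>s. h (?g (z s))) has_real_derivative 0) (at s)" if "0 \<le> s" "s \<le> 1" for s
    proof -
      have zs: "z s \<in> \<Psi> ` S" using zb[OF that] r by blast
      have dg: "(?g has_derivative der ?g (z s)) (at (z s))" by (rule smooth_on_has_derivative[OF si zs])
      have "((\<lambda>u. \<Psi> (?g u)) has_derivative (\<lambda>w. der \<Psi> (?g (z s)) (der ?g (z s) w))) (at (z s))"
        by (rule has_derivative_compose[OF dg smooth_on_has_derivative[OF s\<Psi> g(1)[OF zs]]])
      then have "((\<lambda>u. u) has_derivative (\<lambda>w. der \<Psi> (?g (z s)) (der ?g (z s) w))) (at (z s))"
        by (rule has_derivative_transform_within_open[OF _ o zs]) (rule g(2))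
      from fun_cong[OF has_derivative_unique[OF this has_derivative_ident]]
      have "der \<Psi> (?g (z s)) (der ?g (z s) w) = w" for w .
      then have "der \<Psi> (?g (z s)) (der ?g (z s) (\<Psi> y - \<Psi> x)) \<in> E" using dE by metis
      then have 0: "der h (?g (z s)) (der ?g (z s) (\<Psi> y - \<Psi> x)) = 0"
        by (rule dh[rotated]) (rule gK[OF IntI[OF zs zE]])
      have "(z has_derivative (\<lambda>t. t *\<^sub>R (\<Psi> y - \<Psi> x))) (at s)"
        unfolding z_def by (auto intro!: derivative_eq_intros)
      from has_derivative_compose[OF has_derivative_compose[OF this dg] smooth_on_has_derivative[OF h g(1)[OF zs]]]
      have "((\<lambda>s. h (?g (z s))) has_derivative (\<lambda>t. der h (?g (z s)) (der ?g (z s) (t *\<^sub>R (\<Psi> y - \<Psi> x))))) (at s)" .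
      moreover have "der h (?g (z s)) (der ?g (z s) (t *\<^sub>R (\<Psi> y - \<Psi> x))) = 0 * t" for t
        using 0 linear_cmul[OF smooth_on_linear_frechet_derivative[OF si zs]]
          linear_cmul[OF smooth_on_linear_frechet_derivative[OF h g(1)[OF zs]]] by simp
      ultimately have "((\<lambda>s. h (?g (z s))) has_derivative (\<lambda>t. 0 * t)) (at s)" by (simp only:)
      then show ?thesis by (simp only: has_field_derivative_def)
    qed
    have "h (?g (z 1)) = h (?g (z 0))"
      using MVT2[where a = "0::real" and b = 1 and f = "\<lambda>s. h (?g (z s))" and f' = "\<lambda>_. 0"] D by auto
    moreover have "?g (z 1) = y" "?g (z 0) = x" using inj y K(1) x by (auto simp: z_def inv_into_f_f subset_iff)
    ultimately show ?thesis by simp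
  qed
  show ?thesis
  proof (intro exI[of _ "\<Psi> -` ball (\<Psi> x) r \<inter> S"] conjI)
    show "open (\<Psi> -` ball (\<Psi> x) r \<inter> S)"
      using S smooth_on_imp_continuous_on[OF s\<Psi>] by (simp add: continuous_on_open_vimage)
  qed (use xS r const in auto)
qed


section \<open>Lorentzian manifolds\<close>

lemma coordinate_metric_subset:
  "coordinate_metric G S \<Longrightarrow> open S' \<Longrightarrow> S' \<subseteq> S \<Longrightarrow> coordinate_metric G S'"
  unfolding coordinate_metric_def using smooth_on_subset by blast

lemma nabla_cong_open:
  assumes "open S" "x \<in> S" "\<And>y. y \<in> S \<Longrightarrow> Y y = Y' y"
  shows "nabla G X Y x = nabla G X Y' x"
  using frechet_derivative_cong_open[OF assms] assms(2,3) by (simp add: nabla_def dir_deriv_def)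

lemma grad_cong_open:
  assumes "open S" "x \<in> S" "\<And>y. y \<in> S \<Longrightarrow> h y = h' y"
  shows "grad G h x = grad G h' x"
  using frechet_derivative_cong_open[OF assms] by (simp add: grad_def)

locale lorentzian_mfd =
  fixes A :: "('m::{t2_space, second_countable_topology}, 'd::finite) chart set"
    and g :: "('m, 'd) metric"
  assumes lorentzian_manifold: "lorentzian_manifold A g"
begin

lemma chart:
  assumes "c \<in> A"
  shows "open (fst c)" "open (coords c UNIV)" "homeomorphism (fst c) (coords c UNIV) (snd c) (chart_inv c)"
  using assms lorentzian_manifold by (auto simp: lorentzian_manifold_def smooth_atlas_def)

lemma chart_inv_snd [simp]: "c \<in> A \<Longrightarrow> p \<in> fst c \<Longrightarrow> chart_inv c (snd c p) = p"
  using chart(3) by (simp add: homeomorphism_def)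

lemma snd_chart_inv [simp]: "c \<in> A \<Longrightarrow> x \<in> coords c UNIV \<Longrightarrow> snd c (chart_inv c x) = x"
  using chart(3) by (simp add: homeomorphism_def)

lemma chart_inv_in: "c \<in> A \<Longrightarrow> x \<in> coords c UNIV \<Longrightarrow> chart_inv c x \<in> fst c"
  using homeomorphism_image2[OF chart(3)] by blast

lemma snd_in: "p \<in> fst c \<Longrightarrow> p \<in> W \<Longrightarrow> snd c p \<in> coords c W"
  by (auto simp: coords_def)

lemma coords_subset: "coords c W \<subseteq> coords c UNIV"
  by (auto simp: coords_def)

lemma coords_iff: "c \<in> A \<Longrightarrow> x \<in> coords c W \<longleftrightarrow> x \<in> coords c UNIV \<and> chart_inv c x \<in> W"
proof
  assume c: "c \<in> A" and "x \<in> coords c W"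
  then obtain p where "p \<in> fst c" "p \<in> W" "x = snd c p" by (auto simp: coords_def)
  then show "x \<in> coords c UNIV \<and> chart_inv c x \<in> W" using c by (auto simp: snd_in)
next
  assume c: "c \<in> A" and x: "x \<in> coords c UNIV \<and> chart_inv c x \<in> W"
  then have "snd c (chart_inv c x) \<in> coords c W" by (intro snd_in chart_inv_in) auto
  then show "x \<in> coords c W" using c x by simp
qed

lemma coordsD: "c \<in> A \<Longrightarrow> x \<in> coords c W \<Longrightarrow> x \<in> coords c UNIV"
    "c \<in> A \<Longrightarrow> x \<in> coords c W \<Longrightarrow> chart_inv c x \<in> W"
  using coords_iff by blast+

lemma open_coords:
  assumes "c \<in> A" "open W"
  shows "open (coords c W)"
proof -
  have "openin (top_of_set (coords c UNIV)) (snd c ` (fst c \<inter> W))"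
    by (rule homeomorphism_imp_open_map[OF chart(3)[OF assms(1)]]) (use assms in \<open>auto simp: openin_open\<close>)
  then show ?thesis using chart(2)[OF assms(1)] by (simp add: coords_def openin_open_eq)
qed

lemma open_chart_inv_image:
  assumes c: "c \<in> A" and S: "open S" "S \<subseteq> coords c UNIV"
  shows "open (chart_inv c ` S)"
proof -
  have "openin (top_of_set (fst c)) (chart_inv c ` S)"
    by (rule homeomorphism_imp_open_map[OF homeomorphism_sym[THEN iffD1, OF chart(3)[OF c]]]) (use S in \<open>auto simp: openin_open\<close>)
  then show ?thesis using chart(1)[OF c] by (simp add: openin_open_eq)
qed

lemma continuous_chart_inv: "c \<in> A \<Longrightarrow> S \<subseteq> coords c UNIV \<Longrightarrow> continuous_on S (chart_inv c)"
  by (rule continuous_on_subset[OF homeomorphism_cont2[OF chart(3)]])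

lemma coords_carrier: "c \<in> A \<Longrightarrow> coords c (carrier A) = coords c UNIV"
  by (auto simp: coords_def carrier_def)

lemma chart_inv_carrier: "c \<in> A \<Longrightarrow> x \<in> coords c UNIV \<Longrightarrow> chart_inv c x \<in> carrier A"
  using chart_inv_in by (fastforce simp: carrier_def)

lemma open_carrier: "open (carrier A)"
  using chart(1) by (auto simp: carrier_def)

lemma transition_coords:
  assumes "c \<in> A" "c' \<in> A" "x \<in> coords c (fst c' \<inter> W)"
  shows "transition c c' x \<in> coords c' W" "chart_inv c' (transition c c' x) = chart_inv c x"
  using coordsD[OF assms(1,3)] assms(2) by (auto simp: transition_def intro: snd_in)

lemma local_rep_transition:
  "c \<in> A \<Longrightarrow> c' \<in> A \<Longrightarrow> x \<in> coords c (fst c' \<inter> W) \<Longrightarrow> local_rep h c' (transition c c' x) = local_rep h c x"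
  by (simp add: local_rep_def transition_coords)

lemma coordinate_metric: "c \<in> A \<Longrightarrow> coordinate_metric (g c) (coords c UNIV)"
  using lorentzian_manifold chart(2)
  by (auto simp: lorentzian_manifold_def lorentzian_metric_def coordinate_metric_def)

lemma coordinate_metric_on: "c \<in> A \<Longrightarrow> open W \<Longrightarrow> coordinate_metric (g c) (coords c W)"
  using coordinate_metric_subset[OF coordinate_metric open_coords coords_subset] .

text \<open>Turns the pullback lemmas into the transformation laws of gradients and of H under a
  change of chart.\<close>

lemma transition_isometry:
  assumes c: "c \<in> A" "c' \<in> A" and W: "open W"
  shows "coordinate_isometry (g c) (coords c W) (g c') (coords c' W) (transition c c') (coords c (fst c' \<inter> W))"
proof -
  interpret dom: coordinate_metric "g c" "coords c W" by (rule coordinate_metric_on[OF c(1) W])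
  interpret cod: coordinate_metric "g c'" "coords c' W" by (rule coordinate_metric_on[OF c(2) W])
  have sub: "coords c (fst c' \<inter> W) \<subseteq> coords c (fst c')" by (auto simp: coords_def)
  show ?thesis
  proof
    show "open (coords c (fst c' \<inter> W))" by (intro open_coords c open_Int chart(1) W)
    show "coords c (fst c' \<inter> W) \<subseteq> coords c W" by (auto simp: coords_def)
    show "transition c c' ` coords c (fst c' \<inter> W) \<subseteq> coords c' W" using transition_coords[OF c] by auto
    show "smooth_on (coords c (fst c' \<inter> W)) (transition c c')"
      using lorentzian_manifold c smooth_on_subset[OF _ sub] by (auto simp: lorentzian_manifold_def smooth_atlas_def)
    show "g c' (transition c c' x) (der (transition c c') x u) (der (transition c c') x v) = g c x u v"
      if "x \<in> coords c (fst c' \<inter> W)" for x u v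
      using lorentzian_manifold c that sub by (auto simp: lorentzian_manifold_def lorentzian_metric_def)
  qed
qed

text \<open>The domain consists of the points that \<phi> sends into the target chart; in general W
  is covered only by letting \<open>c'\<close> vary.\<close>

lemma local_isometry_coordinates:
  assumes c: "c \<in> A" "c' \<in> A" and iso: "local_isometry A g W W' \<phi>"
  shows "coordinate_isometry (g c) (coords c UNIV) (g c') (coords c' UNIV) (snd c' \<circ> \<phi> \<circ> chart_inv c)
    (coords c (W \<inter> \<phi> -` fst c'))"
proof -
  interpret dom: coordinate_metric "g c" "coords c UNIV" by (rule coordinate_metric[OF c(1)])
  interpret cod: coordinate_metric "g c'" "coords c' UNIV" by (rule coordinate_metric[OF c(2)])
  have W: "open W" "continuous_on W \<phi>" using iso by (auto simp: local_isometry_def homeomorphism_def)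
  show ?thesis
  proof
    have "open (W \<inter> \<phi> -` fst c')"
      using continuous_on_open_vimage[OF W(1)] W(2) chart(1)[OF c(2)] by (metis Int_commute)
    then show "open (coords c (W \<inter> \<phi> -` fst c'))" by (rule open_coords[OF c(1)])
    show "coords c (W \<inter> \<phi> -` fst c') \<subseteq> coords c UNIV" by (rule coords_subset)
    show "(snd c' \<circ> \<phi> \<circ> chart_inv c) ` coords c (W \<inter> \<phi> -` fst c') \<subseteq> coords c' UNIV"
      using coordsD(2)[OF c(1)] by (auto intro: snd_in)
    show "smooth_on (coords c (W \<inter> \<phi> -` fst c')) (snd c' \<circ> \<phi> \<circ> chart_inv c)"
      using iso c by (auto simp: local_isometry_def smooth_map_def)
    show "g c' ((snd c' \<circ> \<phi> \<circ> chart_inv c) x) (der (snd c' \<circ> \<phi> \<circ> chart_inv c) x u)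
        (der (snd c' \<circ> \<phi> \<circ> chart_inv c) x v) = g c x u v"
      if "x \<in> coords c (W \<inter> \<phi> -` fst c')" for x u v
      using iso c that unfolding local_isometry_def Let_def by blast
  qed
qed

section \<open>Functions and vector fields on the manifold\<close>

lemma smooth_fun_local_rep: "smooth_fun A W h \<Longrightarrow> c \<in> A \<Longrightarrow> smooth_on (coords c W) (local_rep h c)"
  by (simp add: smooth_fun_def)

lemma coords_mono: "W' \<subseteq> W \<Longrightarrow> coords c W' \<subseteq> coords c W"
  by (auto simp: coords_def)

lemma vector_field_gradient:
  assumes W: "open W" and h: "smooth_fun A W h"
  shows "vector_field A W (gradient g h)"
  unfolding vector_field_def
proof (intro conjI ballI)
  fix c assume c: "c \<in> A"
  show "smooth_on (coords c W) (gradient g h c)"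
    unfolding gradient_def
    by (rule coordinate_metric.smooth_grad[OF coordinate_metric_on[OF c W] smooth_fun_local_rep[OF h c]])
next
  fix c c' x assume c: "c \<in> A" "c' \<in> A" and x: "x \<in> coords c (fst c' \<inter> W)"
  interpret coordinate_isometry "g c" "coords c W" "g c'" "coords c' W" "transition c c'" "coords c (fst c' \<inter> W)"
    by (rule transition_isometry[OF c W])
  have "grad (g c) (\<lambda>y. local_rep h c' (transition c c' y)) x = grad (g c) (local_rep h c) x"
    by (rule grad_cong_open[OF open_T x]) (rule local_rep_transition[OF c])
  then show "gradient g h c' (transition c c' x) = der (transition c c') x (gradient g h c x)"
    unfolding gradient_def using grad_pullback[OF x smooth_fun_local_rep[OF h c(2)]] by simp
qed

lemma vector_field_scale:
  assumes W: "open W" and \<psi>: "smooth_fun A W \<psi>" and X: "vector_field A W X"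
  shows "vector_field A W (\<lambda>c x. local_rep \<psi> c x *\<^sub>R X c x)"
  unfolding vector_field_def
proof (intro conjI ballI)
  fix c assume c: "c \<in> A"
  show "smooth_on (coords c W) (\<lambda>x. local_rep \<psi> c x *\<^sub>R X c x)"
    using X c by (intro smooth_on_scaleR open_coords smooth_fun_local_rep \<psi> W) (auto simp: vector_field_def)
next
  fix c c' x assume c: "c \<in> A" "c' \<in> A" and x: "x \<in> coords c (fst c' \<inter> W)"
  interpret coordinate_isometry "g c" "coords c W" "g c'" "coords c' W" "transition c c'" "coords c (fst c' \<inter> W)"
    by (rule transition_isometry[OF c W])
  show "local_rep \<psi> c' (transition c c' x) *\<^sub>R X c' (transition c c' x)
      = der (transition c c') x (local_rep \<psi> c x *\<^sub>R X c x)"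
    using X c x by (simp add: local_rep_transition[OF c x] d\<phi>_simps vector_field_def)
qed

lemma vector_field_subset: "vector_field A W X \<Longrightarrow> W' \<subseteq> W \<Longrightarrow> vector_field A W' X"
proof -
  assume X: "vector_field A W X" and W: "W' \<subseteq> W"
  have "coords c W' \<subseteq> coords c W" "coords c (fst c' \<inter> W') \<subseteq> coords c (fst c' \<inter> W)" for c :: "('m, 'd) chart" and c'
    using W by (auto simp: coords_def)
  then show ?thesis using X unfolding vector_field_def by (meson smooth_on_subset subsetD)
qed

text \<open>The quotient \<open>q\<close> is smooth in each chart but is formed with the Euclidean
  inner product of that chart. Its value is nevertheless the same in all charts, since both fields
  transform by the same linear map and N is nonzero. The chart \<open>c0\<close>, which covers W,
  then turns it into a function on points.\<close>

lemma proportional_vector_field: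
  assumes W: "open W" "W \<subseteq> fst c0" "c0 \<in> A" and X: "vector_field A W X" and N: "vector_field A W N"
    and N0: "\<And>c x. c \<in> A \<Longrightarrow> x \<in> coords c W \<Longrightarrow> N c x \<noteq> 0"
    and sp: "\<And>c x. c \<in> A \<Longrightarrow> x \<in> coords c W \<Longrightarrow> X c x \<in> span {N c x}"
  obtains \<psi> where "smooth_fun A W \<psi>" "\<And>c x. c \<in> A \<Longrightarrow> x \<in> coords c W \<Longrightarrow> X c x = local_rep \<psi> c x *\<^sub>R N c x"
proof -
  define q where "q c x = (X c x \<bullet> N c x) / (N c x \<bullet> N c x)" for c x
  define \<psi> where "\<psi> p = q c0 (snd c0 p)" for p
  have q: "X c x = q c x *\<^sub>R N c x" if "c \<in> A" "x \<in> coords c W" for c x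
    using sp[OF that] N0[OF that] by (auto simp: span_singleton q_def)
  have rep: "local_rep \<psi> c x = q c x" if c: "c \<in> A" and x: "x \<in> coords c W" for c x
  proof -
    have x0: "x \<in> coords c (fst c0 \<inter> W)" using W(2) coordsD[OF c x] coords_iff[OF c, of x "fst c0 \<inter> W"] by blast
    interpret coordinate_isometry "g c" "coords c W" "g c0" "coords c0 W" "transition c c0" "coords c (fst c0 \<inter> W)"
      by (rule transition_isometry[OF c W(3,1)])
    let ?y = "transition c c0 x"
    have y: "?y \<in> coords c0 W" using transition_coords(1)[OF c W(3) x0] .
    have tr: "X c0 ?y = der (transition c c0) x (X c x)" "N c0 ?y = der (transition c c0) x (N c x)"
      using X N c W(3) x0 by (auto simp: vector_field_def)
    have "q c0 ?y *\<^sub>R N c0 ?y = q c x *\<^sub>R N c0 ?y"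
    proof -
      have "q c0 ?y *\<^sub>R N c0 ?y = X c0 ?y" by (rule q[OF W(3) y, symmetric])
      also have "\<dots> = der (transition c c0) x (q c x *\<^sub>R N c x)" unfolding tr q[OF c x, symmetric] ..
      finally show ?thesis by (simp add: d\<phi>_simps[OF x0] tr)
    qed
    then have "q c0 ?y = q c x" using N0[OF W(3) y] by simp
    then show ?thesis by (simp add: local_rep_def \<psi>_def transition_def)
  qed
  have sm: "smooth_on (coords c W) (local_rep \<psi> c)" if c: "c \<in> A" for c
  proof -
    have "smooth_on (coords c W) (q c)"
      unfolding q_def using X N c N0[OF c]
      by (intro smooth_on_divide smooth_on_inner open_coords W) (auto simp: vector_field_def)
    then show ?thesis by (subst smooth_on_cong[OF open_coords[OF c W(1)] rep[OF c]])
  qed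
  show ?thesis
    by (rule that[of \<psi>]) (use sm q rep in \<open>auto simp: smooth_fun_def\<close>)
qed

lemma connected_neighbourhood:
  assumes c: "c \<in> A" and p: "p \<in> fst c" and S: "open S" "S \<subseteq> coords c UNIV" "snd c p \<in> S"
  obtains W where "open W" "connected W" "p \<in> W" "W \<subseteq> fst c" "coords c W \<subseteq> S"
proof -
  obtain r where r: "r > 0" "ball (snd c p) r \<subseteq> S" using S openE by blast
  let ?W = "chart_inv c ` ball (snd c p) r"
  have sub: "ball (snd c p) r \<subseteq> coords c UNIV" using r S by blast
  show ?thesis
  proof (rule that[of ?W])
    show "open ?W" by (rule open_chart_inv_image[OF c open_ball sub])
    show "connected ?W" by (rule connected_continuous_image[OF continuous_chart_inv[OF c sub] connected_ball])
    show "p \<in> ?W" using r c p by (metis centre_in_ball chart_inv_snd imageI)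
    show "?W \<subseteq> fst c" using sub chart_inv_in[OF c] by auto
    show "coords c ?W \<subseteq> S"
    proof
      fix x assume "x \<in> coords c ?W"
      then obtain y where "x \<in> coords c UNIV" "y \<in> ball (snd c p) r" "chart_inv c x = chart_inv c y"
        using coordsD[OF c] by blast
      then have "x = y" using sub snd_chart_inv[OF c] by (metis subsetD)
      then show "x \<in> S" using r \<open>y \<in> _\<close> by auto
    qed
  qed
qed

end


section \<open>Isotropic locally homogeneous steady solitons\<close>

lemma funpow_3: "(T ^^ 3) = (\<lambda>u. T (T (T u)))" and funpow_2: "(T ^^ 2) = (\<lambda>u. T (T u))"
  by (auto simp: numeral_3_eq_3 numeral_2_eq_2)

text \<open>Nonzero Ric at one point spreads to all points by homogeneity and excludes rank 0. The
  nowhere vanishing gradient is the null vector on which the pointwise algebra is built.\<close>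

locale isotropic_soliton = lorentzian_mfd A g
  for A :: "('m::{t2_space, second_countable_topology}, 'd::finite) chart set" and g :: "('m, 'd) metric" +
  fixes f :: "'m \<Rightarrow> real"
  assumes homogeneous: "locally_homogeneous A g"
    and soliton: "steady_gradient_ricci_soliton A g f"
    and isotropic: "\<forall>c\<in>A. \<forall>x\<in>coords c UNIV. g c x (gradient g f c x) (gradient g f c x) = 0"
    and gradient_nonzero: "\<forall>c\<in>A. \<forall>x\<in>coords c UNIV. gradient g f c x \<noteq> 0"
    and not_ricci_flat: "\<exists>c\<in>A. \<exists>x\<in>coords c UNIV. ricci_op (g c) x \<noteq> (\<lambda>_. 0)"
begin

abbreviation N where "N \<equiv> gradient g f"
abbreviation H where "H c \<equiv> hess_op (g c) (local_rep f c)"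

lemma smooth_f: "smooth_fun A (carrier A) f"
  using soliton by (simp add: steady_gradient_ricci_soliton_def)

lemma smooth_rep: "c \<in> A \<Longrightarrow> smooth_on (coords c UNIV) (local_rep f c)"
  using smooth_fun_local_rep[OF smooth_f] coords_carrier by metis

lemma hess_ricci: "c \<in> A \<Longrightarrow> x \<in> coords c UNIV \<Longrightarrow>
    hess (g c) (local_rep f c) (\<lambda>_. u) (\<lambda>_. v) x = - ricci (g c) x u v"
  using soliton by (simp add: steady_gradient_ricci_soliton_def add_eq_0_iff2)

lemma vector_field_N: "vector_field A (carrier A) N"
  by (rule vector_field_gradient[OF open_carrier smooth_f])

lemma smooth_N: "c \<in> A \<Longrightarrow> smooth_on (coords c UNIV) (N c)"
  using vector_field_N coords_carrier unfolding vector_field_def by metis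

lemma N_nonzero: "c \<in> A \<Longrightarrow> x \<in> coords c UNIV \<Longrightarrow> N c x \<noteq> 0"
  using gradient_nonzero by blast

lemma N_null: "c \<in> A \<Longrightarrow> x \<in> coords c UNIV \<Longrightarrow> g c x (N c x) (N c x) = 0"
  using isotropic by blast

lemma H_linear: "c \<in> A \<Longrightarrow> x \<in> coords c UNIV \<Longrightarrow> linear (H c x)"
  by (rule coordinate_metric.hess_op_linear[OF coordinate_metric _ smooth_rep])

lemma H_ricci: "c \<in> A \<Longrightarrow> x \<in> coords c UNIV \<Longrightarrow> H c x u = - ricci_op (g c) x u"
proof -
  assume c: "c \<in> A" and x: "x \<in> coords c UNIV"
  interpret coordinate_metric "g c" "coords c UNIV" by (rule coordinate_metric[OF c])
  show ?thesis
    by (rule G_eqI[OF x]) (simp add: G_hess_op[OF x smooth_rep[OF c]] hess_ricci[OF c x] G_simps[OF x] G_ricci_op[OF x])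
qed

lemma dual_N:
  assumes c: "c \<in> A" and x: "x \<in> coords c UNIV"
  shows "g c x (N c x) v = der (local_rep f c) x v" "g c x v (N c x) = der (local_rep f c) x v"
proof -
  interpret coordinate_metric "g c" "coords c UNIV" by (rule coordinate_metric[OF c])
  show "g c x (N c x) v = der (local_rep f c) x v"
    unfolding gradient_def by (rule G_grad[OF x smooth_rep[OF c] x])
  then show "g c x v (N c x) = der (local_rep f c) x v" using G_sym[OF x] by metis
qed

lemma H_pullback:
  assumes c: "c \<in> A" "c' \<in> A" and S: "S \<subseteq> coords c UNIV" "S' \<subseteq> coords c' UNIV"
    and iso: "coordinate_isometry (g c) S (g c') S' \<phi> T" and x: "x \<in> T"
  shows "H c' (\<phi> x) (der \<phi> x u) = der \<phi> x (H c x u)"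
proof -
  interpret coordinate_isometry "g c" S "g c'" S' \<phi> T by (rule iso)
  have "x \<in> coords c UNIV" "\<phi> x \<in> coords c' UNIV" using S in_S[OF x] \<phi>_in[OF x] by auto
  then show ?thesis
    using H_ricci c ricci_op_pullback[OF x] by (simp add: linear_neg[OF d\<phi>_linear[OF x]])
qed

section \<open>Consequences of local homogeneity\<close>

lemma homogeneous_coordinates:
  assumes "c \<in> A" "c' \<in> A" "x \<in> coords c UNIV" "x' \<in> coords c' UNIV"
  obtains W W' \<phi> where "local_isometry A g W W' \<phi>" "chart_inv c x \<in> W" "\<phi> (chart_inv c x) = chart_inv c' x'"
    "x \<in> coords c (W \<inter> \<phi> -` fst c')" "(snd c' \<circ> \<phi> \<circ> chart_inv c) x = x'"
proof -
  obtain W W' \<phi> where \<phi>: "local_isometry A g W W' \<phi>" "chart_inv c x \<in> W" "\<phi> (chart_inv c x) = chart_inv c' x'"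
    using homogeneous chart_inv_carrier assms unfolding locally_homogeneous_def by metis
  have "x \<in> coords c (W \<inter> \<phi> -` fst c')"
    using \<phi> coords_iff[OF assms(1), of x "W \<inter> \<phi> -` fst c'"] assms(3) chart_inv_in[OF assms(2,4)] by simp
  then show ?thesis using that[OF \<phi>] \<phi>(3) assms by simp
qed

lemma homogeneous_isometry:
  assumes "c \<in> A" "c' \<in> A" "x \<in> coords c UNIV" "x' \<in> coords c' UNIV"
  obtains \<phi> T where "coordinate_isometry (g c) (coords c UNIV) (g c') (coords c' UNIV) \<phi> T" "x \<in> T" "\<phi> x = x'"
proof -
  obtain W W' \<phi> where \<phi>: "local_isometry A g W W' \<phi>" "x \<in> coords c (W \<inter> \<phi> -` fst c')"
    "(snd c' \<circ> \<phi> \<circ> chart_inv c) x = x'"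
    by (rule homogeneous_coordinates[OF assms])
  show ?thesis by (rule that[OF local_isometry_coordinates[OF assms(1,2) \<phi>(1)] \<phi>(2,3)])
qed

text \<open>The form in which homogeneity enters the pointwise arguments: trace, vanishing of H and
  vanishing of its square are conjugation invariants, hence the same at all points.\<close>

lemma H_conjugate:
  assumes "c \<in> A" "c' \<in> A" "x \<in> coords c UNIV" "x' \<in> coords c' UNIV"
  obtains L where "linear L" "inj L" "surj L" "\<And>u. H c' x' (L u) = L (H c x u)"
proof -
  obtain \<phi> T where iso: "coordinate_isometry (g c) (coords c UNIV) (g c') (coords c' UNIV) \<phi> T" and x: "x \<in> T" "\<phi> x = x'"
    by (rule homogeneous_isometry[OF assms])
  interpret coordinate_isometry "g c" "coords c UNIV" "g c'" "coords c' UNIV" \<phi> T by (rule iso)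
  show ?thesis
    using that[OF d\<phi>_linear[OF x(1)] d\<phi>_inj[OF x(1)] d\<phi>_surj[OF x(1)]]
      H_pullback[OF assms(1,2) order_refl order_refl iso x(1)] x(2) by simp
qed

lemma trace_H_constant:
  assumes "c \<in> A" "c' \<in> A" "x \<in> coords c UNIV" "x' \<in> coords c' UNIV"
  shows "trace (matrix (H c' x')) = trace (matrix (H c x))"
proof -
  obtain L where L: "linear L" "inj L" "surj L" "\<And>u. H c' x' (L u) = L (H c x u)"
    by (rule H_conjugate[OF assms]) (rule that)
  show ?thesis
    by (rule trace_conjugate[where T = "H c x" and T' = "H c' x'" and L = L])
       (rule H_linear[OF assms(1,3)] H_linear[OF assms(2,4)] L)+
qed

lemma null_self_adjoint:
  assumes c: "c \<in> A" and x: "x \<in> coords c UNIV"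
  shows "null_self_adjoint (g c x) (H c x) (N c x)"
proof -
  interpret coordinate_metric "g c" "coords c UNIV" by (rule coordinate_metric[OF c])
  note sm = smooth_rep[OF c]
  have null: "g c y (grad (g c) (local_rep f c) y) (grad (g c) (local_rep f c) y) = 0" if "y \<in> coords c UNIV" for y
    using N_null[OF c that] by (simp add: gradient_def)
  have HN: "H c x (N c x) = 0"
    unfolding gradient_def by (rule hess_op_grad_null[OF x sm null])
  \<comment> \<open>The soliton equation evaluated on (N, N): together with H N = 0 it removes the
    Ricci term of the Bochner formula.\<close>
  have "g c x (H c x (N c x)) (N c x) = - ricci (g c) x (N c x) (N c x)"
    unfolding G_hess_op[OF x sm] by (rule hess_ricci[OF c x])
  then have "ricci (g c) x (N c x) (N c x) = 0" unfolding HN by (simp add: G_simps[OF x])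
  then have "trace (matrix (\<lambda>w. H c x (H c x w))) = 0"
    unfolding gradient_def
    by (intro trace_hess_op_square[OF x sm null, of "trace (matrix (H c x))"] trace_H_constant[OF c c x])
  then show ?thesis
    using lorentzian[OF x] H_linear[OF c x] hess_op_adjoint[OF x sm] N_nonzero[OF c x] N_null[OF c x] HN
    unfolding null_self_adjoint_def by blast
qed

lemma H_nonzero:
  assumes c: "c \<in> A" and x: "x \<in> coords c UNIV"
  shows "H c x \<noteq> (\<lambda>_. 0)"
proof
  assume 0: "H c x = (\<lambda>_. 0)"
  obtain c' x' where c': "c' \<in> A" "x' \<in> coords c' UNIV" "ricci_op (g c') x' \<noteq> (\<lambda>_. 0)"
    using not_ricci_flat by blast
  obtain L where L: "linear L" "inj L" "surj L" "\<And>u. H c' x' (L u) = L (H c x u)"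
    by (rule H_conjugate[OF c c'(1) x c'(2)]) (rule that)
  have "ricci_op (g c') x' v = 0" for v
  proof -
    obtain u where "v = L u" using L(3) by (metis surjD)
    then have "H c' x' v = 0" using L(4)[of u] 0 linear_0[OF L(1)] by simp
    then show ?thesis using H_ricci[OF c'(1,2)] by simp
  qed
  then show False using c'(3) by blast
qed

text \<open>A nonzero H^2 at one point is carried by conjugation to every point, so the alternative
  holds for the whole manifold and not just point by point.\<close>

lemma H_dichotomy:
  "(\<forall>c\<in>A. \<forall>x\<in>coords c UNIV. endo_rank (H c x) = 2 \<and> nilpotent_step 3 (H c x)) \<or>
   (\<forall>c\<in>A. \<forall>x\<in>coords c UNIV. \<forall>u. H c x (H c x u) = 0)"
proof (rule disjCI)
  assume "\<not> (\<forall>c\<in>A. \<forall>x\<in>coords c UNIV. \<forall>u. H c x (H c x u) = 0)"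
  then obtain c x u where c: "c \<in> A" and x: "x \<in> coords c UNIV" and u: "H c x (H c x u) \<noteq> 0" by blast
  show "\<forall>c\<in>A. \<forall>x\<in>coords c UNIV. endo_rank (H c x) = 2 \<and> nilpotent_step 3 (H c x)"
  proof (intro ballI)
    fix c' x' assume c': "c' \<in> A" and x': "x' \<in> coords c' UNIV"
    interpret null_self_adjoint "g c' x'" "H c' x'" "N c' x'" by (rule null_self_adjoint[OF c' x'])
    obtain L where L: "linear L" "inj L" "surj L" "\<And>u. H c' x' (L u) = L (H c x u)"
      by (rule H_conjugate[OF c c' x x']) (rule that)
    have "H c' x' (H c' x' (L u)) \<noteq> 0"
      using u L(4) linear_injective_0[OF L(1)] L(2) by metis
    then show "endo_rank (H c' x') = 2 \<and> nilpotent_step 3 (H c' x')"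
      using square_ne_0_rank cube_eq_0 unfolding nilpotent_step_def
      by (auto simp: funpow_3 funpow_2 fun_eq_iff)
  qed
qed

end


section \<open>The rank one case\<close>

text \<open>Near x some basis vector e_i has nonzero value under L. Correcting every other basis
  vector by a multiple of e_i puts it into the kernel, and these k vectors form the smooth
  frame.\<close>

lemma kernel_frame:
  fixes L :: "real^'d::finite \<Rightarrow> real^'d \<Rightarrow> real"
  assumes S: "open S" "x \<in> S" and L: "\<And>y. y \<in> S \<Longrightarrow> linear (L y)" and sm: "\<And>v. smooth_on S (\<lambda>y. L y v)"
    and Lx: "L x \<noteq> (\<lambda>_. 0)" and k: "CARD('d) = Suc k"
  shows "dim {v. L x v = 0} = k"
    "\<exists>S' B. open S' \<and> x \<in> S' \<and> S' \<subseteq> S \<and> (\<forall>i<k. smooth_on S' (B i)) \<and>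
       (\<forall>y\<in>S'. {v. L y v = 0} = span ((\<lambda>i. B i y) ` {..<k}))"
proof -
  obtain i where i: "L x (axis i 1) \<noteq> 0" using linear_ne_0_axis[OF L[OF S(2)] Lx] by blast
  \<comment> \<open>Writes \<open>L x\<close> as the inner product with a nonzero vector, so that
    its kernel is a hyperplane of known dimension.\<close>
  define a :: "real^'d" where "a = (\<chi> j. L x (axis j 1))"
  have "L x v = a \<bullet> v" for v
    using linear_basis_expansion[OF L[OF S(2)], of v] by (simp add: a_def inner_vec_def mult.commute)
  moreover have "a \<noteq> 0" using i by (auto simp: a_def vec_eq_iff)
  ultimately show "dim {v. L x v = 0} = k" using k by (simp add: dim_hyperplane)
  define S' where "S' = {y \<in> S. L y (axis i 1) \<noteq> 0}"
  have "open ((\<lambda>y. L y (axis i 1)) -` (- {0}) \<inter> S)"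
    by (rule continuous_on_open_vimage[THEN iffD1, rule_format, OF S(1) smooth_on_imp_continuous_on[OF sm]])
       (rule open_Compl[OF closed_singleton])
  moreover have "(\<lambda>y. L y (axis i 1)) -` (- {0}) \<inter> S = S'" by (auto simp: S'_def)
  ultimately have S': "open S'" "x \<in> S'" "S' \<subseteq> S" using S i by (auto simp: S'_def)
  have "card (UNIV - {i}) = k" using k by simp
  then obtain b where b: "bij_betw b {..<k} (UNIV - {i})"
    using ex_bij_betw_nat_finite[of "UNIV - {i}"] by (auto simp: atLeast0LessThan)
  define E where "E j y = axis j 1 - (L y (axis j 1) / L y (axis i 1)) *\<^sub>R (axis i 1 :: real^'d)" for j y
  have sE: "smooth_on S' (E j)" for j
    unfolding E_def[abs_def]
    by (intro smooth_on_diff smooth_on_scaleR smooth_on_divide smooth_on_const S'(1) smooth_on_subset[OF sm S'(3)])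
       (simp add: S'_def)
  have span: "{v. L y v = 0} = span ((\<lambda>j. E j y) ` (UNIV - {i}))" if y: "y \<in> S'" for y
  proof
    have l: "linear (L y)" and nz: "L y (axis i 1) \<noteq> 0" using y L by (auto simp: S'_def)
    have "L y (E j y) = 0" for j
      using nz by (simp add: E_def linear_diff[OF l] linear_cmul[OF l])
    moreover have "subspace {v. L y v = 0}"
      by (auto simp: subspace_def linear_0[OF l] linear_add[OF l] linear_cmul[OF l])
    ultimately show "span ((\<lambda>j. E j y) ` (UNIV - {i})) \<subseteq> {v. L y v = 0}"
      by (intro span_minimal) auto
    show "{v. L y v = 0} \<subseteq> span ((\<lambda>j. E j y) ` (UNIV - {i}))"
    proof
      fix v assume "v \<in> {v. L y v = 0}"
      then have "(\<Sum>j\<in>UNIV. (v $ j) *\<^sub>R L y (axis j 1)) = 0"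
        using linear_basis_expansion[OF l, of v] by simp
      then have 0: "(\<Sum>j\<in>UNIV - {i}. v $ j * L y (axis j 1)) = - (v $ i * L y (axis i 1))"
        by (simp add: sum.remove[of UNIV i] add_eq_0_iff)
      have v: "v = (\<Sum>j\<in>UNIV - {i}. (v $ j) *\<^sub>R axis j 1) + (v $ i) *\<^sub>R axis i 1"
        using basis_expansion[of v] by (simp add: scalar_mult_eq_scaleR sum.remove[of UNIV i] add.commute)
      have "(\<Sum>j\<in>UNIV - {i}. (v $ j) *\<^sub>R E j y)
          = (\<Sum>j\<in>UNIV - {i}. (v $ j) *\<^sub>R axis j 1)
            - ((\<Sum>j\<in>UNIV - {i}. v $ j * L y (axis j 1)) / L y (axis i 1)) *\<^sub>R axis i 1"
        by (simp add: E_def scaleR_diff_right sum_subtractf scaleR_sum_left sum_divide_distrib)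
      also have "\<dots> = v" unfolding 0 using nz v by simp
      finally have "(\<Sum>j\<in>UNIV - {i}. (v $ j) *\<^sub>R E j y) = v" .
      moreover have "(\<Sum>j\<in>UNIV - {i}. (v $ j) *\<^sub>R E j y) \<in> span ((\<lambda>j. E j y) ` (UNIV - {i}))"
        by (intro span_sum span_mul span_base) auto
      ultimately show "v \<in> span ((\<lambda>j. E j y) ` (UNIV - {i}))" by simp
    qed
  qed
  have "(\<lambda>k. E (b k) y) ` {..<k} = (\<lambda>j. E j y) ` (UNIV - {i})" for y
    unfolding bij_betw_imp_surj_on[OF b, symmetric] by (simp add: image_image)
  then show "\<exists>S' B. open S' \<and> x \<in> S' \<and> S' \<subseteq> S \<and> (\<forall>i<k. smooth_on S' (B i)) \<and>
       (\<forall>y\<in>S'. {v. L y v = 0} = span ((\<lambda>i. B i y) ` {..<k}))"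
    using S' sE span by (intro exI[of _ S'] exI[of _ "\<lambda>k. E (b k)"]) auto
qed

locale nilpotent_soliton = isotropic_soliton A g f
  for A :: "('m::{t2_space, second_countable_topology}, 'd::finite) chart set" and g :: "('m, 'd) metric" and f :: "'m \<Rightarrow> real" +
  assumes square_zero: "\<forall>c\<in>A. \<forall>x\<in>coords c UNIV. \<forall>u. H c x (H c x u) = 0"
begin

abbreviation D where "D \<equiv> orthogonal_distribution g N"

lemma kernel_H: "c \<in> A \<Longrightarrow> x \<in> coords c UNIV \<Longrightarrow> {v. H c x v = 0} = D c x"
  and range_H: "c \<in> A \<Longrightarrow> x \<in> coords c UNIV \<Longrightarrow> range (H c x) = span {N c x}"
  using null_self_adjoint.square_eq_0_structure[OF null_self_adjoint _ H_nonzero] square_zero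
  unfolding orthogonal_distribution_def by blast+

lemma D_eq: "c \<in> A \<Longrightarrow> x \<in> coords c UNIV \<Longrightarrow> D c x = {v. der (local_rep f c) x v = 0}"
  unfolding orthogonal_distribution_def using dual_N(2) by simp

lemma der_f_nonzero:
  assumes c: "c \<in> A" and x: "x \<in> coords c UNIV"
  shows "der (local_rep f c) x \<noteq> (\<lambda>_. 0)"
proof
  assume "der (local_rep f c) x = (\<lambda>_. 0)"
  then have "N c x = 0"
    by (intro lorentzian_nondegenerate[OF coordinate_metric.lorentzian[OF coordinate_metric[OF c] x]])
       (simp add: dual_N(1)[OF c x])
  then show False using N_nonzero[OF c x] by simp
qed

lemma rank_one:
  assumes c: "c \<in> A" and x: "x \<in> coords c UNIV"
  shows "endo_rank (H c x) = 1" "nilpotent_step 2 (H c x)"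
  using N_nonzero[OF c x] range_H[OF c x] H_nonzero[OF c x] square_zero c x
  by (auto simp: endo_rank_def nilpotent_step_def funpow_2)

text \<open>In the paper's notation \<open>\<nabla>\<^sub>u N = \<omega>(u) N\<close> with \<open>\<omega> = h df\<close>.\<close>

definition \<omega> :: "('m, 'd) chart \<Rightarrow> real^'d \<Rightarrow> real^'d \<Rightarrow> real" where
  "\<omega> c x u = (H c x u \<bullet> N c x) / (N c x \<bullet> N c x)"

lemma H_\<omega>:
  assumes c: "c \<in> A" and x: "x \<in> coords c UNIV"
  shows "H c x u = \<omega> c x u *\<^sub>R N c x"
proof -
  have "H c x u \<in> span {N c x}" using range_H[OF c x] by blast
  then show ?thesis using N_nonzero[OF c x] by (auto simp: span_singleton \<omega>_def)
qed

lemma nabla_N: "nabla (g c) (\<lambda>_. u) (N c) x = H c x u"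
  by (simp add: hess_op_def gradient_def)

text \<open>The Euclidean products in the definition of \<omega> depend on the chart. The
  transformation law is obtained instead by comparing coefficients of the nonzero vector N, since
  both H and N are natural under transition maps.\<close>

lemma one_form_\<omega>: "one_form A (carrier A) \<omega>"
  unfolding one_form_def
proof (intro conjI ballI allI)
  fix c x assume c: "c \<in> A" and "x \<in> coords c (carrier A)"
  then have x: "x \<in> coords c UNIV" using coords_carrier by blast
  show "linear (\<omega> c x)"
    unfolding \<omega>_def
    by (rule linearI)
       (simp_all add: linear_add[OF H_linear[OF c x]] linear_cmul[OF H_linear[OF c x]] inner_add_left add_divide_distrib)
next
  fix c v assume c: "c \<in> A"
  show "smooth_on (coords c (carrier A)) (\<lambda>x. \<omega> c x v)"
    unfolding \<omega>_def coords_carrier[OF c]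
    by (intro smooth_on_divide smooth_on_inner smooth_N[OF c] chart(2)[OF c]
        coordinate_metric.smooth_hess_op[OF coordinate_metric[OF c] smooth_rep[OF c]])
       (use N_nonzero[OF c] in auto)
next
  fix c c' x v assume c: "c \<in> A" "c' \<in> A" and x: "x \<in> coords c (fst c' \<inter> carrier A)"
  let ?T = "transition c c'"
  have x': "x \<in> coords c UNIV" using coordsD(1)[OF c(1) x] .
  interpret coordinate_isometry "g c" "coords c (carrier A)" "g c'" "coords c' (carrier A)" ?T "coords c (fst c' \<inter> carrier A)"
    by (rule transition_isometry[OF c open_carrier])
  have y: "?T x \<in> coords c' UNIV" using \<phi>_in[OF x] coords_subset by blast
  have N': "N c' (?T x) = der ?T x (N c x)" using vector_field_N c x by (simp add: vector_field_def)
  have "\<omega> c' (?T x) (der ?T x v) *\<^sub>R N c' (?T x) = der ?T x (H c x v)"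
    unfolding H_\<omega>[OF c(2) y, symmetric]
    by (rule H_pullback[OF c coords_subset coords_subset transition_isometry[OF c open_carrier] x])
  also have "\<dots> = \<omega> c x v *\<^sub>R N c' (?T x)"
    unfolding H_\<omega>[OF c(1) x'] N' by (simp add: d\<phi>_simps[OF x])
  finally show "\<omega> c' (?T x) (der ?T x v) = \<omega> c x v" using N_nonzero[OF c(2) y] by simp
qed

lemma recurrent_N: "recurrent_field A g (carrier A) N"
  unfolding recurrent_field_def
proof (intro conjI exI[of _ \<omega>] ballI allI)
  fix c x u assume c: "c \<in> A" and "x \<in> coords c (carrier A)"
  then have "x \<in> coords c UNIV" by (simp add: coords_carrier)
  then show "nabla (g c) (\<lambda>_. u) (N c) x = \<omega> c x u *\<^sub>R N c x" unfolding nabla_N by (rule H_\<omega>[OF c])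
qed (rule vector_field_N one_form_\<omega>)+

section \<open>The distribution orthogonal to the gradient\<close>

lemma distribution_D:
  assumes "CARD('d) = Suc k"
  shows "distribution A (carrier A) k D"
  unfolding distribution_def
proof (intro conjI ballI)
  fix c x assume c: "c \<in> A" and "x \<in> coords c (carrier A)"
  then have x: "x \<in> coords c UNIV" using coords_carrier by blast
  have l: "linear (der (local_rep f c) y)" if "y \<in> coords c UNIV" for y
    by (rule smooth_on_linear_frechet_derivative[OF smooth_rep[OF c] that])
  note fr = kernel_frame[of "coords c UNIV" x "der (local_rep f c)",
      OF chart(2)[OF c] x l smooth_on_frechet_derivative[OF smooth_rep[OF c]] der_f_nonzero[OF c x] assms]
  show "subspace (D c x)"
    unfolding D_eq[OF c x]
    by (auto simp: subspace_def linear_0[OF l[OF x]] linear_add[OF l[OF x]] linear_cmul[OF l[OF x]])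
  show "dim (D c x) = k" unfolding D_eq[OF c x] using fr(1) by simp
  obtain S B where "open S" "x \<in> S" and sub: "S \<subseteq> coords c UNIV" and B: "\<forall>i<k. smooth_on S (B i)"
    "\<forall>y\<in>S. {v. der (local_rep f c) y v = 0} = span ((\<lambda>i. B i y) ` {..<k})"
    using fr(2) by blast
  moreover have "\<forall>y\<in>S. D c y = span ((\<lambda>i. B i y) ` {..<k})" using B(2) D_eq[OF c] sub by blast
  ultimately show "\<exists>S B. open S \<and> x \<in> S \<and> S \<subseteq> coords c (carrier A) \<and> (\<forall>i<k. smooth_on S (B i)) \<and>
      (\<forall>y\<in>S. D c y = span ((\<lambda>i. B i y) ` {..<k}))"
    unfolding coords_carrier[OF c] by blast
next
  fix c c' x assume c: "c \<in> A" "c' \<in> A" and x: "x \<in> coords c (fst c' \<inter> carrier A)"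
  let ?T = "transition c c'"
  interpret coordinate_isometry "g c" "coords c (carrier A)" "g c'" "coords c' (carrier A)" ?T "coords c (fst c' \<inter> carrier A)"
    by (rule transition_isometry[OF c open_carrier])
  have N': "N c' (?T x) = der ?T x (N c x)" using vector_field_N c x by (simp add: vector_field_def)
  show "der ?T x ` D c x = D c' (?T x)"
  proof
    show "der ?T x ` D c x \<subseteq> D c' (?T x)"
      by (auto simp: orthogonal_distribution_def N' isometry[OF x])
    show "D c' (?T x) \<subseteq> der ?T x ` D c x"
    proof
      fix w assume w: "w \<in> D c' (?T x)"
      obtain v where "w = der ?T x v" using surjD[OF d\<phi>_surj[OF x]] by metis
      then show "w \<in> der ?T x ` D c x" using w by (auto simp: orthogonal_distribution_def N' isometry[OF x])
    qed
  qed
qed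

text \<open>Differentiating g(Y, N) = 0 along X gives g(\<nabla>_X Y, N) = - g(Y, H X), and H X is a
  multiple of N, to which Y is orthogonal.\<close>

lemma totally_geodesic_D: "totally_geodesic_distribution A g (carrier A) D"
  unfolding totally_geodesic_distribution_def
proof (intro allI impI ballI, elim conjE)
  fix U X Y c x
  assume U: "open U" "U \<subseteq> carrier A" and X: "section_of A U D X" and Y: "section_of A U D Y"
    and c: "c \<in> A" and x: "x \<in> coords c U"
  have x': "x \<in> coords c UNIV" using coordsD(1)[OF c x] .
  interpret coordinate_metric "g c" "coords c UNIV" by (rule coordinate_metric[OF c])
  have dY: "(Y c has_derivative der (Y c) x) (at x)"
    using Y c x smooth_on_has_derivative by (auto simp: section_of_def vector_field_def)
  have dN: "(N c has_derivative der (N c) x) (at x)"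
    by (rule smooth_on_has_derivative[OF smooth_N[OF c] x'])
  have orth: "g c y (Y c y) (N c y) = 0" if "y \<in> coords c U" for y
    using Y c that by (auto simp: section_of_def orthogonal_distribution_def)
  have "((\<lambda>y. 0) has_derivative (\<lambda>w. g c x (der (Y c) x w + christoffel (g c) x w (Y c x)) (N c x)
      + g c x (Y c x) (der (N c) x w + christoffel (g c) x w (N c x)))) (at x)"
    by (rule has_derivative_transform_within_open[OF G_nabla[OF x' dY dN] open_coords[OF c U(1)] x]) (rule orth)
  from has_derivative_constD[OF this, of "X c x"]
  have "g c x (nabla (g c) (X c) (Y c) x) (N c x) + g c x (Y c x) (H c x (X c x)) = 0"
    by (simp add: nabla_def dir_deriv_def hess_op_def gradient_def)
  moreover have "g c x (Y c x) (H c x (X c x)) = 0"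
    unfolding H_\<omega>[OF c x'] using orth[OF x] by (simp add: G_simps[OF x'])
  ultimately show "nabla (g c) (X c) (Y c) x \<in> D c x" by (simp add: orthogonal_distribution_def)
qed

section \<open>Leaves as connected components of level sets\<close>

abbreviation level where "level t \<equiv> {p \<in> carrier A. f p = t}"

text \<open>Straightening gives a connected piece of the level set around each point of C. By
  maximality C contains that piece, so near the point C is the whole level set and is straightened
  by the same map.\<close>

lemma component_integral_manifold:
  assumes C: "C \<in> components (level t)"
  shows "integral_manifold A D C"
  unfolding integral_manifold_def
proof (intro conjI ballI)
  have CL: "C \<subseteq> level t" by (rule in_components_subset[OF C])
  then show "C \<subseteq> carrier A" by auto
  fix c x assume c: "c \<in> A" and x: "x \<in> coords c C"
  let ?h = "local_rep f c"
  have x': "x \<in> coords c UNIV" using coordsD(1)[OF c x] .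
  have px: "chart_inv c x \<in> C" using coordsD(2)[OF c x] .
  then have hx: "?h x = t" using CL by (auto simp: local_rep_def)
  obtain S \<Psi> E where S: "open S" "x \<in> S" "S \<subseteq> coords c UNIV" "inj_on \<Psi> S" "open (\<Psi> ` S)"
    "smooth_on S \<Psi>" "smooth_on (\<Psi> ` S) (inv_into S \<Psi>)" "subspace (E :: (real^'d) set)"
    and img: "\<Psi> ` (S \<inter> {y. ?h y = ?h x}) = \<Psi> ` S \<inter> E" and conn: "connected (S \<inter> {y. ?h y = ?h x})"
    and ker: "\<And>y. y \<in> S \<Longrightarrow> {v. der ?h y v = 0} = {v. der \<Psi> y v \<in> E}"
    by (rule level_set_straightening[OF chart(2)[OF c] x' smooth_rep[OF c] der_f_nonzero[OF c x']]) (rule that)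
  have "S \<inter> coords c C = S \<inter> {y. ?h y = ?h x}"
  proof
    show "S \<inter> coords c C \<subseteq> S \<inter> {y. ?h y = ?h x}"
      using CL hx coordsD(2)[OF c] by (auto simp: local_rep_def)
    have "chart_inv c ` (S \<inter> {y. ?h y = ?h x}) \<subseteq> C"
    proof (rule components_maximal[OF C])
      show "connected (chart_inv c ` (S \<inter> {y. ?h y = ?h x}))"
        using S(3) by (intro connected_continuous_image[OF continuous_chart_inv[OF c] conn]) auto
      show "chart_inv c ` (S \<inter> {y. ?h y = ?h x}) \<subseteq> level t"
        using S(3) hx chart_inv_carrier[OF c] by (auto simp: local_rep_def)
      show "C \<inter> chart_inv c ` (S \<inter> {y. ?h y = ?h x}) \<noteq> {}" using px S(2) by blast
    qed
    then show "S \<inter> {y. ?h y = ?h x} \<subseteq> S \<inter> coords c C"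
      using S(3) coords_iff[OF c, of _ C] by blast
  qed
  then show "\<exists>S (\<Psi> :: real^'d \<Rightarrow> real^'d) E. open S \<and> x \<in> S \<and> S \<subseteq> coords c UNIV \<and>
        inj_on \<Psi> S \<and> open (\<Psi> ` S) \<and> smooth_on S \<Psi> \<and> smooth_on (\<Psi> ` S) (inv_into S \<Psi>) \<and>
        subspace E \<and> \<Psi> ` (S \<inter> coords c C) = \<Psi> ` S \<inter> E \<and>
        (\<forall>y\<in>S \<inter> coords c C. D c y = {v. der \<Psi> y v \<in> E})"
    using S img ker D_eq[OF c] by (intro exI[of _ S] exI[of _ \<Psi>] exI[of _ E]) auto
qed

text \<open>The tangent spaces are kernels of df, so f is locally constant on M; connectedness makes
  it constant.\<close>

lemma constant_on_integral_manifold: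
  assumes M: "integral_manifold A D M" and conn: "connected M" and pq: "p \<in> M" "q \<in> M"
  shows "f p = f q"
proof (rule connected_local_const[OF conn pq], intro ballI)
  fix p assume p: "p \<in> M"
  then obtain c where c: "c \<in> A" "p \<in> fst c" using M by (auto simp: integral_manifold_def carrier_def)
  let ?x = "snd c p" and ?h = "local_rep f c"
  have x: "?x \<in> coords c M" by (rule snd_in[OF c(2) p])
  have "\<exists>S (\<Psi> :: real^'d \<Rightarrow> real^'d) E. open S \<and> ?x \<in> S \<and> S \<subseteq> coords c UNIV \<and>
        inj_on \<Psi> S \<and> open (\<Psi> ` S) \<and> smooth_on S \<Psi> \<and> smooth_on (\<Psi> ` S) (inv_into S \<Psi>) \<and>
        subspace E \<and> \<Psi> ` (S \<inter> coords c M) = \<Psi> ` S \<inter> E \<and>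
        (\<forall>y\<in>S \<inter> coords c M. D c y = {v. der \<Psi> y v \<in> E})"
    using M c(1) x unfolding integral_manifold_def by blast
  then obtain S and \<Psi> :: "real^'d \<Rightarrow> real^'d" and E where S: "open S" "?x \<in> S" "S \<subseteq> coords c UNIV" "inj_on \<Psi> S" "open (\<Psi> ` S)"
    "smooth_on S \<Psi>" "smooth_on (\<Psi> ` S) (inv_into S \<Psi>)" "subspace E"
    and img: "\<Psi> ` (S \<inter> coords c M) = \<Psi> ` S \<inter> E"
    and D: "\<forall>y\<in>S \<inter> coords c M. D c y = {v. der \<Psi> y v \<in> E}" by blast
  have "der ?h y v = 0" if "y \<in> S \<inter> coords c M" "der \<Psi> y v \<in> E" for y v
    using D D_eq[OF c(1)] that S(3) by blast
  then obtain S' where S': "open S'" "?x \<in> S'" "S' \<subseteq> S" "\<forall>y\<in>S' \<inter> (S \<inter> coords c M). ?h y = ?h ?x"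
    using locally_constant_on_integral_manifold[OF S(1,4-8) _ img _ smooth_on_subset[OF smooth_rep[OF c(1)] S(3)], of ?x] x S(2)
    by blast
  have sub: "S' \<subseteq> coords c UNIV" using S' S by blast
  have "f p = f q" if q: "q \<in> chart_inv c ` S'" "q \<in> M" for q
  proof -
    obtain y where y: "y \<in> S'" "q = chart_inv c y" using q(1) by blast
    then have "y \<in> coords c M" using q(2) sub coords_iff[OF c(1), of y M] by blast
    then have "?h y = ?h ?x" using S' y by blast
    then show ?thesis using y c by (simp add: local_rep_def)
  qed
  moreover have "open (chart_inv c ` S')" by (rule open_chart_inv_image[OF c(1) S'(1) sub])
  moreover have "p \<in> chart_inv c ` S'" using S'(2) c by (metis chart_inv_snd imageI)
  ultimately show "eventually (\<lambda>q. f p = f q) (at p within M)"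
    unfolding eventually_at_topological by blast
qed

lemma integral_manifold_component:
  assumes M: "integral_manifold A D M" "connected M" "p \<in> M"
  shows "M \<subseteq> connected_component_set (level (f p)) p"
proof (rule connected_component_maximal[OF M(3,2)])
  show "M \<subseteq> level (f p)"
    using constant_on_integral_manifold[OF M(1,2) _ M(3)] M(1) by (auto simp: integral_manifold_def)
qed

text \<open>Every connected integral manifold lies in a single component of a level set, and these
  components are themselves connected integral manifolds. Hence they are exactly the maximal
  ones.\<close>

lemma leaf_iff: "leaf A D M \<longleftrightarrow> (\<exists>t. M \<in> components (level t))"
proof
  assume leaf: "leaf A D M"
  then obtain p where p: "p \<in> M" by (auto simp: leaf_def)
  let ?C = "connected_component_set (level (f p)) p"
  have M: "integral_manifold A D M" "connected M" using leaf by (auto simp: leaf_def)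
  have "p \<in> carrier A" using p M by (auto simp: integral_manifold_def)
  then have C: "?C \<in> components (level (f p))" by (auto intro: componentsI)
  have "?C = M"
    using leaf component_integral_manifold[OF C] in_components_connected[OF C] integral_manifold_component[OF M p]
    by (auto simp: leaf_def)
  then show "\<exists>t. M \<in> components (level t)" using C by auto
next
  assume "\<exists>t. M \<in> components (level t)"
  then obtain t where t: "M \<in> components (level t)" by blast
  obtain p where p: "p \<in> M" using in_components_nonempty[OF t] by blast
  have fp: "f p = t" using in_components_subset[OF t] p by auto
  have "M' = M" if M': "integral_manifold A D M'" "connected M'" "M \<subseteq> M'" for M'
  proof -
    have "p \<in> M'" using p M' by blast
    then have "M' \<subseteq> level t"
      using integral_manifold_component[OF M'(1,2)] connected_component_subset[of "level t" p] fp by blast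
    then have "M' \<subseteq> M" using components_maximal[OF t M'(2)] M'(3) p by blast
    then show ?thesis using M'(3) by blast
  qed
  then show "leaf A D M"
    unfolding leaf_def using component_integral_manifold[OF t] in_components_connected[OF t] p by blast
qed

lemma integrable_D: "integrable_distribution A D"
  unfolding integrable_distribution_def
proof
  fix p assume "p \<in> carrier A"
  then have p: "p \<in> level (f p)" by simp
  then have "connected_component_set (level (f p)) p \<in> components (level (f p))" by (rule componentsI)
  from component_integral_manifold[OF this] show "\<exists>M. integral_manifold A D M \<and> p \<in> M"
    using p connected_component_refl by (metis (no_types, lifting) mem_Collect_eq)
qed

end


section \<open>Null parallel vector fields\<close>

context nilpotent_soliton
begin

lemma nabla_scaled_N:
  assumes c: "c \<in> A" and S: "open S" "S \<subseteq> coords c UNIV" "x \<in> S" and \<psi>: "smooth_on S \<psi>"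
  shows "nabla (g c) X (\<lambda>y. \<psi> y *\<^sub>R N c y) x = der \<psi> x (X x) *\<^sub>R N c x + \<psi> x *\<^sub>R H c x (X x)"
proof -
  interpret coordinate_metric "g c" "coords c UNIV" by (rule coordinate_metric[OF c])
  have x: "x \<in> coords c UNIV" using S by blast
  have "((\<lambda>y. \<psi> y *\<^sub>R N c y) has_derivative (\<lambda>w. \<psi> x *\<^sub>R der (N c) x w + der \<psi> x w *\<^sub>R N c x)) (at x)"
    by (intro has_derivative_scaleR smooth_on_has_derivative[OF \<psi> S(3)] smooth_on_has_derivative[OF smooth_N[OF c] x])
  then show ?thesis
    unfolding nabla_def dir_deriv_def hess_op_eq
    by (simp add: der_eqI christoffel_simps[OF x] scaleR_add_right gradient_def)
qed

lemma scaled_N_null: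
  assumes "c \<in> A" "x \<in> coords c UNIV"
  shows "g c x (a *\<^sub>R N c x) (b *\<^sub>R N c x) = 0"
proof -
  interpret coordinate_metric "g c" "coords c UNIV" by (rule coordinate_metric[OF assms(1)])
  show ?thesis using N_null[OF assms] by (simp add: G_simps[OF assms(2)])
qed

lemma null_parallel_field_scaled_N:
  assumes W: "open W" "W \<subseteq> carrier A" "P \<in> W" and \<psi>: "smooth_fun A W \<psi>"
    and nz: "\<And>c x. c \<in> A \<Longrightarrow> x \<in> coords c W \<Longrightarrow> local_rep \<psi> c x \<noteq> 0"
    and par: "\<And>c x u. c \<in> A \<Longrightarrow> x \<in> coords c W \<Longrightarrow> nabla (g c) (\<lambda>_. u) (\<lambda>y. local_rep \<psi> c y *\<^sub>R N c y) x = 0"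
  shows "null_parallel_field A g W (\<lambda>c x. local_rep \<psi> c x *\<^sub>R N c x)"
  unfolding null_parallel_field_def
proof (intro conjI ballI allI)
  show "vector_field A W (\<lambda>c x. local_rep \<psi> c x *\<^sub>R N c x)"
    by (rule vector_field_scale[OF W(1) \<psi> vector_field_subset[OF vector_field_N W(2)]])
  obtain c where c: "c \<in> A" "P \<in> fst c" using W by (auto simp: carrier_def)
  have x: "snd c P \<in> coords c W" by (rule snd_in[OF c(2) W(3)])
  show "\<exists>c\<in>A. \<exists>x\<in>coords c W. local_rep \<psi> c x *\<^sub>R N c x \<noteq> 0"
    using nz[OF c(1) x] N_nonzero[OF c(1) coordsD(1)[OF c(1) x]] c(1) x by (intro bexI[of _ c] bexI[of _ "snd c P"]) auto
qed (use par scaled_N_null coordsD(1) in auto)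

text \<open>The last clause identifies the gradient of the displacement, carried over by \<phi>,
  with the failure of \<phi> to preserve N. It decides where the parallel field supplied by the
  other clauses is nonzero.\<close>

lemma isometry_displacement:
  assumes iso: "local_isometry A g W W' \<phi>"
  defines "u \<equiv> \<lambda>p. f (\<phi> p) - f p"
  shows "smooth_fun A W u"
    and "\<And>c x v. c \<in> A \<Longrightarrow> x \<in> coords c W \<Longrightarrow> nabla (g c) (\<lambda>_. v) (gradient g u c) x = 0"
    and "\<And>c x. c \<in> A \<Longrightarrow> x \<in> coords c W \<Longrightarrow> gradient g u c x \<in> span {N c x}"
    and "\<And>c c' x. c \<in> A \<Longrightarrow> c' \<in> A \<Longrightarrow> x \<in> coords c (W \<inter> \<phi> -` fst c') \<Longrightarrow>
      der (snd c' \<circ> \<phi> \<circ> chart_inv c) x (gradient g u c x)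
        = N c' ((snd c' \<circ> \<phi> \<circ> chart_inv c) x) - der (snd c' \<circ> \<phi> \<circ> chart_inv c) x (N c x)"
proof -
  have W: "open W" "W \<subseteq> carrier A" "\<phi> ` W \<subseteq> carrier A"
    using iso by (auto simp: local_isometry_def homeomorphism_def)
  have chart_at: "\<exists>c'\<in>A. x \<in> coords c (W \<inter> \<phi> -` fst c')" if c: "c \<in> A" and x: "x \<in> coords c W" for c x
  proof -
    have "\<phi> (chart_inv c x) \<in> carrier A" using W(3) coordsD(2)[OF c x] by blast
    then obtain c' where "c' \<in> A" "\<phi> (chart_inv c x) \<in> fst c'" by (auto simp: carrier_def)
    then show ?thesis using coordsD[OF c x] coords_iff[OF c, of x "W \<inter> \<phi> -` fst c'"] by blast
  qed
  \<comment> \<open>A coordinate expression of \<phi> exists only where \<phi> lands in the domain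
    of \<open>c'\<close>. All claims are therefore proved on these open pieces, which cover W by
    \<open>chart_at\<close>.\<close>
  have main: "open (coords c (W \<inter> \<phi> -` fst c')) \<and> smooth_on (coords c (W \<inter> \<phi> -` fst c')) (local_rep u c) \<and>
      nabla (g c) (\<lambda>_. v) (gradient g u c) x = 0 \<and> gradient g u c x \<in> span {N c x} \<and>
      der (snd c' \<circ> \<phi> \<circ> chart_inv c) x (gradient g u c x)
        = N c' ((snd c' \<circ> \<phi> \<circ> chart_inv c) x) - der (snd c' \<circ> \<phi> \<circ> chart_inv c) x (N c x)"
    if c: "c \<in> A" "c' \<in> A" and x: "x \<in> coords c (W \<inter> \<phi> -` fst c')" for c c' x v
  proof -
    let ?T = "coords c (W \<inter> \<phi> -` fst c')" and ?\<psi> = "snd c' \<circ> \<phi> \<circ> chart_inv c"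
    let ?f = "local_rep f c" and ?f' = "local_rep f c'"
    note ci = local_isometry_coordinates[OF c iso]
    interpret coordinate_isometry "g c" "coords c UNIV" "g c'" "coords c' UNIV" ?\<psi> ?T by (rule ci)
    interpret T: coordinate_metric "g c" ?T
      by (rule coordinate_metric_subset[OF coordinate_metric[OF c(1)] open_T T_S])
    let ?k = "\<lambda>y. ?f' (?\<psi> y)"
    have k: "smooth_on ?T ?k" by (rule smooth_pullback[OF smooth_rep[OF c(2)]])
    have sf: "smooth_on ?T ?f" by (rule smooth_on_subset[OF smooth_rep[OF c(1)] T_S])
    have u: "local_rep u c y = ?k y - ?f y" if "y \<in> ?T" for y
      using coordsD(2)[OF c(1) that] c(2) by (simp add: u_def local_rep_def)
    have su: "smooth_on ?T (local_rep u c)"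
      by (rule smooth_on_cong[THEN iffD2, OF open_T _ smooth_on_diff[OF open_T k sf]]) (rule u)
    have du: "der (local_rep u c) y v = der ?k y v - der ?f y v" if "y \<in> ?T" for y v
      using frechet_derivative_cong_open[OF open_T that u]
        der_eqI[OF has_derivative_diff[OF smooth_on_has_derivative[OF k that] smooth_on_has_derivative[OF sf that]]]
      by simp
    have ddu: "der (\<lambda>y. der (local_rep u c) y v) x w = der (\<lambda>y. der ?k y v) x w - der (\<lambda>y. der ?f y v) x w" for v w
      using frechet_derivative_cong_open[OF open_T x du]
        der_eqI[OF has_derivative_diff[OF smooth_on_has_derivative[OF smooth_on_frechet_derivative[OF k] x]
            smooth_on_has_derivative[OF smooth_on_frechet_derivative[OF sf] x]]]
      by simp
    have x': "x \<in> coords c UNIV" and y': "?\<psi> x \<in> coords c' UNIV" using in_S[OF x] \<phi>_in[OF x] by auto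
    have hk: "hess (g c) ?k (\<lambda>_. a) (\<lambda>_. b) x = hess (g c) ?f (\<lambda>_. a) (\<lambda>_. b) x" for a b
      unfolding hess_pullback[OF x smooth_rep[OF c(2)]] hess_ricci[OF c(2) y'] hess_ricci[OF c(1) x'] ricci_pullback[OF x] ..
    have hu: "hess (g c) (local_rep u c) (\<lambda>_. a) (\<lambda>_. b) x = 0" for a b
      using hk[of a b] unfolding T.hess_const by (simp add: ddu du[OF x])
    have "hess_op (g c) (local_rep u c) x v = 0"
      by (rule lorentzian_nondegenerate[OF T.lorentzian[OF x]]) (simp add: T.G_hess_op[OF x su] hu)
    then have 1: "nabla (g c) (\<lambda>_. v) (gradient g u c) x = 0" by (simp add: hess_op_def gradient_def)
    have gu: "gradient g u c x = grad (g c) ?k x - N c x"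
    proof (rule T.G_eqI[OF x])
      fix w
      show "g c x (gradient g u c x) w = g c x (grad (g c) ?k x - N c x) w"
        unfolding gradient_def T.G_simps[OF x] T.G_grad[OF x su x] T.G_grad[OF x k x] T.G_grad[OF x sf x] du[OF x] ..
    qed
    have gk: "der ?\<psi> x (grad (g c) ?k x) = N c' (?\<psi> x)"
      unfolding grad_pullback[OF x smooth_rep[OF c(2)]] by (simp add: gradient_def)
    \<comment> \<open>The image of H is the line of N at both ends, and \<phi> intertwines the two
      operators. So the pulled back gradient, being carried to N at the image point, lies in the
      image of H at x.\<close>
    have "N c' (?\<psi> x) \<in> range (H c' (?\<psi> x))"
      unfolding range_H[OF c(2) y'] by (rule span_base) simp
    then obtain w where w: "N c' (?\<psi> x) = H c' (?\<psi> x) w" by blast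
    obtain w' where "w = der ?\<psi> x w'" using surjD[OF d\<phi>_surj[OF x]] by metis
    then have "der ?\<psi> x (grad (g c) ?k x) = der ?\<psi> x (H c x w')"
      using gk w H_pullback[OF c order_refl order_refl ci x] by simp
    then have "grad (g c) ?k x = H c x w'" using d\<phi>_inj[OF x] by (simp add: inj_eq)
    then have "grad (g c) ?k x \<in> span {N c x}" using range_H[OF c(1) x'] by blast
    then have 2: "gradient g u c x \<in> span {N c x}"
      unfolding gu by (intro span_diff) (auto intro: span_base)
    show ?thesis using open_T su 1 2 gk gu by (simp add: d\<phi>_simps[OF x])
  qed
  show "smooth_fun A W u"
    unfolding smooth_fun_def
  proof
    fix c assume c: "c \<in> A"
    show "smooth_on (coords c W) (local_rep u c)"
    proof (rule smooth_on_local)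
      fix x assume "x \<in> coords c W"
      then obtain c' where c': "c' \<in> A" "x \<in> coords c (W \<inter> \<phi> -` fst c')" using chart_at[OF c] by blast
      then show "\<exists>T. open T \<and> x \<in> T \<and> smooth_on T (local_rep u c)"
        using main[OF c c'] by blast
    qed
  qed
  show "nabla (g c) (\<lambda>_. v) (gradient g u c) x = 0" "gradient g u c x \<in> span {N c x}"
    if c: "c \<in> A" and x: "x \<in> coords c W" for c x v
    using chart_at[OF c x] main[OF c] by blast+
  show "der (snd c' \<circ> \<phi> \<circ> chart_inv c) x (gradient g u c x)
        = N c' ((snd c' \<circ> \<phi> \<circ> chart_inv c) x) - der (snd c' \<circ> \<phi> \<circ> chart_inv c) x (N c x)"
    if "c \<in> A" "c' \<in> A" "x \<in> coords c (W \<inter> \<phi> -` fst c')" for c c' x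
    using main[OF that] by blast
qed

text \<open>The parallel field is the gradient of the displacement, nonzero at P by
  \<open>moved\<close>, and \<psi> is its coefficient along N. U is taken inside one chart because
  that chart serves to define \<psi> on points.\<close>

lemma parallel_multiple_from_isometry:
  assumes iso: "local_isometry A g W W' \<phi>" and P: "P \<in> W" and c: "c \<in> A" "c' \<in> A" "P \<in> fst c" "\<phi> P \<in> fst c'"
    and moved: "der (snd c' \<circ> \<phi> \<circ> chart_inv c) (snd c P) (N c (snd c P)) \<noteq> N c' (snd c' (\<phi> P))"
  obtains U \<psi> where "open U" "connected U" "P \<in> U" "U \<subseteq> carrier A" "smooth_fun A U \<psi>"
    "null_parallel_field A g U (\<lambda>c x. local_rep \<psi> c x *\<^sub>R N c x)"
    "\<And>c x. c \<in> A \<Longrightarrow> x \<in> coords c U \<Longrightarrow> local_rep \<psi> c x \<noteq> 0"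
proof -
  define u where "u = (\<lambda>p. f (\<phi> p) - f p)"
  let ?V = "gradient g u"
  note disp = isometry_displacement[OF iso, folded u_def]
  have W: "open W" "W \<subseteq> carrier A" using iso by (auto simp: local_isometry_def)
  have V: "vector_field A W ?V" by (rule vector_field_gradient[OF W(1) disp(1)])
  let ?x = "snd c P"
  have x: "?x \<in> coords c (W \<inter> \<phi> -` fst c')" using P c by (intro snd_in) auto
  interpret iso: coordinate_isometry "g c" "coords c UNIV" "g c'" "coords c' UNIV" "snd c' \<circ> \<phi> \<circ> chart_inv c"
    "coords c (W \<inter> \<phi> -` fst c')"
    by (rule local_isometry_coordinates[OF c(1,2) iso])
  have "?V c ?x \<noteq> 0"
    using disp(4)[OF c(1,2) x] moved c iso.d\<phi>_simps(4)[OF x] by auto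
  \<comment> \<open>Shrinking to the open set where the gradient is nonzero makes \<psi> nowhere
    zero on U.\<close>
  define S where "S = {y \<in> coords c W. ?V c y \<noteq> 0}"
  have "open (?V c -` (- {0}) \<inter> coords c W)"
    by (rule continuous_on_open_vimage[THEN iffD1, rule_format, OF open_coords[OF c(1) W(1)] smooth_on_imp_continuous_on])
       (use V c in \<open>auto simp: vector_field_def\<close>)
  moreover have "?V c -` (- {0}) \<inter> coords c W = S" by (auto simp: S_def)
  ultimately have S: "open S" "S \<subseteq> coords c UNIV" "?x \<in> S"
    using \<open>?V c ?x \<noteq> 0\<close> coords_subset[of c W] snd_in[OF c(3) P] by (auto simp: S_def)
  obtain U where U: "open U" "connected U" "P \<in> U" "U \<subseteq> fst c" "coords c U \<subseteq> S"
    by (rule connected_neighbourhood[OF c(1,3) S])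
  have UW: "U \<subseteq> W"
  proof
    fix p assume p: "p \<in> U"
    then have "snd c p \<in> coords c W" using U snd_in[of p c U] by (auto simp: S_def)
    then show "p \<in> W" using coordsD(2)[OF c(1)] c(1) p U(4) by fastforce
  qed
  have UA: "U \<subseteq> carrier A" using UW W by blast
  have sub: "coords c'' U \<subseteq> coords c'' W" for c'' :: "('m, 'd) chart" by (rule coords_mono[OF UW])
  obtain \<psi> where \<psi>: "smooth_fun A U \<psi>"
    and V\<psi>: "\<And>c x. c \<in> A \<Longrightarrow> x \<in> coords c U \<Longrightarrow> ?V c x = local_rep \<psi> c x *\<^sub>R N c x"
  proof (rule proportional_vector_field[OF U(1,4) c(1) vector_field_subset[OF V UW] vector_field_subset[OF vector_field_N UA]])
    show "N c x \<noteq> 0" if "c \<in> A" "x \<in> coords c U" for c x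
      using N_nonzero[OF that(1) coordsD(1)[OF that]] .
    show "?V c x \<in> span {N c x}" if "c \<in> A" "x \<in> coords c U" for c x
      using disp(3)[OF that(1)] that(2) sub by blast
  qed (rule that)
  have nz: "local_rep \<psi> c'' y \<noteq> 0" if c'': "c'' \<in> A" and y: "y \<in> coords c'' U" for c'' y
  proof
    assume "local_rep \<psi> c'' y = 0"
    let ?p = "chart_inv c'' y"
    have p: "?p \<in> U" by (rule coordsD(2)[OF c'' y])
    have z: "snd c ?p \<in> coords c U" using p U(4) by (intro snd_in) auto
    have "local_rep \<psi> c (snd c ?p) = 0"
      using \<open>local_rep \<psi> c'' y = 0\<close> p U(4) c(1) by (auto simp: local_rep_def)
    then have "?V c (snd c ?p) = 0" using V\<psi>[OF c(1) z] by simp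
    then show False using z U(5) by (auto simp: S_def)
  qed
  have "null_parallel_field A g U (\<lambda>c x. local_rep \<psi> c x *\<^sub>R N c x)"
  proof (rule null_parallel_field_scaled_N[OF U(1) UA U(3) \<psi> nz])
    fix c x v assume c: "c \<in> A" and x: "x \<in> coords c U"
    have "nabla (g c) (\<lambda>_. v) (\<lambda>y. local_rep \<psi> c y *\<^sub>R N c y) x = nabla (g c) (\<lambda>_. v) (?V c) x"
      by (rule nabla_cong_open[OF open_coords[OF c U(1)] x]) (simp add: V\<psi>[OF c])
    then show "nabla (g c) (\<lambda>_. v) (\<lambda>y. local_rep \<psi> c y *\<^sub>R N c y) x = 0"
      by (simp only: disp(2)[OF c subsetD[OF sub x]])
  qed
  then show ?thesis using that[OF U(1,2,3) UA \<psi> _ nz] by blast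
qed

text \<open>The coefficient is computed once, at P. Every other point is the image of P under a
  local isometry, which intertwines H, preserves g and, by \<open>fixed\<close>, carries N to N; so
  the same number appears there.\<close>

lemma constant_coefficient:
  assumes P: "P \<in> fst c" "c \<in> A"
    and fixed: "\<And>W W' \<phi> c'. local_isometry A g W W' \<phi> \<Longrightarrow> P \<in> W \<Longrightarrow> c' \<in> A \<Longrightarrow> \<phi> P \<in> fst c' \<Longrightarrow>
      der (snd c' \<circ> \<phi> \<circ> chart_inv c) (snd c P) (N c (snd c P)) = N c' (snd c' (\<phi> P))"
  obtains a where "\<And>c x u. c \<in> A \<Longrightarrow> x \<in> coords c UNIV \<Longrightarrow> H c x u = (a * der (local_rep f c) x u) *\<^sub>R N c x"
proof -
  let ?x = "snd c P"
  have x: "?x \<in> coords c UNIV" using P by (intro snd_in) auto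
  interpret null_self_adjoint "g c ?x" "H c ?x" "N c ?x" by (rule null_self_adjoint[OF P(2) x])
  obtain U where U: "g c ?x U (N c ?x) = 1" using exists_transversal by blast
  \<comment> \<open>H vanishes on the complement of N at this point, so H u depends only on g(u, N),
    and its value on one vector with g(U, N) = 1 determines it.\<close>
  define a where "a = \<omega> c ?x U"
  have base: "H c ?x u = (a * g c ?x u (N c ?x)) *\<^sub>R N c ?x" for u
  proof -
    have "g c ?x (u - g c ?x u (N c ?x) *\<^sub>R U) (N c ?x) = 0"
      using U by (simp add: linear_diff[OF Br] linear_cmul[OF Br])
    then have "H c ?x (u - g c ?x u (N c ?x) *\<^sub>R U) = 0"
      using kernel_H[OF P(2) x] by (auto simp: orthogonal_distribution_def)
    then have "H c ?x u = g c ?x u (N c ?x) *\<^sub>R H c ?x U"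
      by (simp add: linear_diff[OF H] linear_cmul[OF H])
    then show ?thesis unfolding H_\<omega>[OF P(2) x, of U] a_def by (simp add: mult.commute)
  qed
  show ?thesis
  proof (rule that[of a])
    fix c' x' v assume c': "c' \<in> A" and x': "x' \<in> coords c' UNIV"
    obtain W W' \<phi> where \<phi>: "local_isometry A g W W' \<phi>" "chart_inv c ?x \<in> W" "\<phi> (chart_inv c ?x) = chart_inv c' x'"
      "?x \<in> coords c (W \<inter> \<phi> -` fst c')" "(snd c' \<circ> \<phi> \<circ> chart_inv c) ?x = x'"
      by (rule homogeneous_coordinates[OF P(2) c' x x'])
    let ?\<psi> = "snd c' \<circ> \<phi> \<circ> chart_inv c"
    note ci = local_isometry_coordinates[OF P(2) c' \<phi>(1)]
    interpret iso: coordinate_isometry "g c" "coords c UNIV" "g c'" "coords c' UNIV" ?\<psi> "coords c (W \<inter> \<phi> -` fst c')"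
      by (rule ci)
    have inv: "chart_inv c ?x = P" using P by simp
    have N': "der ?\<psi> ?x (N c ?x) = N c' x'"
      using fixed[OF \<phi>(1) _ c'] \<phi>(2,3) chart_inv_in[OF c' x'] x' c' unfolding inv by simp
    obtain u where u: "v = der ?\<psi> ?x u" using surjD[OF iso.d\<phi>_surj[OF \<phi>(4)]] by metis
    have "H c' x' v = der ?\<psi> ?x (H c ?x u)"
      using H_pullback[OF P(2) c' order_refl order_refl ci \<phi>(4), of u] \<phi>(5) u by simp
    also have "\<dots> = (a * g c ?x u (N c ?x)) *\<^sub>R N c' x'"
      unfolding base[of u] N'[symmetric] by (simp add: iso.d\<phi>_simps[OF \<phi>(4)])
    also have "g c ?x u (N c ?x) = g c' x' v (N c' x')"
      using iso.isometry[OF \<phi>(4), of u "N c ?x"] unfolding N' u \<phi>(5) by simp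
    finally show "H c' x' v = (a * der (local_rep f c') x' v) *\<^sub>R N c' x'"
      by (simp add: dual_N(2)[OF c' x'])
  qed
qed

text \<open>Besides alternative (ii), the nonvanishing of \<psi> on all of U is recorded: the strict
  Walker property requires the parallel field to span the line field at every point.\<close>

lemma exists_parallel_multiple:
  assumes P: "P \<in> carrier A"
  obtains U \<psi> where "open U" "connected U" "P \<in> U" "U \<subseteq> carrier A" "smooth_fun A U \<psi>"
    "null_parallel_field A g U (\<lambda>c x. local_rep \<psi> c x *\<^sub>R N c x)"
    "\<And>c x. c \<in> A \<Longrightarrow> x \<in> coords c U \<Longrightarrow> local_rep \<psi> c x \<noteq> 0"
proof -
  obtain c where c: "c \<in> A" "P \<in> fst c" using P by (auto simp: carrier_def)
  show ?thesis
  proof (cases "\<exists>W W' \<phi> c'. local_isometry A g W W' \<phi> \<and> P \<in> W \<and> c' \<in> A \<and> \<phi> P \<in> fst c' \<and>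
      der (snd c' \<circ> \<phi> \<circ> chart_inv c) (snd c P) (N c (snd c P)) \<noteq> N c' (snd c' (\<phi> P))")
    case True
    then obtain W W' \<phi> c' where "local_isometry A g W W' \<phi>" "P \<in> W" "c' \<in> A" "\<phi> P \<in> fst c'"
      "der (snd c' \<circ> \<phi> \<circ> chart_inv c) (snd c P) (N c (snd c P)) \<noteq> N c' (snd c' (\<phi> P))" by blast
    then show ?thesis using parallel_multiple_from_isometry[OF _ _ c(1) _ c(2)] that by blast
  next
    case False
    obtain a where a: "\<And>c x u. c \<in> A \<Longrightarrow> x \<in> coords c UNIV \<Longrightarrow> H c x u = (a * der (local_rep f c) x u) *\<^sub>R N c x"
      by (rule constant_coefficient[OF c(2,1)]) (use False in blast)+
    \<comment> \<open>A solution of d\<psi> = - a \<psi> df, so that the two terms of the covariant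
      derivative of \<psi> N cancel.\<close>
    define \<psi> where "\<psi> p = exp (- a * f p)" for p
    have rep: "local_rep \<psi> c = (\<lambda>y. exp (- a * local_rep f c y))" for c :: "('m, 'd) chart"
      by (auto simp: local_rep_def \<psi>_def)
    have sm: "smooth_on (coords c UNIV) (local_rep \<psi> c)" if "c \<in> A" for c
      unfolding rep by (intro smooth_on_exp smooth_on_mult smooth_on_const smooth_rep chart(2) that)
    obtain U where U: "open U" "connected U" "P \<in> U" "U \<subseteq> fst c" "coords c U \<subseteq> coords c UNIV"
      by (rule connected_neighbourhood[OF c chart(2)[OF c(1)] order_refl]) (use c in \<open>auto intro: snd_in\<close>)
    have UA: "U \<subseteq> carrier A" using U(4) c(1) by (auto simp: carrier_def)
    have \<psi>: "smooth_fun A U \<psi>" unfolding smooth_fun_def using sm smooth_on_subset coords_subset by blast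
    have nz: "local_rep \<psi> c x \<noteq> 0" for c :: "('m, 'd) chart" and x by (simp add: rep)
    have "null_parallel_field A g U (\<lambda>c x. local_rep \<psi> c x *\<^sub>R N c x)"
    proof (rule null_parallel_field_scaled_N[OF U(1) UA U(3) \<psi> nz])
      fix c x u assume c: "c \<in> A" and "x \<in> coords c U"
      then have x: "x \<in> coords c UNIV" using coordsD(1) by blast
      have "(local_rep \<psi> c has_derivative (\<lambda>w. exp (- a * local_rep f c x) * (- a * der (local_rep f c) x w))) (at x)"
        unfolding rep using smooth_on_has_derivative[OF smooth_rep[OF c] x]
        by (auto intro!: derivative_eq_intros)
      then show "nabla (g c) (\<lambda>_. u) (\<lambda>y. local_rep \<psi> c y *\<^sub>R N c y) x = 0"
        unfolding nabla_scaled_N[OF c chart(2)[OF c] order_refl x sm[OF c]]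
        by (simp add: der_eqI a[OF c x] rep flip: scaleR_add_left)
    qed
    then show ?thesis using that[OF U(1,2,3) UA \<psi> _ nz] by blast
  qed
qed

text \<open>The line field is spanned by N, and equally by the parallel multiple since \<psi> is
  nonzero. A section has the form q N, and \<nabla>_X (q N) = (dq(X) + q \<omega>(X)) N stays in the
  line.\<close>

lemma strict_walker_from_multiple:
  assumes W: "open W" "W \<subseteq> carrier A"
    and par: "null_parallel_field A g W (\<lambda>c x. local_rep \<psi> c x *\<^sub>R N c x)"
    and nz: "\<And>c x. c \<in> A \<Longrightarrow> x \<in> coords c W \<Longrightarrow> local_rep \<psi> c x \<noteq> 0"
  shows "strict_walker A g W"
  unfolding strict_walker_def
proof (intro exI conjI ballI)
  let ?L = "\<lambda>c x. span {N c x}"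
  show "null_parallel_field A g W (\<lambda>c x. local_rep \<psi> c x *\<^sub>R N c x)" by (rule par)
  show "?L c x = span {local_rep \<psi> c x *\<^sub>R N c x}" if "c \<in> A" "x \<in> coords c W" for c x
    using nz[OF that] by (auto simp: span_singleton image_iff) (metis divide_self_if mult.commute nonzero_eq_divide_eq times_divide_eq_right)
  show "g c x v v = 0" if "c \<in> A" "x \<in> coords c W" "v \<in> ?L c x" for c x v
    using that scaled_N_null[OF that(1) coordsD(1)[OF that(1,2)]] by (auto simp: span_singleton)
  show "distribution A W 1 ?L"
    unfolding distribution_def
  proof (intro conjI ballI)
    fix c x assume c: "c \<in> A" and x: "x \<in> coords c W"
    show "subspace (?L c x)" by simp
    show "dim (?L c x) = 1" using N_nonzero[OF c coordsD(1)[OF c x]] by simp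
    show "\<exists>S B. open S \<and> x \<in> S \<and> S \<subseteq> coords c W \<and> (\<forall>i<1. smooth_on S (B i)) \<and>
        (\<forall>y\<in>S. ?L c y = span ((\<lambda>i. B i y) ` {..<1::nat}))"
      by (intro exI[of _ "coords c W"] exI[of _ "\<lambda>_. N c"])
         (use x open_coords[OF c W(1)] smooth_on_subset[OF smooth_N[OF c] coords_subset] in \<open>auto simp: lessThan_Suc\<close>)
  next
    fix c c' x assume c: "c \<in> A" "c' \<in> A" and x: "x \<in> coords c (fst c' \<inter> W)"
    interpret coordinate_isometry "g c" "coords c W" "g c'" "coords c' W" "transition c c'" "coords c (fst c' \<inter> W)"
      by (rule transition_isometry[OF c W(1)])
    have "N c' (transition c c' x) = der (transition c c') x (N c x)"
      using vector_field_subset[OF vector_field_N W(2)] c x by (simp add: vector_field_def)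
    then show "der (transition c c') x ` ?L c x = ?L c' (transition c c' x)"
      using linear_span_image[OF d\<phi>_linear[OF x], of "{N c x}"] by simp
  qed
  show "parallel_distribution A g W ?L"
    unfolding parallel_distribution_def
  proof (intro allI impI ballI, elim conjE)
    fix U X Y c x assume U: "open U" "U \<subseteq> W" and Y: "section_of A U ?L Y" and c: "c \<in> A" and x: "x \<in> coords c U"
    have x': "x \<in> coords c UNIV" by (rule coordsD(1)[OF c x])
    have oU: "open (coords c U)" by (rule open_coords[OF c U(1)])
    define q where "q y = (Y c y \<bullet> N c y) / (N c y \<bullet> N c y)" for y
    have "smooth_on (coords c U) q"
      unfolding q_def using Y c N_nonzero[OF c coordsD(1)[OF c]]
      by (intro smooth_on_divide smooth_on_inner oU smooth_on_subset[OF smooth_N[OF c] coords_subset])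
         (auto simp: section_of_def vector_field_def)
    note nabla = nabla_scaled_N[OF c oU coords_subset x this, of "X c"]
    have "Y c y = q y *\<^sub>R N c y" if "y \<in> coords c U" for y
    proof -
      have "Y c y \<in> span {N c y}" using Y c that by (auto simp: section_of_def)
      then show ?thesis using N_nonzero[OF c coordsD(1)[OF c that]] by (auto simp: span_singleton q_def)
    qed
    then have "nabla (g c) (X c) (Y c) x = nabla (g c) (X c) (\<lambda>y. q y *\<^sub>R N c y) x"
      by (rule nabla_cong_open[OF oU x])
    also have "\<dots> = (der q x (X c x) + q x * \<omega> c x (X c x)) *\<^sub>R N c x"
      unfolding nabla H_\<omega>[OF c x'] by (simp add: scaleR_add_left)
    also have "\<dots> \<in> ?L c x" by (intro span_mul span_base) simp
    finally show "nabla (g c) (X c) (Y c) x \<in> ?L c x" .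
  qed
qed

lemma locally_strict_walker: "locally_strict_walker A g"
  unfolding locally_strict_walker_def
proof
  fix p assume "p \<in> carrier A"
  then obtain U \<psi> where "open U" "connected U" "p \<in> U" "U \<subseteq> carrier A" "smooth_fun A U \<psi>"
    "null_parallel_field A g U (\<lambda>c x. local_rep \<psi> c x *\<^sub>R N c x)"
    "\<And>c x. c \<in> A \<Longrightarrow> x \<in> coords c U \<Longrightarrow> local_rep \<psi> c x \<noteq> 0"
    by (rule exists_parallel_multiple) (rule that)
  then show "\<exists>W. open W \<and> p \<in> W \<and> W \<subseteq> carrier A \<and> strict_walker A g W"
    using strict_walker_from_multiple by blast
qed

end

theorem theorem8:
  fixes A :: "('m::{t2_space, second_countable_topology}, 'd::finite) chart set"
    and g :: "('m, 'd) metric"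
    and f :: "'m \<Rightarrow> real"
    and n :: nat
  assumes dimension: "CARD('d) = n + 2" "n \<ge> 1"
    and lorentzian: "lorentzian_manifold A g"
    and homogeneous: "locally_homogeneous A g"
    and soliton: "steady_gradient_ricci_soliton A g f"
    and isotropic: "\<forall>c\<in>A. \<forall>x\<in>coords c UNIV. g c x (gradient g f c x) (gradient g f c x) = 0"
    and gradient_nonzero: "\<forall>c\<in>A. \<forall>x\<in>coords c UNIV. gradient g f c x \<noteq> 0"
    and not_ricci_flat: "\<exists>c\<in>A. \<exists>x\<in>coords c UNIV. ricci_op (g c) x \<noteq> (\<lambda>_. 0)"
  shows
    "(\<forall>c\<in>A. \<forall>x\<in>coords c UNIV. \<forall>u. hess_op (g c) (local_rep f c) x u = - ricci_op (g c) x u) \<and>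
     ((\<forall>c\<in>A. \<forall>x\<in>coords c UNIV.
         endo_rank (hess_op (g c) (local_rep f c) x) = 2 \<and>
         nilpotent_step 3 (hess_op (g c) (local_rep f c) x))
      \<or>
      ((\<forall>c\<in>A. \<forall>x\<in>coords c UNIV.
         endo_rank (hess_op (g c) (local_rep f c) x) = 1 \<and>
         nilpotent_step 2 (hess_op (g c) (local_rep f c) x)) \<and>
       locally_strict_walker A g \<and>
       (\<forall>c\<in>A. \<forall>x\<in>coords c UNIV.
         {v. hess_op (g c) (local_rep f c) x v = 0} = orthogonal_distribution g (gradient g f) c x \<and>
         range (hess_op (g c) (local_rep f c) x) = span {gradient g f c x}) \<and>
       recurrent_field A g (carrier A) (gradient g f) \<and>
       distribution A (carrier A) (n + 1) (orthogonal_distribution g (gradient g f)) \<and>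
       integrable_distribution A (orthogonal_distribution g (gradient g f)) \<and>
       totally_geodesic_distribution A g (carrier A) (orthogonal_distribution g (gradient g f)) \<and>
       (\<forall>N. leaf A (orthogonal_distribution g (gradient g f)) N \<longleftrightarrow>
          (\<exists>t. N \<in> components {p \<in> carrier A. f p = t})) \<and>
       (\<forall>P\<in>carrier A. \<exists>W. open W \<and> connected W \<and> P \<in> W \<and> W \<subseteq> carrier A \<and>
          ((\<exists>F. killing_field A g W F \<and> null_parallel_field A g W (gradient_along g F f)) \<or>
           (\<exists>\<psi>. smooth_fun A W \<psi> \<and>
              null_parallel_field A g W (\<lambda>c x. local_rep \<psi> c x *\<^sub>R gradient g f c x))))))"
proof (intro conjI)
  interpret isotropic_soliton A g f
    by unfold_locales (fact lorentzian homogeneous soliton isotropic gradient_nonzero not_ricci_flat)+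
  show "\<forall>c\<in>A. \<forall>x\<in>coords c UNIV. \<forall>u. hess_op (g c) (local_rep f c) x u = - ricci_op (g c) x u"
    using H_ricci by blast
  from H_dichotomy
  show "(\<forall>c\<in>A. \<forall>x\<in>coords c UNIV.
         endo_rank (hess_op (g c) (local_rep f c) x) = 2 \<and>
         nilpotent_step 3 (hess_op (g c) (local_rep f c) x))
      \<or>
      ((\<forall>c\<in>A. \<forall>x\<in>coords c UNIV.
         endo_rank (hess_op (g c) (local_rep f c) x) = 1 \<and>
         nilpotent_step 2 (hess_op (g c) (local_rep f c) x)) \<and>
       locally_strict_walker A g \<and>
       (\<forall>c\<in>A. \<forall>x\<in>coords c UNIV.
         {v. hess_op (g c) (local_rep f c) x v = 0} = orthogonal_distribution g (gradient g f) c x \<and>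
         range (hess_op (g c) (local_rep f c) x) = span {gradient g f c x}) \<and>
       recurrent_field A g (carrier A) (gradient g f) \<and>
       distribution A (carrier A) (n + 1) (orthogonal_distribution g (gradient g f)) \<and>
       integrable_distribution A (orthogonal_distribution g (gradient g f)) \<and>
       totally_geodesic_distribution A g (carrier A) (orthogonal_distribution g (gradient g f)) \<and>
       (\<forall>N. leaf A (orthogonal_distribution g (gradient g f)) N \<longleftrightarrow>
          (\<exists>t. N \<in> components {p \<in> carrier A. f p = t})) \<and>
       (\<forall>P\<in>carrier A. \<exists>W. open W \<and> connected W \<and> P \<in> W \<and> W \<subseteq> carrier A \<and>
          ((\<exists>F. killing_field A g W F \<and> null_parallel_field A g W (gradient_along g F f)) \<or>
           (\<exists>\<psi>. smooth_fun A W \<psi> \<and>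
              null_parallel_field A g W (\<lambda>c x. local_rep \<psi> c x *\<^sub>R gradient g f c x)))))"
  \<comment> \<open>The rank two alternative is passed on unchanged; only the alternative H^2 = 0 is
    refined.\<close>
  proof (rule disj_forward)
    assume "\<forall>c\<in>A. \<forall>x\<in>coords c UNIV. \<forall>u. H c x (H c x u) = 0"
    then interpret nilpotent_soliton A g f by unfold_locales
    show "(\<forall>c\<in>A. \<forall>x\<in>coords c UNIV. endo_rank (H c x) = 1 \<and> nilpotent_step 2 (H c x)) \<and>
       locally_strict_walker A g \<and>
       (\<forall>c\<in>A. \<forall>x\<in>coords c UNIV. {v. H c x v = 0} = D c x \<and> range (H c x) = span {N c x}) \<and>
       recurrent_field A g (carrier A) N \<and> distribution A (carrier A) (n + 1) D \<and>
       integrable_distribution A D \<and> totally_geodesic_distribution A g (carrier A) D \<and>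
       (\<forall>M. leaf A D M \<longleftrightarrow> (\<exists>t. M \<in> components (level t))) \<and>
       (\<forall>P\<in>carrier A. \<exists>W. open W \<and> connected W \<and> P \<in> W \<and> W \<subseteq> carrier A \<and>
          ((\<exists>F. killing_field A g W F \<and> null_parallel_field A g W (gradient_along g F f)) \<or>
           (\<exists>\<psi>. smooth_fun A W \<psi> \<and> null_parallel_field A g W (\<lambda>c x. local_rep \<psi> c x *\<^sub>R N c x))))"
    proof (intro conjI ballI allI)
      show "distribution A (carrier A) (n + 1) D" using dimension by (intro distribution_D) simp
      fix P assume "P \<in> carrier A"
      then obtain U \<psi> where "open U" "connected U" "P \<in> U" "U \<subseteq> carrier A" "smooth_fun A U \<psi>"
        "null_parallel_field A g U (\<lambda>c x. local_rep \<psi> c x *\<^sub>R N c x)"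
        "\<And>c x. c \<in> A \<Longrightarrow> x \<in> coords c U \<Longrightarrow> local_rep \<psi> c x \<noteq> 0"
        by (rule exists_parallel_multiple) (rule that)
      then show "\<exists>W. open W \<and> connected W \<and> P \<in> W \<and> W \<subseteq> carrier A \<and>
          ((\<exists>F. killing_field A g W F \<and> null_parallel_field A g W (gradient_along g F f)) \<or>
           (\<exists>\<psi>. smooth_fun A W \<psi> \<and> null_parallel_field A g W (\<lambda>c x. local_rep \<psi> c x *\<^sub>R N c x)))"
        by blast
    qed (use rank_one locally_strict_walker kernel_H range_H recurrent_N integrable_D totally_geodesic_D leaf_iff in blast)+
  qed
qed

end
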